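(* Let $\mathcal A=\{A_i\}_{i=1}^n$ be an (oriented) affine hyperplane arrangement in $\mathbb R^{k-1}$ whose normals affinely span $\mathbb R^{k-1}$. Suppose $R_{\boldsymbol+}$ is bounded and let $N$ be an affine subspace of $\mathbb R^{k-1}$ of dimension $l-1$. Then the following hold: (1) If $R_{\boldsymbol+}\cap N\neq\emptyset$, then for all $\mathbf b\in\{-,+\}^n$ with $\mathbf b\neq\boldsymbol+,\boldsymbol-$: $N\cap\Lambda_{\mathcal A}(\mathbf b)\neq\emptyset$ implies $\widetilde H^\bullet(N\cap\Lambda_{\mathcal A}(\mathbf b))=0$. (2) If $\overline{R_{\boldsymbol+}}\cap N=\emptyset$, then for each $j\in[0,l-2]$ there exists $\mathbf b\neq\boldsymbol+,\boldsymbol-$ such that $N\cap\Lambda_{\mathcal A}(\mathbf b)\neq\emptyset$ and $\widetilde H^j(N\cap\Lambda_{\mathcal A}(\mathbf b))\neq0$.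
   Context: $\widetilde H$ denotes reduced cohomology with coefficients in a fixed field $\Bbbk$; $j$ is an integer. Each hyperplane $A_i$ is oriented, i.e. has a chosen positive side. For $\mathbf b\in\{-,+\}^n$, $R_{\mathbf b}\subseteq\mathbb R^{k-1}$ is the open region lying on the $\mathbf b_i$ side of $A_i$ for every $i$; $\boldsymbol+,\boldsymbol-$ are the constant sign vectors; $\overline{R_{\boldsymbol+}}$ is the closure of $R_{\boldsymbol+}$. $\mathbb R^{k-1}$ is compactified by a "sphere at infinity": identify $x\in\mathbb R^{k-1}$ with $(x,1)/\|(x,1)\|$ in the open upper hemisphere of $S^{k-1}\subset\mathbb R^k$, the sphere at infinity being the equator $\{y\in S^{k-1}:y_k=0\}$. $\Lambda_{\mathcal A}(\mathbf b)$ is the union of the facets $F$ of $R_{\mathbf b}$ such that $R_{\mathbf b}$ lies on the negative side of the affine hull of $F$ (with respect to the orientation of the hyperplane $A_i$ equal to that affine hull), together with their closures in the sphere at infinity (i.e. the union of the closures of such $F$ in the closed upper hemisphere). In $N\cap\Lambda_{\mathcal A}(\mathbf b)$, $N$ is likewise understood together with its points at infinity, i.e. as its closure in the closed upper hemisphere.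
   Formalization: R_+ is assumed nonempty as well as bounded; if R_+ is empty, (2) fails: in R^1 with positive sides x>1 and x<0, N=R and j=0, Λ(b) is empty for both b other than +,-. *)

theory Defs
  imports "HOL-Analysis.Analysis" "HOL-Homology.Homology"
begin

section \<open>Reduced singular cohomology with field coefficients\<close>

text \<open>
  The reduced (augmented) singular cochain complex is indexed by all integers. In degree \<open>-1\<close>
  there is exactly one simplex, the unique extensional map on the empty set; it is a face of every
  \<open>0\<close>-simplex, so the coboundary out of degree \<open>-1\<close> is the usual augmentation
  sending a scalar to the corresponding constant \<open>0\<close>-cochain.
\<close>

definition aug_simplices :: "int \<Rightarrow> 'a topology \<Rightarrow> ((nat \<Rightarrow> real) \<Rightarrow> 'a) set" where
  "aug_simplices p X =
     (if 0 \<le> p then singular_simplex_set (nat p) X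
      else if p = -1 then {\<lambda>_. undefined} else {})"

definition aug_face :: "int \<Rightarrow> nat \<Rightarrow> ((nat \<Rightarrow> real) \<Rightarrow> 'a) \<Rightarrow> ((nat \<Rightarrow> real) \<Rightarrow> 'a)" where
  "aug_face p i \<sigma> = (if 0 < p then singular_face (nat p) i \<sigma> else (\<lambda>_. undefined))"

text \<open>Cochains are normalised to be \<open>0\<close> on functions that are not simplices of \<open>X\<close>.\<close>

definition red_cochains ::
    "'k::field itself \<Rightarrow> int \<Rightarrow> 'a topology \<Rightarrow> (((nat \<Rightarrow> real) \<Rightarrow> 'a) \<Rightarrow> 'k) set" where
  "red_cochains K p X = {\<phi>. \<forall>\<sigma>. \<sigma> \<notin> aug_simplices p X \<longrightarrow> \<phi> \<sigma> = 0}"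

definition red_coboundary ::
    "int \<Rightarrow> 'a topology \<Rightarrow> (((nat \<Rightarrow> real) \<Rightarrow> 'a) \<Rightarrow> 'k::field) \<Rightarrow> (((nat \<Rightarrow> real) \<Rightarrow> 'a) \<Rightarrow> 'k)" where
  "red_coboundary p X \<phi> =
     (\<lambda>\<sigma>. if \<sigma> \<in> aug_simplices (p + 1) X
           then \<Sum>i\<le>nat (p + 1). (-1) ^ i * \<phi> (aug_face (p + 1) i \<sigma>) else 0)"

definition red_cocycle_group ::
    "'k::field itself \<Rightarrow> int \<Rightarrow> 'a topology \<Rightarrow> (((nat \<Rightarrow> real) \<Rightarrow> 'a) \<Rightarrow> 'k) monoid" where
  "red_cocycle_group K p X =
     \<lparr> carrier = {\<phi> \<in> red_cochains K p X. red_coboundary p X \<phi> = (\<lambda>_. 0)},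
       mult = (\<lambda>\<phi> \<psi> \<sigma>. \<phi> \<sigma> + \<psi> \<sigma>),
       one = (\<lambda>_. 0) \<rparr>"

definition red_coboundaries ::
    "'k::field itself \<Rightarrow> int \<Rightarrow> 'a topology \<Rightarrow> (((nat \<Rightarrow> real) \<Rightarrow> 'a) \<Rightarrow> 'k) set" where
  "red_coboundaries K p X = red_coboundary (p - 1) X ` red_cochains K (p - 1) X"

definition reduced_cohomology_group ::
    "'k::field itself \<Rightarrow> int \<Rightarrow> 'a topology \<Rightarrow> (((nat \<Rightarrow> real) \<Rightarrow> 'a) \<Rightarrow> 'k) set monoid" where
  "reduced_cohomology_group K p X = red_cocycle_group K p X Mod red_coboundaries K p X"

lemma red_coboundary_add:
  "red_coboundary p X (\<lambda>\<sigma>. \<phi> \<sigma> + \<psi> \<sigma>) = (\<lambda>\<sigma>. red_coboundary p X \<phi> \<sigma> + red_coboundary p X \<psi> \<sigma>)"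
  by (auto simp: red_coboundary_def fun_eq_iff sum.distrib distrib_left)

lemma red_coboundary_minus:
  "red_coboundary p X (\<lambda>\<sigma>. - \<phi> \<sigma>) = (\<lambda>\<sigma>. - red_coboundary p X \<phi> \<sigma>)"
  by (auto simp: red_coboundary_def fun_eq_iff sum_negf)

lemma red_coboundary_zero: "red_coboundary p X (\<lambda>_. 0) = (\<lambda>_. 0)"
  by (auto simp: red_coboundary_def fun_eq_iff)

lemma red_coboundary_in_cochains: "red_coboundary p X \<phi> \<in> red_cochains K (p + 1) X"
  by (auto simp: red_coboundary_def red_cochains_def)

lemma aug_face_in_simplices:
  assumes "\<sigma> \<in> aug_simplices p X" "0 \<le> p" "i \<le> nat p"
  shows "aug_face p i \<sigma> \<in> aug_simplices (p - 1) X"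
proof (cases "p = 0")
  case False
  then have "nat (p - 1) = nat p - Suc 0" by auto
  then show ?thesis
    using assms False singular_simplex_singular_face[of "nat p" X \<sigma> i]
    by (auto simp: aug_face_def aug_simplices_def)
qed (use assms in \<open>auto simp: aug_face_def aug_simplices_def\<close>)

lemma aug_face_aug_face:
  assumes "i \<le> j" "int j \<le> p" "0 \<le> p"
  shows "aug_face p i (aug_face (p + 1) (Suc j) \<sigma>) = aug_face p j (aug_face (p + 1) i \<sigma>)"
proof (cases "p = 0")
  case False
  define m where "m = nat p"
  have m: "nat (p + 1) = Suc m" "nat p = m" "0 < m" "j \<le> m" using False assms by (auto simp: m_def)
  have "singular_face m i (singular_face (Suc m) (Suc j) \<sigma>) t =
        singular_face m j (singular_face (Suc m) i \<sigma>) t" for t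
  proof (cases "t \<in> standard_simplex (m - Suc 0)")
    case True
    have fi: "simplical_face i t \<in> standard_simplex m" "simplical_face j t \<in> standard_simplex m"
      using simplical_face_in_standard_simplex[of m] True m assms by auto
    have eq: "simplical_face (Suc j) (simplical_face i t) = simplical_face i (simplical_face j t)"
      using \<open>i \<le> j\<close> unfolding simplical_face_def by fastforce
    show ?thesis using True fi by (simp add: singular_face_def eq)
  qed (simp add: singular_face_def)
  then show ?thesis using False assms m by (auto simp: aug_face_def fun_eq_iff)
qed (simp add: aug_face_def)

lemma red_coboundary_coboundary:
  assumes "\<phi> \<in> red_cochains K (p - 1) X"
  shows "red_coboundary p X (red_coboundary (p - 1) X \<phi>) = (\<lambda>_. 0)"
proof (cases "0 \<le> p")
  case False
  have z: "red_coboundary (p - 1) X \<phi> = (\<lambda>_. 0)"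
    using assms False by (auto simp: red_coboundary_def red_cochains_def aug_simplices_def)
  show ?thesis unfolding z by (rule red_coboundary_zero)
next
  case True
  define m where "m = nat p"
  have m: "nat (p + 1) = Suc m" "nat p = m" using True by (auto simp: m_def)
  have "red_coboundary p X (red_coboundary (p - 1) X \<phi>) \<sigma> = 0" for \<sigma>
  proof (cases "\<sigma> \<in> aug_simplices (p + 1) X")
    case \<sigma>: True
    define g where "g = (\<lambda>(k, i). (-1) ^ (k + i) * \<phi> (aug_face p i (aug_face (p + 1) k \<sigma>)))"
    have in_s: "aug_face (p + 1) k \<sigma> \<in> aug_simplices p X" if "k \<le> Suc m" for k
      using aug_face_in_simplices[OF \<sigma>, of k] True that m by simp
    have "red_coboundary p X (red_coboundary (p - 1) X \<phi>) \<sigma> = (\<Sum>k\<le>Suc m. \<Sum>i\<le>m. g (k, i))"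
      using \<sigma> in_s m
      by (auto simp: red_coboundary_def g_def sum_distrib_left power_add mult.assoc simp del: sum.atMost_Suc
               intro!: sum.cong)
    also have "\<dots> = sum g ({..Suc m} \<times> {..m})"
      by (simp add: sum.cartesian_product del: sum.atMost_Suc)
    also have "\<dots> = sum g {(k, i). i < k \<and> k \<le> Suc m} + sum g {(k, i). k \<le> i \<and> i \<le> m}"
      by (subst sum.union_disjoint [symmetric])
         (auto intro: finite_subset[of _ "{..Suc m} \<times> {..Suc m}"] sum.cong)
    also have "sum g {(k, i). i < k \<and> k \<le> Suc m} = (\<Sum>(k, i)\<in>{(k, i). k \<le> i \<and> i \<le> m}. g (Suc i, k))"
      by (rule sum.reindex_bij_witness[of _ "\<lambda>(k, i). (Suc i, k)" "\<lambda>(k, i). (i, k - 1)"]) auto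
    also have "\<dots> = - sum g {(k, i). k \<le> i \<and> i \<le> m}"
    proof -
      have "g (Suc i, k) = - g (k, i)" if "k \<le> i" "i \<le> m" for k i
        using aug_face_aug_face[of k i p \<sigma>] that m True by (auto simp: g_def add.commute)
      then show ?thesis by (auto simp: sum_negf[symmetric] intro!: sum.cong)
    qed
    finally show ?thesis by simp
  qed (simp add: red_coboundary_def)
  then show ?thesis by auto
qed

lemma comm_group_red_cocycle_group: "comm_group (red_cocycle_group K p X)"
proof (rule comm_groupI)
  fix x assume "x \<in> carrier (red_cocycle_group K p X)"
  then show "\<exists>y\<in>carrier (red_cocycle_group K p X). y \<otimes>\<^bsub>red_cocycle_group K p X\<^esub> x = \<one>\<^bsub>red_cocycle_group K p X\<^esub>"
    by (intro bexI[of _ "\<lambda>\<sigma>. - x \<sigma>"])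
       (auto simp: red_cocycle_group_def red_cochains_def red_coboundary_minus)
qed (auto simp: red_cocycle_group_def red_cochains_def red_coboundary_add red_coboundary_zero add_ac)

lemma subgroup_red_coboundaries:
  "subgroup (red_coboundaries K p X) (red_cocycle_group K p X)"
proof -
  interpret G: comm_group "red_cocycle_group K p X" by (rule comm_group_red_cocycle_group)
  show ?thesis
  proof (rule G.subgroupI)
    show sub: "red_coboundaries K p X \<subseteq> carrier (red_cocycle_group K p X)"
      using red_coboundary_in_cochains[of "p - 1" X _ K] red_coboundary_coboundary[of _ K p X]
      by (auto simp: red_coboundaries_def red_cocycle_group_def)
    show "red_coboundaries K p X \<noteq> {}"
      by (auto simp: red_coboundaries_def red_cochains_def)
    show "inv\<^bsub>red_cocycle_group K p X\<^esub> a \<in> red_coboundaries K p X"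
      if a: "a \<in> red_coboundaries K p X" for a
    proof -
      have m: "(\<lambda>\<sigma>. - a \<sigma>) \<in> red_coboundaries K p X"
        using a unfolding red_coboundaries_def
        by (force simp: red_coboundary_minus[symmetric] red_cochains_def)
      have "inv\<^bsub>red_cocycle_group K p X\<^esub> a = (\<lambda>\<sigma>. - a \<sigma>)"
        by (rule G.inv_equality) (use a m sub in \<open>auto simp: red_cocycle_group_def\<close>)
      with m show ?thesis by simp
    qed
    show "a \<otimes>\<^bsub>red_cocycle_group K p X\<^esub> b \<in> red_coboundaries K p X"
      if "a \<in> red_coboundaries K p X" "b \<in> red_coboundaries K p X" for a b
      using that unfolding red_coboundaries_def red_cocycle_group_def
      by (force simp: red_coboundary_add[symmetric] red_cochains_def)
  qed
qed

lemma group_reduced_cohomology_group: "group (reduced_cohomology_group K p X)"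
  unfolding reduced_cohomology_group_def
  using comm_group.normal_iff_subgroup[OF comm_group_red_cocycle_group]
    subgroup_red_coboundaries normal.factorgroup_is_group by blast

section \<open>Oriented affine hyperplane arrangements\<close>

text \<open>
  An oriented affine hyperplane arrangement is given by a family of normals \<open>a i\<close> and offsets
  \<open>c i\<close>; the normal points to the positive side.
\<close>

datatype side = Neg | Pos

definition hyperplane :: "'a::euclidean_space \<Rightarrow> real \<Rightarrow> 'a set" where
  "hyperplane v r = {x. v \<bullet> x = r}"

fun open_side :: "side \<Rightarrow> 'a::euclidean_space \<Rightarrow> real \<Rightarrow> 'a set" where
  "open_side Pos v r = {x. v \<bullet> x > r}"
| "open_side Neg v r = {x. v \<bullet> x < r}"

definition region :: "('n \<Rightarrow> 'a::euclidean_space) \<Rightarrow> ('n \<Rightarrow> real) \<Rightarrow> ('n \<Rightarrow> side) \<Rightarrow> 'a set" where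
  "region a c b = (\<Inter>i. open_side (b i) (a i) (c i))"

text \<open>
  The central projection onto the open upper hemisphere of the unit sphere of \<open>'a \<times> real\<close>.
  The closed upper hemisphere is closed in \<open>'a \<times> real\<close>, so the closure in it is the
  closure in \<open>'a \<times> real\<close>.
\<close>

definition to_hemisphere :: "'a::euclidean_space \<Rightarrow> 'a \<times> real" where
  "to_hemisphere x = (x, 1) /\<^sub>R norm (x, 1::real)"

definition hemisphere_closure :: "'a::euclidean_space set \<Rightarrow> ('a \<times> real) set" where
  "hemisphere_closure S = closure (to_hemisphere ` S)"

text \<open>The facets of the open polyhedron \<open>region a c b\<close> are those of its closure.\<close>

definition Lambda ::
    "('n \<Rightarrow> 'a::euclidean_space) \<Rightarrow> ('n \<Rightarrow> real) \<Rightarrow> ('n \<Rightarrow> side) \<Rightarrow> ('a \<times> real) set" where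
  "Lambda a c b =
     \<Union> {hemisphere_closure F | F. F facet_of closure (region a c b) \<and>
          (\<exists>i. affine hull F = hyperplane (a i) (c i) \<and>
               region a c b \<subseteq> open_side Neg (a i) (c i))}"

end

theory Submission
  imports Defs
begin

text \<open>
  Everything is homogenized. A point \<open>x\<close> becomes the ray through \<open>(x, 1)\<close>, the hyperplane
  \<open>a i \<bullet> x = c i\<close> becomes the kernel of the linear form \<open>L i\<close> given by \<open>(a i, - c i)\<close>, the sphere
  at infinity becomes the zero set of the height form \<open>t\<close> given by \<open>(0, 1)\<close>, and \<open>N\<close> becomes the
  linear subspace \<open>W\<close> spanned by \<open>N \<times> {1}\<close>, of dimension \<open>l\<close>. A facet of \<open>region a c b\<close> that
  belongs to \<open>Lambda a c b\<close> is one through which a point of the all-positive region sees the region. A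
  point where some constraint with negative sign is tight always lies on such a facet, since moving
  towards the all-positive region violates that constraint; by a limiting argument this stays true
  at infinity. Hence \<open>N\<close> meets \<open>Lambda a c b\<close>, for nonempty \<open>region a c b\<close>, in the unit vectors
  \<open>z\<close> of \<open>W\<close> with \<open>t \<bullet> z \<ge> 0\<close>, with the signs of all \<open>L i \<bullet> z\<close> weakly prescribed by \<open>b\<close>, and
  with some \<open>L i \<bullet> z = 0\<close> for a negative \<open>i\<close> (\<open>affine_meets_Lambda\<close>).

  For the first claim, let \<open>p\<close> be a point of \<open>N\<close> in the positive region. All \<open>L i\<close> are positive at
  \<open>(p, 1)\<close>, so each point of the convex cone of sign pattern \<open>b\<close> in \<open>W\<close> can be pushed in direction
  \<open>(p, 1)\<close> until the first negative constraint becomes tight. Boundedness makes this cone pointed, so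
  the cone without its apex is starlike, and the visible part is a retract of it
  (\<open>acyclic_in_visible\<close>).

  For the second claim, boundedness and the disjointness of \<open>N\<close> from the closed positive region say
  that no nonzero \<open>z\<close> in \<open>W\<close> has all \<open>L i \<bullet> z \<ge> 0\<close>. The sign pattern is found in two steps. Choose a
  small set \<open>T\<close> of \<open>j + 2\<close> indices and a convex cone \<open>C\<close> in \<open>W\<close> such that the sets
  \<open>{z \<in> C - {0}. L u \<bullet> z \<ge> 0}\<close>, for \<open>u\<close> in \<open>T\<close>, have no common point while any proper subfamily has
  one. As for the faces of a simplex, their union has nonzero cohomology in degree \<open>j\<close>
  (\<open>nerve_not_acyclic\<close>), so some cocycle on the union does not extend to the contractible
  set \<open>C - {0}\<close>. Now treat the remaining indices one at a time. If the obstructed cocycle stays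
  obstructed after imposing \<open>L i \<ge> 0\<close>, impose that; otherwise Mayer-Vietoris extends it over
  \<open>{L i \<ge> 0}\<close>, and it is still obstructed on the enlarged union (\<open>obstructed_step\<close>). At the end every
  index has a sign; the obstruction provides a point where all signs are attained, hence a nonempty
  region, and pushing away from that point deforms the union onto the visible part of the boundary of
  the region (\<open>obstructed_boundary\<close>), which therefore has nonzero cohomology in degree \<open>j\<close>.

  How \<open>T\<close> is chosen depends on the position of \<open>t\<close>. Since the \<open>L i\<close> positively span the dual of
  \<open>W\<close>, the form \<open>-t\<close> is a positive combination of independent forms \<open>L u\<close> with \<open>u\<close> in some \<open>I\<close>; let
  \<open>U\<close> extend \<open>I\<close> to a basis of the dual. If \<open>U - I\<close> has at most \<open>j + 2\<close> elements, any \<open>T\<close> of size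
  \<open>j + 2\<close> between \<open>U - I\<close> and \<open>U\<close> works. Otherwise one passes to the subspace
  where \<open>t\<close> and the \<open>L u\<close> with \<open>u\<close> in \<open>I\<close> vanish, which is a set of points at infinity, and argues by
  induction on the dimension (\<open>exists_nonacyclic_sign_pattern\<close>).

  The topological input is homotopy invariance (the prism operator), the extension to all singular
  simplices of cocycles given on small ones (barycentric subdivision), and the fact that finite unions
  of closed convex sets are Euclidean neighbourhood retracts, which makes Mayer-Vietoris available for
  closed sets.
\<close>

section \<open>Reduced cohomology in terms of cocycles\<close>

text \<open>
  The reduced coboundary without the normalization of cochains outside the simplices of a fixed
  space; it can then be applied to the same function on a space and on each of its subspaces, and
  restriction needs no notation. In degree \<open>-1\<close> the value is \<open>0\<close>, there being no cochains in
  degree \<open>-2\<close>.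
\<close>

definition codiff :: "int \<Rightarrow> (((nat \<Rightarrow> real) \<Rightarrow> 'a) \<Rightarrow> 'k::field) \<Rightarrow> ((nat \<Rightarrow> real) \<Rightarrow> 'a) \<Rightarrow> 'k" where
  "codiff p \<psi> \<sigma> = (if 0 \<le> p then \<Sum>i\<le>nat p. (-1) ^ i * \<psi> (aug_face p i \<sigma>) else 0)"

abbreviation simplices :: "int \<Rightarrow> 'a::topological_space set \<Rightarrow> ((nat \<Rightarrow> real) \<Rightarrow> 'a) set" where
  "simplices p X \<equiv> aug_simplices p (top_of_set X)"

definition cocycle :: "int \<Rightarrow> 'a::topological_space set \<Rightarrow> (((nat \<Rightarrow> real) \<Rightarrow> 'a) \<Rightarrow> 'k::field) \<Rightarrow> bool" where
  "cocycle p X \<phi> \<longleftrightarrow> (\<forall>\<sigma>\<in>simplices (p + 1) X. codiff (p + 1) \<phi> \<sigma> = 0)"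

definition cohomologous ::
    "int \<Rightarrow> 'a::topological_space set \<Rightarrow> (((nat \<Rightarrow> real) \<Rightarrow> 'a) \<Rightarrow> 'k::field) \<Rightarrow> (((nat \<Rightarrow> real) \<Rightarrow> 'a) \<Rightarrow> 'k) \<Rightarrow> bool" where
  "cohomologous p X \<phi> \<phi>' \<longleftrightarrow> (\<exists>\<psi>. \<forall>\<sigma>\<in>simplices p X. \<phi> \<sigma> - \<phi>' \<sigma> = codiff p \<psi> \<sigma>)"

text \<open>
  Vanishing in the single degree \<open>p\<close>. The argument \<open>K\<close> only fixes the coefficient field.
\<close>

definition acyclic_in :: "'k::field itself \<Rightarrow> int \<Rightarrow> 'a::topological_space set \<Rightarrow> bool" where
  "acyclic_in K p X \<longleftrightarrow> (\<forall>\<phi> :: ((nat \<Rightarrow> real) \<Rightarrow> 'a) \<Rightarrow> 'k. cocycle p X \<phi> \<longrightarrow> cohomologous p X \<phi> (\<lambda>_. 0))"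

lemma codiff_cong:
  assumes "\<sigma> \<in> aug_simplices p X" "\<And>\<tau>. \<tau> \<in> aug_simplices (p - 1) X \<Longrightarrow> \<phi> \<tau> = \<psi> \<tau>"
  shows "codiff p \<phi> \<sigma> = codiff p \<psi> \<sigma>"
  unfolding codiff_def using assms by (auto intro!: sum.cong simp: aug_face_in_simplices)

lemma codiff_add: "codiff p (\<lambda>\<sigma>. \<phi> \<sigma> + \<psi> \<sigma>) \<sigma> = codiff p \<phi> \<sigma> + codiff p \<psi> \<sigma>"
  by (simp add: codiff_def sum.distrib distrib_left)

lemma codiff_diff: "codiff p (\<lambda>\<sigma>. \<phi> \<sigma> - \<psi> \<sigma>) \<sigma> = codiff p \<phi> \<sigma> - codiff p \<psi> \<sigma>"
  by (simp add: codiff_def sum_subtractf right_diff_distrib)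

lemma codiff_uminus: "codiff p (\<lambda>\<sigma>. - \<phi> \<sigma>) \<sigma> = - codiff p \<phi> \<sigma>"
  by (simp add: codiff_def sum_negf)

lemma codiff_zero [simp]: "codiff p (\<lambda>_. 0) \<sigma> = 0"
  by (simp add: codiff_def)

lemma codiff_codiff:
  assumes "\<sigma> \<in> aug_simplices (p + 1) X"
  shows "codiff (p + 1) (codiff p \<psi>) \<sigma> = 0"
proof (cases "0 \<le> p")
  case False
  then have "codiff p \<psi> = (\<lambda>_. 0)" by (auto simp: codiff_def)
  then show ?thesis by simp
next
  case True
  let ?\<psi> = "\<lambda>\<tau>. if \<tau> \<in> aug_simplices (p - 1) X then \<psi> \<tau> else 0"
  have 1: "codiff p \<psi> \<tau> = red_coboundary (p - 1) X ?\<psi> \<tau>" if "\<tau> \<in> aug_simplices p X" for \<tau>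
    using that True codiff_cong[OF that, of \<psi> ?\<psi>] by (simp add: red_coboundary_def codiff_def cong: if_cong)
  have "codiff (p + 1) (codiff p \<psi>) \<sigma> = codiff (p + 1) (red_coboundary (p - 1) X ?\<psi>) \<sigma>"
    by (rule codiff_cong[OF assms]) (use 1 in auto)
  also have "\<dots> = red_coboundary p X (red_coboundary (p - 1) X ?\<psi>) \<sigma>"
    using True assms by (simp add: red_coboundary_def codiff_def)
  also have "\<dots> = 0"
    by (subst red_coboundary_coboundary[of _ "TYPE('b)"]) (auto simp: red_cochains_def)
  finally show ?thesis .
qed

lemma simplices_mono: "X \<subseteq> Y \<Longrightarrow> simplices p X \<subseteq> simplices p Y"
  using singular_simplex_mono[of "nat p" euclidean X _ Y] by (auto simp: aug_simplices_def)

lemma cocycle_mono: "cocycle p Y \<phi> \<Longrightarrow> X \<subseteq> Y \<Longrightarrow> cocycle p X \<phi>"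
  unfolding cocycle_def using simplices_mono[of X Y "p + 1"] by blast

lemma cohomologous_mono: "cohomologous p Y \<phi> \<psi> \<Longrightarrow> X \<subseteq> Y \<Longrightarrow> cohomologous p X \<phi> \<psi>"
  unfolding cohomologous_def using simplices_mono[of X Y "p"] by blast

lemma cohomologous_refl [simp]: "cohomologous p X \<phi> \<phi>"
  unfolding cohomologous_def by (auto intro: exI[of _ "\<lambda>_. 0"])

lemma cohomologous_sym: "cohomologous p X \<phi> \<psi> \<Longrightarrow> cohomologous p X \<psi> \<phi>"
proof -
  assume "cohomologous p X \<phi> \<psi>"
  then obtain \<theta> where "\<forall>\<sigma>\<in>simplices p X. \<phi> \<sigma> - \<psi> \<sigma> = codiff p \<theta> \<sigma>"
    by (auto simp: cohomologous_def)
  then have "\<forall>\<sigma>\<in>simplices p X. \<psi> \<sigma> - \<phi> \<sigma> = codiff p (\<lambda>\<sigma>. - \<theta> \<sigma>) \<sigma>"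
    by (simp add: codiff_uminus) (metis minus_diff_eq)
  then show ?thesis by (auto simp: cohomologous_def)
qed

lemma cohomologous_trans [trans]:
  assumes "cohomologous p X \<phi> \<psi>" "cohomologous p X \<psi> \<xi>" shows "cohomologous p X \<phi> \<xi>"
proof -
  obtain \<theta> \<theta>' where "\<forall>\<sigma>\<in>simplices p X. \<phi> \<sigma> - \<psi> \<sigma> = codiff p \<theta> \<sigma>"
     "\<forall>\<sigma>\<in>simplices p X. \<psi> \<sigma> - \<xi> \<sigma> = codiff p \<theta>' \<sigma>"
    using assms by (auto simp: cohomologous_def)
  then have "\<forall>\<sigma>\<in>simplices p X. \<phi> \<sigma> - \<xi> \<sigma> = codiff p (\<lambda>\<sigma>. \<theta> \<sigma> + \<theta>' \<sigma>) \<sigma>"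
    by (simp add: codiff_add) (metis diff_add_cancel add_diff_eq)
  then show ?thesis by (auto simp: cohomologous_def)
qed

lemma cohomologous_eq:
  "(\<And>\<sigma>. \<sigma> \<in> simplices p X \<Longrightarrow> \<phi> \<sigma> = \<psi> \<sigma>) \<Longrightarrow> cohomologous p X \<phi> \<psi>"
  unfolding cohomologous_def by (auto intro: exI[of _ "\<lambda>_. 0"])

lemma cocycle_cong:
  assumes "\<And>\<sigma>. \<sigma> \<in> simplices p X \<Longrightarrow> \<phi> \<sigma> = \<psi> \<sigma>"
  shows "cocycle p X \<phi> \<longleftrightarrow> cocycle p X \<psi>"
  unfolding cocycle_def using codiff_cong[of _ "p + 1" "top_of_set X" \<phi> \<psi>] assms by auto

lemma cocycle_codiff: "cocycle p X (codiff p \<psi>)"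
  unfolding cocycle_def by (simp add: codiff_codiff)

lemma cocycle_diff: "cocycle p X \<phi> \<Longrightarrow> cocycle p X \<psi> \<Longrightarrow> cocycle p X (\<lambda>\<sigma>. \<phi> \<sigma> - \<psi> \<sigma>)"
  unfolding cocycle_def by (simp add: codiff_diff)

text \<open>
  Cochains are unconstrained in the predicates above and vanish outside the simplices in the groups;
  cutting a cochain off to zero translates one into the other.
\<close>

lemma trivial_reduced_cohomology_iff:
  fixes K :: "'k::field itself" and X :: "'a::topological_space set"
  shows
  "trivial_group (reduced_cohomology_group K p (top_of_set X)) \<longleftrightarrow> acyclic_in K p X"
proof -
  interpret G: comm_group "red_cocycle_group K p (top_of_set X)" by (rule comm_group_red_cocycle_group)
  let ?T = "top_of_set X"
  have sub: "subgroup (red_coboundaries K p ?T) (red_cocycle_group K p ?T)"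
    by (rule subgroup_red_coboundaries)
  have "trivial_group (reduced_cohomology_group K p ?T) \<longleftrightarrow>
      carrier (red_cocycle_group K p ?T) \<subseteq> red_coboundaries K p ?T"
  proof
    assume *: "trivial_group (reduced_cohomology_group K p ?T)"
    show "carrier (red_cocycle_group K p ?T) \<subseteq> red_coboundaries K p ?T"
    proof
      fix \<phi> assume \<phi>: "\<phi> \<in> carrier (red_cocycle_group K p ?T)"
      have "red_coboundaries K p ?T #>\<^bsub>red_cocycle_group K p ?T\<^esub> \<phi> = red_coboundaries K p ?T"
        using * \<phi> by (auto simp: trivial_group_def reduced_cohomology_group_def FactGroup_def RCOSETS_def)
      then show "\<phi> \<in> red_coboundaries K p ?T"
        using G.rcos_self[OF \<phi> sub] by simp
    qed
  next
    assume *: "carrier (red_cocycle_group K p ?T) \<subseteq> red_coboundaries K p ?T"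
    then have "carrier (reduced_cohomology_group K p ?T) = {red_coboundaries K p ?T}"
      using G.coset_join2[OF _ sub] G.one_closed
      by (auto simp: reduced_cohomology_group_def FactGroup_def RCOSETS_def)
    then show "trivial_group (reduced_cohomology_group K p ?T)"
      using group_reduced_cohomology_group[of K p ?T]
      by (simp add: trivial_group_def) (simp add: reduced_cohomology_group_def FactGroup_def)
  qed
  also have "\<dots> \<longleftrightarrow> acyclic_in K p X"
  proof
    assume *: "carrier (red_cocycle_group K p ?T) \<subseteq> red_coboundaries K p ?T"
    show "acyclic_in K p X"
      unfolding acyclic_in_def
    proof (intro allI impI)
      fix \<phi> :: "((nat \<Rightarrow> real) \<Rightarrow> 'a) \<Rightarrow> 'k" assume \<phi>: "cocycle p X \<phi>"
      let ?\<phi> = "\<lambda>\<tau>. if \<tau> \<in> simplices p X then \<phi> \<tau> else 0"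
      have "cocycle p X ?\<phi>" using \<phi> cocycle_cong[of p X \<phi> ?\<phi>] by auto
      then have "red_coboundary p ?T ?\<phi> \<sigma> = 0" for \<sigma>
        by (cases "0 \<le> p + 1") (auto simp: cocycle_def red_coboundary_def codiff_def aug_simplices_def)
      then have "?\<phi> \<in> carrier (red_cocycle_group K p ?T)"
        by (auto simp: red_cocycle_group_def red_cochains_def)
      then obtain \<psi> where \<psi>: "\<psi> \<in> red_cochains K (p - 1) ?T" "?\<phi> = red_coboundary (p - 1) ?T \<psi>"
        using * by (auto simp: red_coboundaries_def)
      have "\<phi> \<sigma> = codiff p \<psi> \<sigma>" if "\<sigma> \<in> simplices p X" for \<sigma>
        using fun_cong[OF \<psi>(2), of \<sigma>] that \<psi>(1)
        by (auto simp: red_coboundary_def codiff_def red_cochains_def aug_simplices_def aug_face_def split: if_splits)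
      then show "cohomologous p X \<phi> (\<lambda>_. 0)" by (auto simp: cohomologous_def)
    qed
  next
    assume *: "acyclic_in K p X"
    show "carrier (red_cocycle_group K p ?T) \<subseteq> red_coboundaries K p ?T"
    proof
      fix \<phi> assume \<phi>: "\<phi> \<in> carrier (red_cocycle_group K p ?T)"
      then have "codiff (p + 1) \<phi> \<sigma> = 0" if "\<sigma> \<in> simplices (p + 1) X" for \<sigma>
      proof -
        have "red_coboundary p ?T \<phi> \<sigma> = 0" using \<phi> by (simp add: red_cocycle_group_def)
        with that show ?thesis by (auto simp: red_coboundary_def codiff_def)
      qed
      then have "cocycle p X \<phi>" by (simp add: cocycle_def)
      then obtain \<psi> where \<psi>: "\<forall>\<sigma>\<in>simplices p X. \<phi> \<sigma> = codiff p \<psi> \<sigma>"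
        using * by (auto simp: acyclic_in_def cohomologous_def)
      let ?\<psi> = "\<lambda>\<tau>. if \<tau> \<in> simplices (p - 1) X then \<psi> \<tau> else 0"
      have "\<phi> = red_coboundary (p - 1) ?T ?\<psi>"
      proof
        fix \<sigma>
        show "\<phi> \<sigma> = red_coboundary (p - 1) ?T ?\<psi> \<sigma>"
        proof (cases "\<sigma> \<in> simplices p X")
          case True
          then have "\<phi> \<sigma> = codiff p ?\<psi> \<sigma>"
            using \<psi> codiff_cong[OF True, of \<psi> ?\<psi>] by auto
          with True show ?thesis
            by (cases "0 \<le> p") (simp_all add: red_coboundary_def codiff_def aug_simplices_def cong: if_cong)
        next
          case False
          then show ?thesis using \<phi> by (auto simp: red_cocycle_group_def red_cochains_def red_coboundary_def)
        qed
      qed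
      then show "\<phi> \<in> red_coboundaries K p ?T"
        unfolding red_coboundaries_def by (intro image_eqI[of _ _ ?\<psi>]) (auto simp: red_cochains_def)
    qed
  qed
  finally show ?thesis .
qed

text \<open>
  The map induced on augmented simplices: the simplex of degree \<open>-1\<close> goes to itself.
\<close>

definition aug_map :: "int \<Rightarrow> ('a \<Rightarrow> 'b) \<Rightarrow> ((nat \<Rightarrow> real) \<Rightarrow> 'a) \<Rightarrow> ((nat \<Rightarrow> real) \<Rightarrow> 'b)" where
  "aug_map p f \<sigma> = (if 0 \<le> p then simplex_map (nat p) f \<sigma> else (\<lambda>_. undefined))"

lemma aug_map_in_simplices:
  assumes "\<sigma> \<in> simplices p X" "continuous_on X f" "f ` X \<subseteq> Y"
  shows "aug_map p f \<sigma> \<in> simplices p Y"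
proof -
  have "continuous_map (top_of_set X) (top_of_set Y) f"
    using assms by auto
  then show ?thesis
    using assms(1) singular_simplex_simplex_map[of "nat p" "top_of_set X" \<sigma> "top_of_set Y" f]
    by (auto simp: aug_simplices_def aug_map_def split: if_splits)
qed

lemma aug_face_aug_map:
  assumes "\<sigma> \<in> simplices p X" "0 \<le> p" "i \<le> nat p"
  shows "aug_face p i (aug_map p f \<sigma>) = aug_map (p - 1) f (aug_face p i \<sigma>)"
proof (cases "p = 0")
  case False
  then have p: "1 \<le> nat p" "nat (p - 1) = nat p - Suc 0" using assms by auto
  show ?thesis
    using assms p singular_face_simplex_map[of "nat p" i f \<sigma>] False
    by (auto simp: aug_face_def aug_map_def singular_face_def simplex_map_def fun_eq_iff)
qed (auto simp: aug_face_def aug_map_def)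

lemma codiff_pullback:
  assumes "\<sigma> \<in> simplices p X"
  shows "codiff p \<phi> (aug_map p f \<sigma>) = codiff p (\<lambda>\<tau>. \<phi> (aug_map (p - 1) f \<tau>)) \<sigma>"
  using assms by (auto simp: codiff_def aug_face_aug_map intro!: sum.cong)

lemma cocycle_pullback:
  assumes "cocycle p Y \<phi>" "continuous_on X f" "f ` X \<subseteq> Y"
  shows "cocycle p X (\<lambda>\<sigma>. \<phi> (aug_map p f \<sigma>))"
  unfolding cocycle_def
proof
  fix \<sigma> assume s: "\<sigma> \<in> simplices (p + 1) X"
  have "codiff (p + 1) \<phi> (aug_map (p + 1) f \<sigma>) = 0"
    using assms(1) aug_map_in_simplices[OF s assms(2,3)] by (auto simp: cocycle_def)
  then show "codiff (p + 1) (\<lambda>\<sigma>. \<phi> (aug_map p f \<sigma>)) \<sigma> = 0"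
    using codiff_pullback[OF s, of \<phi> f] by simp
qed

lemma cohomologous_pullback:
  assumes "cohomologous p Y \<phi> \<psi>" "continuous_on X f" "f ` X \<subseteq> Y"
  shows "cohomologous p X (\<lambda>\<sigma>. \<phi> (aug_map p f \<sigma>)) (\<lambda>\<sigma>. \<psi> (aug_map p f \<sigma>))"
proof -
  obtain \<theta> where \<theta>: "\<forall>\<sigma>\<in>simplices p Y. \<phi> \<sigma> - \<psi> \<sigma> = codiff p \<theta> \<sigma>"
    using assms by (auto simp: cohomologous_def)
  then have "\<forall>\<sigma>\<in>simplices p X. \<phi> (aug_map p f \<sigma>) - \<psi> (aug_map p f \<sigma>) = codiff p (\<lambda>\<tau>. \<theta> (aug_map (p - 1) f \<tau>)) \<sigma>"
    using aug_map_in_simplices[OF _ assms(2,3)] by (auto simp: codiff_pullback)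
  then show ?thesis by (auto simp: cohomologous_def)
qed

lemma aug_map_ident:
  assumes "\<sigma> \<in> simplices p X" "\<And>x. x \<in> X \<Longrightarrow> f x = x"
  shows "aug_map p f \<sigma> = \<sigma>"
  using assms simplex_map_id_gen[of "nat p" "top_of_set X" \<sigma> f]
  by (auto simp: aug_simplices_def aug_map_def split: if_splits)

lemma aug_map_cong:
  assumes "\<sigma> \<in> simplices p X" "\<And>x. x \<in> X \<Longrightarrow> f x = g x"
  shows "aug_map p f \<sigma> = aug_map p g \<sigma>"
  using assms simplex_map_eq[of "nat p" "top_of_set X" \<sigma> f g]
  by (auto simp: aug_simplices_def aug_map_def split: if_splits)

lemma acyclic_in_retract:
  fixes K :: "'k::field itself" and X :: "'a::topological_space set"
  assumes "acyclic_in K p Y" "continuous_on Y r" "r ` Y \<subseteq> X" "X \<subseteq> Y" "\<And>x. x \<in> X \<Longrightarrow> r x = x"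
  shows "acyclic_in K p X"
  unfolding acyclic_in_def
proof (intro allI impI)
  fix \<phi> :: "((nat \<Rightarrow> real) \<Rightarrow> 'a) \<Rightarrow> 'k" assume "cocycle p X \<phi>"
  then have "cocycle p Y (\<lambda>\<sigma>. \<phi> (aug_map p r \<sigma>))" by (rule cocycle_pullback) (use assms in auto)
  then have "cohomologous p Y (\<lambda>\<sigma>. \<phi> (aug_map p r \<sigma>)) (\<lambda>_. 0)"
    using assms(1) by (auto simp: acyclic_in_def)
  then have "cohomologous p X (\<lambda>\<sigma>. \<phi> (aug_map p r \<sigma>)) (\<lambda>_. 0)"
    using assms(4) by (rule cohomologous_mono)
  moreover have "cohomologous p X \<phi> (\<lambda>\<sigma>. \<phi> (aug_map p r \<sigma>))"
    by (rule cohomologous_eq) (use aug_map_ident assms(5) in metis)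
  ultimately show "cohomologous p X \<phi> (\<lambda>_. 0)" using cohomologous_trans by blast
qed

section \<open>Homotopy invariance by the prism operator\<close>

text \<open>
  The degeneracy of simplices that merges the vertices \<open>i\<close> and \<open>i + 1\<close>. Together with the sum of the
  coordinates beyond \<open>i\<close>, it maps the simplex of dimension \<open>n + 1\<close> onto the \<open>i\<close>-th piece of the
  standard triangulation of the prism over the simplex of dimension \<open>n\<close>.
\<close>

definition degen :: "nat \<Rightarrow> (nat \<Rightarrow> real) \<Rightarrow> nat \<Rightarrow> real" where
  "degen i x = (\<lambda>k. if k < i then x k else if k = i then x i + x (Suc i) else x (Suc k))"

definition tail_sum :: "nat \<Rightarrow> nat \<Rightarrow> (nat \<Rightarrow> real) \<Rightarrow> real" where
  "tail_sum n i x = (\<Sum>k\<in>{i<..n}. x k)"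

lemma sum_atMost_simplical_face: "k \<le> n \<Longrightarrow> (\<Sum>j\<in>{..n}. simplical_face k x j :: real) = (\<Sum>j<n. x j)"
proof (induction n)
  case (Suc n)
  show ?case
  proof (cases "k = Suc n")
    case True
    then have "(\<Sum>j\<in>{..Suc n}. simplical_face k x j) = (\<Sum>j\<in>{..n}. x j)"
      by (auto simp: simplical_face_def intro!: sum.cong)
    then show ?thesis by (simp add: lessThan_Suc_atMost)
  next
    case False
    with Suc show ?thesis by (simp add: simplical_face_def)
  qed
qed (auto simp: simplical_face_def)

lemma tail_sum_eq: "i \<le> n \<Longrightarrow> tail_sum n i x = sum x {..n} - sum x {..i}"
proof -
  assume "i \<le> n"
  then have *: "{..n} = {..i} \<union> {i<..n}" by auto
  have "sum x {..n} = sum x {..i} + sum x {i<..n}"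
    unfolding * by (rule sum.union_disjoint) auto
  then show ?thesis by (simp add: tail_sum_def)
qed

lemma sum_simplical_face_gt:
  "i < j \<Longrightarrow> (\<Sum>k\<le>i. simplical_face j x k :: real) = (\<Sum>k\<le>i. x k)"
  by (auto simp: simplical_face_def intro!: sum.cong)

lemma degen_face_less: "j < i \<Longrightarrow> degen i (simplical_face j x) = simplical_face j (degen (i - 1) x)"
  by (auto simp: degen_def simplical_face_def fun_eq_iff)

lemma degen_face_eq: "degen i (simplical_face i x) = x" "degen i (simplical_face (Suc i) x) = x"
  by (auto simp: degen_def simplical_face_def fun_eq_iff)

lemma degen_face_greater: "Suc i < j \<Longrightarrow> degen i (simplical_face j x) = simplical_face (j - 1) (degen i x)"
  by (auto simp: degen_def simplical_face_def fun_eq_iff)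

lemma tail_sum_face_le:
  assumes "j \<le> i" "i \<le> Suc n" 
  shows "tail_sum (Suc n) i (simplical_face j x) = (\<Sum>k<Suc n. x k) - (\<Sum>k<i. x k)"
  using assms by (subst tail_sum_eq) (auto simp: sum_atMost_simplical_face simp del: sum.atMost_Suc)

lemma tail_sum_face_gt:
  assumes "i < j" "j \<le> Suc n" 
  shows "tail_sum (Suc n) i (simplical_face j x) = (\<Sum>k<Suc n. x k) - (\<Sum>k\<le>i. x k)"
  using assms by (subst tail_sum_eq) (auto simp: sum_atMost_simplical_face sum_simplical_face_gt simp del: sum.atMost_Suc)

lemma sum_degen: "i \<le> n \<Longrightarrow> (\<Sum>k\<le>n. degen i x k) = (\<Sum>k\<le>Suc n. x k)"
proof (induction n)
  case (Suc n)
  show ?case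
  proof (cases "i = Suc n")
    case True
    then have "(\<Sum>k\<le>n. degen i x k) = (\<Sum>k\<le>n. x k)" by (auto simp: degen_def intro!: sum.cong)
    with True show ?thesis by (simp add: degen_def)
  next
    case False
    with Suc show ?thesis by (simp add: degen_def)
  qed
qed (auto simp: degen_def)

lemma degen_in_simplex:
  assumes "x \<in> standard_simplex (Suc n)" "i \<le> n"
  shows "degen i x \<in> standard_simplex n"
proof -
  have x: "\<And>k. 0 \<le> x k" "\<And>k. k > Suc n \<Longrightarrow> x k = 0" "(\<Sum>k\<le>Suc n. x k) = 1"
    using assms by (auto simp: standard_simplex_def)
  have nn: "0 \<le> degen i x k" for k using x by (auto simp: degen_def)
  have s1: "(\<Sum>k\<le>n. degen i x k) = 1" using sum_degen[OF assms(2), of x] x(3) by simp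
  have z: "degen i x k = 0" if "k > n" for k using that x(2) assms(2) by (auto simp: degen_def)
  have "degen i x k \<le> 1" for k
  proof (cases "k \<le> n")
    case True
    then have "degen i x k \<le> (\<Sum>k\<le>n. degen i x k)" using nn by (intro member_le_sum) auto
    with s1 show ?thesis by simp
  qed (use z in auto)
  with nn s1 z show ?thesis by (auto simp: standard_simplex_def)
qed

lemma tail_sum_01:
  assumes "x \<in> standard_simplex (Suc n)" "i \<le> Suc n"
  shows "tail_sum (Suc n) i x \<in> {0..1}"
proof -
  have x: "\<And>k. 0 \<le> x k" "(\<Sum>k\<le>Suc n. x k) = 1"
    using assms by (auto simp: standard_simplex_def)
  have "0 \<le> tail_sum (Suc n) i x" using x by (auto simp: tail_sum_def intro: sum_nonneg)
  moreover have "0 \<le> sum x {..i}" using x by (auto intro: sum_nonneg)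
  ultimately show ?thesis using tail_sum_eq[OF assms(2), of x] x(2) by simp
qed

definition prism_simplex ::
    "(real \<times> 'a \<Rightarrow> 'b) \<Rightarrow> nat \<Rightarrow> nat \<Rightarrow> ((nat \<Rightarrow> real) \<Rightarrow> 'a) \<Rightarrow> ((nat \<Rightarrow> real) \<Rightarrow> 'b)" where
  "prism_simplex h n i \<sigma> = restrict (\<lambda>x. h (tail_sum (Suc n) i x, \<sigma> (degen i x))) (standard_simplex (Suc n))"

lemma singular_simplex_prism:
  assumes s: "singular_simplex n (top_of_set X) \<sigma>" and i: "i \<le> n"
    and h: "continuous_on ({0..1} \<times> X) h" "h ` ({0..1} \<times> X) \<subseteq> Y"
  shows "singular_simplex (Suc n) (top_of_set Y) (prism_simplex h n i \<sigma>)"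
proof -
  let ?S = "\<lambda>n. subtopology (powertop_real UNIV) (standard_simplex n)"
  have proj: "continuous_map (?S (Suc n)) euclideanreal (\<lambda>x. x k)" for k
    by (auto intro: continuous_map_product_projection continuous_map_from_subtopology)
  have "continuous_map (?S (Suc n)) (powertop_real UNIV) (degen i)"
    unfolding degen_def by (auto simp: continuous_map_componentwise_UNIV intro!: continuous_intros proj)
  then have 1: "continuous_map (?S (Suc n)) (?S n) (degen i)"
    using i degen_in_simplex by (auto simp: continuous_map_in_subtopology)
  have 2: "continuous_map (?S (Suc n)) (top_of_set X) (\<sigma> \<circ> degen i)"
    using s by (intro continuous_map_compose[OF 1]) (simp add: singular_simplex_def)
  have "continuous_map (?S (Suc n)) euclideanreal (tail_sum (Suc n) i)"
    unfolding tail_sum_def by (intro continuous_map_sum proj) auto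
  then have 3: "continuous_map (?S (Suc n)) (top_of_set {0..1}) (tail_sum (Suc n) i)"
    using i tail_sum_01 by (auto simp: continuous_map_in_subtopology image_subset_iff simp del: atLeastAtMost_iff)
  have "continuous_map (?S (Suc n)) (prod_topology (top_of_set {0..1}) (top_of_set X)) (\<lambda>x. (tail_sum (Suc n) i x, (\<sigma> \<circ> degen i) x))"
    using 2 3 by (intro continuous_map_pairedI)
  moreover have "prod_topology (top_of_set {0..1::real}) (top_of_set X) = top_of_set ({0..1} \<times> X)"
    using subtopology_Times[of euclidean euclidean "{0..1::real}" X] by simp
  moreover have "continuous_map (top_of_set ({0..1} \<times> X)) (top_of_set Y) h" using h by auto
  ultimately have "continuous_map (?S (Suc n)) (top_of_set Y) (h \<circ> (\<lambda>x. (tail_sum (Suc n) i x, (\<sigma> \<circ> degen i) x)))"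
    by (intro continuous_map_compose[of _ "top_of_set ({0..1} \<times> X)"]) simp_all
  then show ?thesis
    unfolding singular_simplex_def prism_simplex_def
    by (auto elim!: continuous_map_eq)
qed

lemma prism_face_less:
  assumes "j < i" "i \<le> n" "0 < n"
  shows "singular_face (Suc n) j (prism_simplex h n i \<sigma>) = prism_simplex h (n - 1) (i - 1) (singular_face n j \<sigma>)"
proof
  fix x
  obtain m where m: "n = Suc m" using assms by (cases n) auto
  obtain i' where i': "i = Suc i'" using assms by (cases i) auto
  show "singular_face (Suc n) j (prism_simplex h n i \<sigma>) x = prism_simplex h (n - 1) (i - 1) (singular_face n j \<sigma>) x"
  proof (cases "x \<in> standard_simplex n")
    case True
    then have "simplical_face j x \<in> standard_simplex (Suc n)" "degen i' x \<in> standard_simplex m"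
      using assms simplical_face_in_standard_simplex[of "Suc n" j x] degen_in_simplex[of x m i'] m i' by auto
    moreover have "tail_sum (Suc n) i (simplical_face j x) = tail_sum n i' x"
      using assms m i' by (simp add: tail_sum_face_le tail_sum_eq[of i' "Suc m" x] lessThan_Suc_atMost del: sum.atMost_Suc)
    ultimately show ?thesis using True m i' assms
      by (simp add: singular_face_def prism_simplex_def degen_face_less)
  qed (use m in \<open>simp add: singular_face_def prism_simplex_def\<close>)
qed

lemma prism_face_greater:
  assumes "Suc i < j" "j \<le> Suc n" "0 < n"
  shows "singular_face (Suc n) j (prism_simplex h n i \<sigma>) = prism_simplex h (n - 1) i (singular_face n (j - 1) \<sigma>)"
proof
  fix x
  obtain m where m: "n = Suc m" using assms by (cases n) auto
  show "singular_face (Suc n) j (prism_simplex h n i \<sigma>) x = prism_simplex h (n - 1) i (singular_face n (j - 1) \<sigma>) x"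
  proof (cases "x \<in> standard_simplex n")
    case True
    then have "simplical_face j x \<in> standard_simplex (Suc n)" "degen i x \<in> standard_simplex m"
      using assms simplical_face_in_standard_simplex[of "Suc n" j x] degen_in_simplex[of x m i] m by auto
    moreover have "tail_sum (Suc n) i (simplical_face j x) = tail_sum n i x"
      using assms m by (simp add: tail_sum_face_gt tail_sum_eq[of i "Suc m" x] lessThan_Suc_atMost del: sum.atMost_Suc)
    ultimately show ?thesis using True m assms
      by (simp add: singular_face_def prism_simplex_def degen_face_greater)
  qed (use m in \<open>simp add: singular_face_def prism_simplex_def\<close>)
qed

lemma prism_face_mid:
  assumes "i < n"
  shows "singular_face (Suc n) (Suc i) (prism_simplex h n i \<sigma>) = singular_face (Suc n) (Suc i) (prism_simplex h n (Suc i) \<sigma>)"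
proof
  fix x
  show "singular_face (Suc n) (Suc i) (prism_simplex h n i \<sigma>) x = singular_face (Suc n) (Suc i) (prism_simplex h n (Suc i) \<sigma>) x"
  proof (cases "x \<in> standard_simplex n")
    case True
    then have "simplical_face (Suc i) x \<in> standard_simplex (Suc n)"
      using assms simplical_face_in_standard_simplex[of "Suc n" "Suc i" x] by auto
    moreover have "tail_sum (Suc n) i (simplical_face (Suc i) x) = tail_sum (Suc n) (Suc i) (simplical_face (Suc i) x)"
      using assms by (simp add: tail_sum_face_le tail_sum_face_gt lessThan_Suc_atMost)
    ultimately show ?thesis using True 
      by (simp add: singular_face_def prism_simplex_def degen_face_eq)
  qed (simp add: singular_face_def prism_simplex_def)
qed

lemma prism_face_bottom:
  assumes "singular_simplex n (top_of_set X) \<sigma>"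
  shows "singular_face (Suc n) 0 (prism_simplex h n 0 \<sigma>) = simplex_map n (\<lambda>z. h (1, z)) \<sigma>"
proof
  fix x
  show "singular_face (Suc n) 0 (prism_simplex h n 0 \<sigma>) x = simplex_map n (\<lambda>z. h (1, z)) \<sigma> x"
  proof (cases "x \<in> standard_simplex n")
    case True
    then have "simplical_face 0 x \<in> standard_simplex (Suc n)"
      using simplical_face_in_standard_simplex[of "Suc n" 0 x] by auto
    moreover have "tail_sum (Suc n) 0 (simplical_face 0 x) = 1"
      using True by (simp add: tail_sum_face_le standard_simplex_def lessThan_Suc_atMost)
    ultimately show ?thesis using True 
      by (simp add: singular_face_def prism_simplex_def degen_face_eq simplex_map_def)
  qed (simp add: singular_face_def prism_simplex_def simplex_map_def)
qed

lemma prism_face_top: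
  assumes "singular_simplex n (top_of_set X) \<sigma>"
  shows "singular_face (Suc n) (Suc n) (prism_simplex h n n \<sigma>) = simplex_map n (\<lambda>z. h (0, z)) \<sigma>"
proof
  fix x
  show "singular_face (Suc n) (Suc n) (prism_simplex h n n \<sigma>) x = simplex_map n (\<lambda>z. h (0, z)) \<sigma> x"
  proof (cases "x \<in> standard_simplex n")
    case True
    then have "simplical_face (Suc n) x \<in> standard_simplex (Suc n)"
      using simplical_face_in_standard_simplex[of "Suc n" "Suc n" x] by auto
    moreover have "tail_sum (Suc n) n (simplical_face (Suc n) x) = 0"
      by (simp add: tail_sum_face_gt lessThan_Suc_atMost)
    ultimately show ?thesis using True 
      by (simp add: singular_face_def prism_simplex_def degen_face_eq simplex_map_def)
  qed (simp add: singular_face_def prism_simplex_def simplex_map_def)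
qed

text \<open>
  The boundary of the prism is top minus bottom minus the prism over the boundary. The inner faces
  (the faces \<open>i\<close> and \<open>i + 1\<close> of the \<open>i\<close>-th piece) telescope, and the faces below and above the
  diagonal are reindexed to the pieces of the prisms over the faces.
\<close>

lemma prism_boundary:
  fixes \<phi> :: "((nat \<Rightarrow> real) \<Rightarrow> 'b) \<Rightarrow> 'k::field"
  assumes s: "singular_simplex n (top_of_set X) \<sigma>"
  shows "(\<Sum>i\<le>n. \<Sum>j\<le>Suc n. (-1) ^ (i + j) * \<phi> (singular_face (Suc n) j (prism_simplex h n i \<sigma>)))
    = \<phi> (simplex_map n (\<lambda>z. h (1, z)) \<sigma>) - \<phi> (simplex_map n (\<lambda>z. h (0, z)) \<sigma>)
      - (if n = 0 then 0 else \<Sum>j\<le>n. \<Sum>i<n. (-1) ^ (i + j) * \<phi> (prism_simplex h (n - 1) i (singular_face n j \<sigma>)))"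
proof -
  define g where "g i j = (-1) ^ (i + j) * \<phi> (singular_face (Suc n) j (prism_simplex h n i \<sigma>))" for i j
  define A where "A = {(i, j). j < i \<and> i \<le> n}"
  define B where "B = {(i, j). Suc i < j \<and> j \<le> Suc n}"
  have fin: "finite A" "finite B"
    by (rule finite_subset[of _ "{..Suc n} \<times> {..Suc n}"]; auto simp: A_def B_def)+
  have split: "{..n} \<times> {..Suc n} = A \<union> B \<union> ((\<lambda>i. (i, i)) ` {..n} \<union> (\<lambda>i. (i, Suc i)) ` {..n})"
    by (auto simp: A_def B_def image_iff)
  have "(\<Sum>i\<le>n. \<Sum>j\<le>Suc n. g i j) = (\<Sum>(i, j)\<in>{..n} \<times> {..Suc n}. g i j)"
    by (simp add: sum.cartesian_product del: sum.atMost_Suc)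
  also have "\<dots> = (\<Sum>(i, j)\<in>A. g i j) + (\<Sum>(i, j)\<in>B. g i j) +
      ((\<Sum>(i, j)\<in>(\<lambda>i. (i, i)) ` {..n}. g i j) + (\<Sum>(i, j)\<in>(\<lambda>i. (i, Suc i)) ` {..n}. g i j))"
  proof -
    have "A \<inter> B = {}" "(A \<union> B) \<inter> ((\<lambda>i. (i, i)) ` {..n} \<union> (\<lambda>i. (i, Suc i)) ` {..n}) = {}"
      "(\<lambda>i. (i, i)) ` {..n} \<inter> (\<lambda>i. (i, Suc i)) ` {..n} = {}"
      by (auto simp: A_def B_def)
    then show ?thesis
      unfolding split using fin by (simp add: sum.union_disjoint)
  qed
  also have "(\<Sum>(i, j)\<in>(\<lambda>i. (i, i)) ` {..n}. g i j) = (\<Sum>i\<le>n. g i i)"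
    by (subst sum.reindex) (auto simp: inj_on_def)
  also have "(\<Sum>(i, j)\<in>(\<lambda>i. (i, Suc i)) ` {..n}. g i j) = (\<Sum>i\<le>n. g i (Suc i))"
    by (subst sum.reindex) (auto simp: inj_on_def)
  also have "(\<Sum>i\<le>n. g i i) + (\<Sum>i\<le>n. g i (Suc i)) = g 0 0 + g n (Suc n)"
  proof -
    have "m \<le> n \<Longrightarrow> (\<Sum>i\<le>m. g i i) + (\<Sum>i\<le>m. g i (Suc i)) = g 0 0 + g m (Suc m)" for m
    proof (induction m)
      case (Suc m)
      have "g (Suc m) (Suc m) = - g m (Suc m)"
        using prism_face_mid[of m n h \<sigma>] Suc.prems by (simp add: g_def)
      with Suc show ?case by (simp add: algebra_simps)
    qed simp
    then show ?thesis by simp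
  qed
  also have "g 0 0 = \<phi> (simplex_map n (\<lambda>z. h (1, z)) \<sigma>)"
    by (simp add: g_def prism_face_bottom[OF s])
  also have "g n (Suc n) = - \<phi> (simplex_map n (\<lambda>z. h (0, z)) \<sigma>)"
    by (simp add: g_def prism_face_top[OF s] flip: power_add mult_2)
  finally have 1: "(\<Sum>i\<le>n. \<Sum>j\<le>Suc n. g i j) = (\<Sum>(i, j)\<in>A. g i j) + (\<Sum>(i, j)\<in>B. g i j) +
     (\<phi> (simplex_map n (\<lambda>z. h (1, z)) \<sigma>) - \<phi> (simplex_map n (\<lambda>z. h (0, z)) \<sigma>))" by simp
  have 2: "(\<Sum>(i, j)\<in>A. g i j) + (\<Sum>(i, j)\<in>B. g i j) =
      - (if n = 0 then 0 else \<Sum>j\<le>n. \<Sum>i<n. (-1) ^ (i + j) * \<phi> (prism_simplex h (n - 1) i (singular_face n j \<sigma>)))"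
  proof (cases "n = 0")
    case True
    then have "A = {}" "B = {}" by (auto simp: A_def B_def)
    with True show ?thesis by simp
  next
    case False
    define f where "f i j = (-1) ^ (i + j) * \<phi> (prism_simplex h (n - 1) i (singular_face n j \<sigma>))" for i j
    define A' where "A' = {(i, j). j \<le> i \<and> i < n}"
    define B' where "B' = {(i, j). i < j \<and> j \<le> n}"
    have fin': "finite A'" "finite B'"
      by (rule finite_subset[of _ "{..Suc n} \<times> {..Suc n}"]; auto simp: A'_def B'_def)+
    have gA: "g i j = - f (i - 1) j" if "j < i" "i \<le> n" for i j
      using prism_face_less[of j i n h \<sigma>] that by (cases i) (simp_all add: g_def f_def)
    have gB: "g i j = - f i (j - 1)" if "Suc i < j" "j \<le> Suc n" for i j
      using prism_face_greater[of i j n h \<sigma>] that by (cases j) (simp_all add: g_def f_def)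
    have "(\<Sum>(i, j)\<in>A. g i j) = (\<Sum>(i, j)\<in>A'. - f i j)"
      by (rule sum.reindex_bij_witness[of _ "\<lambda>(i, j). (Suc i, j)" "\<lambda>(i, j). (i - 1, j)"])
         (use False gA in \<open>auto simp: A_def A'_def\<close>)
    moreover have "(\<Sum>(i, j)\<in>B. g i j) = (\<Sum>(i, j)\<in>B'. - f i j)"
      by (rule sum.reindex_bij_witness[of _ "\<lambda>(i, j). (i, Suc j)" "\<lambda>(i, j). (i, j - 1)"])
         (use False gB in \<open>auto simp: B_def B'_def\<close>)
    moreover have "(\<Sum>j\<le>n. \<Sum>i<n. f i j) = (\<Sum>(i, j)\<in>A'. f i j) + (\<Sum>(i, j)\<in>B'. f i j)"
    proof -
      have "(\<Sum>j\<le>n. \<Sum>i<n. f i j) = (\<Sum>(i, j)\<in>{..<n} \<times> {..n}. f i j)"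
        by (subst sum.swap) (simp add: sum.cartesian_product)
      also have "{..<n} \<times> {..n} = A' \<union> B'" by (auto simp: A'_def B'_def)
      also have "(\<Sum>(i, j)\<in>A' \<union> B'. f i j) = (\<Sum>(i, j)\<in>A'. f i j) + (\<Sum>(i, j)\<in>B'. f i j)"
        by (rule sum.union_disjoint[OF fin']) (auto simp: A'_def B'_def)
      finally show ?thesis .
    qed
    ultimately show ?thesis using False by (simp add: f_def sum_negf split_def)
  qed
  from 1 2 show ?thesis by (simp add: g_def)
qed

text \<open>
  The two pullbacks differ by the coboundary of the prism cochain, because a cocycle vanishes on the
  boundary of each piece of the prism.
\<close>

lemma homotopic_imp_cohomologous:
  fixes \<phi> :: "((nat \<Rightarrow> real) \<Rightarrow> 'b::topological_space) \<Rightarrow> 'k::field"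
    and h :: "real \<times> 'a::topological_space \<Rightarrow> 'b"
  assumes "cocycle p Y \<phi>" and h: "continuous_on ({0..1} \<times> X) h" "h ` ({0..1} \<times> X) \<subseteq> Y"
  shows "cohomologous p X (\<lambda>\<sigma>. \<phi> (aug_map p (\<lambda>z. h (1, z)) \<sigma>)) (\<lambda>\<sigma>. \<phi> (aug_map p (\<lambda>z. h (0, z)) \<sigma>))"
proof (cases "0 \<le> p")
  case False
  then show ?thesis by (intro cohomologous_eq) (auto simp: aug_map_def)
next
  case True
  define n where "n = nat p"
  have n: "p = int n" using True by (simp add: n_def)
  define \<psi> where "\<psi> \<tau> = (if n = 0 then 0 else \<Sum>i<n. (-1) ^ i * \<phi> (prism_simplex h (n - 1) i \<tau>))" for \<tau>
  have "\<phi> (aug_map p (\<lambda>z. h (1, z)) \<sigma>) - \<phi> (aug_map p (\<lambda>z. h (0, z)) \<sigma>) = codiff p \<psi> \<sigma>"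
    if "\<sigma> \<in> simplices p X" for \<sigma>
  proof -
    have s: "singular_simplex n (top_of_set X) \<sigma>" using that n by (simp add: aug_simplices_def)
    have "codiff (p + 1) \<phi> (prism_simplex h n i \<sigma>) = 0" if "i \<le> n" for i
    proof -
      have "prism_simplex h n i \<sigma> \<in> simplices (p + 1) Y"
        using singular_simplex_prism[OF s that h] n by (simp add: aug_simplices_def nat_add_distrib)
      with assms(1) show ?thesis by (simp add: cocycle_def)
    qed
    then have "(\<Sum>j\<le>Suc n. (-1) ^ j * \<phi> (singular_face (Suc n) j (prism_simplex h n i \<sigma>))) = 0" if "i \<le> n" for i
      using that n by (simp add: codiff_def aug_face_def nat_add_distrib)
    then have "(\<Sum>i\<le>n. (-1) ^ i * (\<Sum>j\<le>Suc n. (-1) ^ j * \<phi> (singular_face (Suc n) j (prism_simplex h n i \<sigma>)))) = 0"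
      by simp
    then have "(\<Sum>i\<le>n. \<Sum>j\<le>Suc n. (-1) ^ (i + j) * \<phi> (singular_face (Suc n) j (prism_simplex h n i \<sigma>))) = 0"
      by (simp add: sum_distrib_left power_add mult.assoc del: sum.atMost_Suc)
    then have "\<phi> (simplex_map n (\<lambda>z. h (1, z)) \<sigma>) - \<phi> (simplex_map n (\<lambda>z. h (0, z)) \<sigma>)
       = (if n = 0 then 0 else \<Sum>j\<le>n. \<Sum>i<n. (-1) ^ (i + j) * \<phi> (prism_simplex h (n - 1) i (singular_face n j \<sigma>)))"
      unfolding prism_boundary[OF s] by simp
    also have "\<dots> = codiff p \<psi> \<sigma>"
      using n by (auto simp: codiff_def \<psi>_def aug_face_def sum_distrib_left power_add mult_ac intro!: sum.cong)
    finally show ?thesis using n by (simp add: aug_map_def)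
  qed
  then show ?thesis by (auto simp: cohomologous_def)
qed

section \<open>Cocycles on small simplices\<close>

definition pairing :: "(((nat \<Rightarrow> real) \<Rightarrow> 'a) \<Rightarrow> 'k::field) \<Rightarrow> 'a chain \<Rightarrow> 'k" where
  "pairing \<phi> c = (\<Sum>\<sigma>\<in>Poly_Mapping.keys c. of_int (Poly_Mapping.lookup c \<sigma>) * \<phi> \<sigma>)"

lemma pairing_superset:
  assumes "finite S" "Poly_Mapping.keys c \<subseteq> S"
  shows "pairing \<phi> c = (\<Sum>\<sigma>\<in>S. of_int (Poly_Mapping.lookup c \<sigma>) * \<phi> \<sigma>)"
  unfolding pairing_def using assms by (intro sum.mono_neutral_left) (auto simp: in_keys_iff)

lemma pairing_0 [simp]: "pairing \<phi> 0 = 0"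
  by (simp add: pairing_def)

lemma pairing_of [simp]: "pairing \<phi> (frag_of \<sigma>) = \<phi> \<sigma>"
  by (simp add: pairing_def)

lemma pairing_add: "pairing \<phi> (a + b) = pairing \<phi> a + pairing \<phi> b"
proof -
  let ?S = "Poly_Mapping.keys a \<union> Poly_Mapping.keys b"
  have "Poly_Mapping.keys (a + b) \<subseteq> ?S" by (rule Poly_Mapping.keys_add)
  then show ?thesis
    by (simp add: pairing_superset[of ?S] lookup_add distrib_right sum.distrib)
qed

lemma pairing_minus: "pairing \<phi> (- a) = - pairing \<phi> a"
  by (simp add: pairing_def sum_negf)

lemma pairing_diff: "pairing \<phi> (a - b) = pairing \<phi> a - pairing \<phi> b"
  using pairing_add[of \<phi> a "- b"] by (simp add: pairing_minus)

lemma pairing_cmul: "pairing \<phi> (frag_cmul k a) = of_int k * pairing \<phi> a"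
proof -
  have "Poly_Mapping.keys (frag_cmul k a) \<subseteq> Poly_Mapping.keys a" by (rule keys_cmul)
  then show ?thesis
    by (simp add: pairing_superset[of "Poly_Mapping.keys a"] sum_distrib_left mult.assoc)
qed

lemma pairing_sum: "pairing \<phi> (sum f I) = (\<Sum>i\<in>I. pairing \<phi> (f i))"
  by (induction I rule: infinite_finite_induct) (auto simp: pairing_add)

lemma pairing_boundary:
  assumes "0 < p"
  shows "pairing \<phi> (chain_boundary p (frag_of \<sigma>)) = codiff (int p) \<phi> \<sigma>"
  using assms by (simp add: chain_boundary_of pairing_sum pairing_cmul codiff_def aug_face_def)

text \<open>
  The chains that excision uses: those whose simplices lie each in one of two sets.
\<close>

definition small_chain :: "nat \<Rightarrow> 'a::topological_space set \<Rightarrow> 'a set \<Rightarrow> 'a chain \<Rightarrow> bool" where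
  "small_chain p U V c \<longleftrightarrow>
     Poly_Mapping.keys c \<subseteq> singular_simplex_set p (top_of_set U) \<union> singular_simplex_set p (top_of_set V)"

lemma small_chain_0 [simp]: "small_chain p U V 0"
  by (simp add: small_chain_def)

lemma small_chain_diff: "small_chain p U V a \<Longrightarrow> small_chain p U V b \<Longrightarrow> small_chain p U V (a - b)"
  unfolding small_chain_def using keys_diff[of a b] by blast

lemma small_chain_add: "small_chain p U V a \<Longrightarrow> small_chain p U V b \<Longrightarrow> small_chain p U V (a + b)"
  unfolding small_chain_def using Poly_Mapping.keys_add[of a b] by blast

lemma small_chain_cmul: "small_chain p U V a \<Longrightarrow> small_chain p U V (frag_cmul k a)"
  unfolding small_chain_def using keys_cmul[of k a] by blast

lemma small_chain_sum: "(\<And>i. i \<in> I \<Longrightarrow> small_chain p U V (f i)) \<Longrightarrow> small_chain p U V (sum f I)"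
  by (induction I rule: infinite_finite_induct) (auto simp: small_chain_add)

lemma singular_chain_imp_small:
  "singular_chain p (top_of_set U) c \<or> singular_chain p (top_of_set V) c \<Longrightarrow> small_chain p U V c"
  by (auto simp: small_chain_def singular_chain_def)

text \<open>
  An additive operator that does not enlarge the space carrying a chain keeps chains small.
  This applies to iterated subdivision and to the chain homotopy that joins it to the identity.
\<close>

lemma small_chain_operator:
  assumes "small_chain p U V c" "F 0 = 0" "\<And>a b. F (a - b) = F a - F b"
    "\<And>X c. singular_chain p X c \<Longrightarrow> singular_chain q X (F c)"
  shows "small_chain q U V (F c)"
  using assms(1) unfolding small_chain_def[of p]
proof (induction c rule: frag_induction)
  case (one \<sigma>)
  then show ?case
    by (intro singular_chain_imp_small) (auto intro!: assms(4) simp: singular_chain_of)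
next
  case (diff a b)
  then show ?case by (simp add: assms small_chain_diff)
qed (simp add: assms)

lemma pairing_small_boundary:
  assumes "small_chain (Suc p) U V c"
    and "\<And>\<sigma>. \<sigma> \<in> simplices (int p + 1) U \<union> simplices (int p + 1) V \<Longrightarrow> codiff (int p + 1) \<psi> \<sigma> = 0"
  shows "pairing \<psi> (chain_boundary (Suc p) c) = 0"
  using assms(1) unfolding small_chain_def
proof (induction c rule: frag_induction)
  case (one \<sigma>)
  then have "\<sigma> \<in> simplices (int p + 1) U \<union> simplices (int p + 1) V"
    by (auto simp: aug_simplices_def nat_add_distrib)
  with assms(2) show ?case by (auto simp: pairing_boundary add.commute)
next
  case (diff a b)
  then show ?case by (simp add: chain_boundary_diff pairing_diff)
qed simp

text \<open>
  Excision on the level of cochains. Write \<open>sd\<close> for subdivision and \<open>T\<close> for the natural homotopy with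
  \<open>\<partial>T + T\<partial> = sd - 1\<close>. For each simplex \<open>\<sigma>\<close> let \<open>m \<sigma>\<close> be the number of subdivisions after which it
  stays small, and put \<open>\<phi> \<sigma> = \<psi> (\<sigma> + \<partial> S \<sigma>)\<close> where \<open>S \<sigma> = T (1 + sd + \<dots>)\<close> has \<open>m \<sigma>\<close> summands.
  Nothing happens to small simplices, for which \<open>m \<sigma> = 0\<close>. On the boundary of \<open>\<tau>\<close> the value of \<open>\<phi>\<close> is
  that of \<open>\<psi>\<close> on the boundary of a small chain, and therefore zero.
\<close>

lemma extend_small_cocycle:
  fixes \<psi> :: "((nat \<Rightarrow> real) \<Rightarrow> 'a::topological_space) \<Rightarrow> 'k::field"
  assumes U: "openin (top_of_set (U \<union> V)) U" and V: "openin (top_of_set (U \<union> V)) V"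
    and \<psi>: "\<And>\<sigma>. \<sigma> \<in> simplices (p + 1) U \<union> simplices (p + 1) V \<Longrightarrow> codiff (p + 1) \<psi> \<sigma> = 0"
  obtains \<phi> where "cocycle p (U \<union> V) \<phi>"
    "\<And>\<sigma>. \<sigma> \<in> simplices p U \<union> simplices p V \<Longrightarrow> \<phi> \<sigma> = \<psi> \<sigma>"
proof (cases "0 \<le> p")
  case False
  have "simplices (p + 1) (U \<union> V) \<subseteq> simplices (p + 1) U \<union> simplices (p + 1) V"
  proof (cases "p + 1 = 0")
    case True
    show ?thesis
      unfolding True by (auto simp: aug_simplices_def singular_simplex_subtopology standard_simplex_0)
  qed (use False in \<open>auto simp: aug_simplices_def\<close>)
  then have "cocycle p (U \<union> V) \<psi>" using \<psi> by (auto simp: cocycle_def)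
  then show ?thesis using that by blast
next
  case True
  define n where "n = nat p"
  have p: "p = int n" using True by (simp add: n_def)
  let ?Y = "top_of_set (U \<union> V)"
  let ?sd = "\<lambda>q k. (singular_subdivision q ^^ k) :: 'a chain \<Rightarrow> 'a chain"
  obtain T where T0: "\<And>q. T q 0 = (0 :: 'a chain)"
    and Td: "\<And>q c1 c2. T q (c1 - c2) = T q c1 - T q c2"
    and Tc: "\<And>q X c. singular_chain q X c \<Longrightarrow> singular_chain (Suc q) X (T q c)"
    and Tb: "\<And>q X c. singular_chain q X c \<Longrightarrow>
       chain_boundary (Suc q) (T q c) + T (q - Suc 0) (chain_boundary q c) = singular_subdivision q c - c"
    by (blast intro: chain_homotopic_singular_subdivision)
  define S where "S q N c = (\<Sum>k<N. T q (?sd q k c))" for q N and c :: "'a chain"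
  have sdc: "singular_chain q X (?sd q k c)" if "singular_chain q X c" for q X k c
    using that by (induction k) (auto simp: singular_chain_singular_subdivision)
  have sdb: "chain_boundary q (?sd q k c) = ?sd (q - Suc 0) k (chain_boundary q c)" if "singular_chain q X c" for q X k c
    using that by (induction k) (auto simp: chain_boundary_singular_subdivision[OF sdc])
  have Sd: "S q N (a - b) = S q N a - S q N b" for q N a b
    by (simp add: S_def singular_subdivision_power_diff Td sum_subtractf)
  have S0: "S q N 0 = 0" for q N by (simp add: S_def T0)
  have Smin: "S q N (- a) = - S q N a" for q N a using Sd[of q N 0 a] S0 by simp
  have Sadd: "S q N (a + b) = S q N a + S q N b" for q N a b
    using Sd[of q N a "- b"] Smin by simp
  have Ssum: "S q N (sum f I) = (\<Sum>i\<in>I. S q N (f i))" for q N and f :: "nat \<Rightarrow> 'a chain" and I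
    by (induction I rule: infinite_finite_induct) (auto simp: S0 Sadd)
  have Scmul: "S q N (frag_cmul ((-1) ^ i) c) = frag_cmul ((-1) ^ i) (S q N c)" for q N c and i :: nat
    by (cases "even i") (auto simp: Smin)
  have Sb: "chain_boundary (Suc q) (S q N c) + S (q - Suc 0) N (chain_boundary q c) = ?sd q N c - c"
    if c: "singular_chain q X c" for q X N c
  proof (induction N)
    case (Suc N)
    have *: "chain_boundary (Suc q) (T q (?sd q N c)) + T (q - Suc 0) (?sd (q - Suc 0) N (chain_boundary q c))
        = ?sd q (Suc N) c - ?sd q N c"
      using Tb[OF sdc[OF c], of N] sdb[OF c] by simp
    have "chain_boundary (Suc q) (S q (Suc N) c) + S (q - Suc 0) (Suc N) (chain_boundary q c)
      = (chain_boundary (Suc q) (S q N c) + S (q - Suc 0) N (chain_boundary q c)) +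
        (chain_boundary (Suc q) (T q (?sd q N c)) + T (q - Suc 0) (?sd (q - Suc 0) N (chain_boundary q c)))"
      by (simp add: S_def chain_boundary_add)
    also have "\<dots> = ?sd q (Suc N) c - c" unfolding Suc * by simp
    finally show ?case .
  qed (simp add: S_def)
  have sm_T: "small_chain (Suc q) U V (T q c)" if "small_chain q U V c" for q c
    using that by (rule small_chain_operator) (auto simp: T0 Td Tc)
  have sm_sd: "small_chain q U V (?sd q k c)" if "small_chain q U V c" for q k c
    using that by (rule small_chain_operator) (auto simp: singular_subdivision_power_diff sdc)
  have ex: "\<exists>N. \<forall>k\<ge>N. small_chain q U V (?sd q k c)" if c: "singular_chain q ?Y c" for q c
  proof -
    obtain N where N: "\<And>m f. \<lbrakk>N \<le> m; f \<in> Poly_Mapping.keys (?sd q m c)\<rbrakk> \<Longrightarrow> \<exists>W \<in> {U, V}. f \<in> (standard_simplex q) \<rightarrow> W"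
      by (rule sufficient_iterated_singular_subdivision_exists[of "{U, V}" ?Y q c]) (use U V c in auto)
    have "small_chain q U V (?sd q k c)" if "k \<ge> N" for k
      unfolding small_chain_def
    proof
      fix f assume f: "f \<in> Poly_Mapping.keys (?sd q k c)"
      then have "singular_simplex q ?Y f" using sdc[OF c, of k] by (auto simp: singular_chain_def)
      then have "singular_simplex q euclidean f" by (simp add: singular_simplex_subtopology)
      with N[OF that f] show "f \<in> singular_simplex_set q (top_of_set U) \<union> singular_simplex_set q (top_of_set V)"
        by (auto simp: singular_simplex_subtopology)
    qed
    then show ?thesis by blast
  qed
  define m where "m \<sigma> = (LEAST N. \<forall>k\<ge>N. small_chain n U V (?sd n k (frag_of \<sigma>)))" for \<sigma>
  have m: "small_chain n U V (?sd n k (frag_of \<sigma>))" if "singular_simplex n ?Y \<sigma>" "k \<ge> m \<sigma>" for \<sigma> k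
  proof -
    have "\<forall>k\<ge>m \<sigma>. small_chain n U V (?sd n k (frag_of \<sigma>))"
      unfolding m_def by (rule LeastI_ex[OF ex]) (use that in \<open>simp add: singular_chain_of\<close>)
    with that show ?thesis by blast
  qed
  have m0: "m \<sigma> = 0" if "small_chain n U V (frag_of \<sigma>)" for \<sigma>
    unfolding m_def by (rule Least_equality) (use that sm_sd in auto)
  define \<phi> where "\<phi> \<sigma> = pairing \<psi> (frag_of \<sigma> + chain_boundary (Suc n) (S n (m \<sigma>) (frag_of \<sigma>)))" for \<sigma>
  show ?thesis
  proof (rule that)
    fix \<sigma> assume "\<sigma> \<in> simplices p U \<union> simplices p V"
    then have "small_chain n U V (frag_of \<sigma>)"
      by (auto simp: small_chain_def aug_simplices_def p)
    then show "\<phi> \<sigma> = \<psi> \<sigma>" by (simp add: \<phi>_def m0 S_def)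
  next
    show "cocycle p (U \<union> V) \<phi>"
      unfolding cocycle_def
    proof
      fix \<tau> assume "\<tau> \<in> simplices (p + 1) (U \<union> V)"
      then have \<tau>: "singular_simplex (Suc n) ?Y \<tau>" by (simp add: p aug_simplices_def nat_add_distrib)
      define f where "f i = singular_face (Suc n) i \<tau>" for i
      have f: "singular_simplex n ?Y (f i)" if "i \<le> Suc n" for i
        using singular_simplex_singular_face[OF \<tau>, of i] that by (simp add: f_def)
      obtain N0 where N0: "\<forall>k\<ge>N0. small_chain (Suc n) U V (?sd (Suc n) k (frag_of \<tau>))"
        using ex[of "Suc n" "frag_of \<tau>"] \<tau> by (auto simp: singular_chain_of)
      define N where "N = Max (insert N0 ((\<lambda>i. m (f i)) ` {..Suc n}))"
      have N: "N0 \<le> N" "\<And>i. i \<le> Suc n \<Longrightarrow> m (f i) \<le> N"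
        unfolding N_def by (rule Max_ge; auto)+
      \<comment> \<open>Up to a boundary this is \<open>\<tau> + S (\<partial> \<tau>)\<close>, where each face has its own number of subdivisions.
        It is small because only subdivisions of faces beyond \<open>m\<close> remain in the difference.\<close>
      define e where "e = ?sd (Suc n) N (frag_of \<tau>) +
         (\<Sum>i\<le>Suc n. frag_cmul ((-1) ^ i) (S n (m (f i)) (frag_of (f i)) - S n N (frag_of (f i))))"
      have bd: "chain_boundary (Suc n) (frag_of \<tau>) = (\<Sum>i\<le>Suc n. frag_cmul ((-1) ^ i) (frag_of (f i)))"
        by (simp add: chain_boundary_of f_def del: sum.atMost_Suc)
      have e: "e = frag_of \<tau> + chain_boundary (Suc (Suc n)) (S (Suc n) N (frag_of \<tau>))
          + (\<Sum>i\<le>Suc n. frag_cmul ((-1) ^ i) (S n (m (f i)) (frag_of (f i))))"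
      proof -
        have d: "frag_cmul k (a - b) = frag_cmul k a - frag_cmul k b" for k :: int and a b :: "'a chain"
          by (simp add: lookup_minus poly_mapping_eqI right_diff_distrib)
        have "chain_boundary (Suc (Suc n)) (S (Suc n) N (frag_of \<tau>))
            + (\<Sum>i\<le>Suc n. frag_cmul ((-1) ^ i) (S n N (frag_of (f i)))) = ?sd (Suc n) N (frag_of \<tau>) - frag_of \<tau>"
          using Sb[of "Suc n" ?Y "frag_of \<tau>" N] \<tau>
          by (simp add: bd Ssum Scmul singular_chain_of del: sum.atMost_Suc)
        then have "?sd (Suc n) N (frag_of \<tau>) = frag_of \<tau> + (chain_boundary (Suc (Suc n)) (S (Suc n) N (frag_of \<tau>))
            + (\<Sum>i\<le>Suc n. frag_cmul ((-1) ^ i) (S n N (frag_of (f i)))))"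
          by (simp only: eq_diff_eq add.commute[of "frag_of \<tau>"])
        moreover have "x + (y + z) + (w - z) = x + y + w" for x y z w :: "'a chain"
          by (simp add: algebra_simps)
        ultimately show ?thesis
          unfolding e_def d sum_subtractf by (simp only:)
      qed
      have "small_chain (Suc n) U V e"
        unfolding e_def
      proof (intro small_chain_add small_chain_sum small_chain_cmul)
        show "small_chain (Suc n) U V (?sd (Suc n) N (frag_of \<tau>))" using N0 N by blast
        fix i assume i: "i \<in> {..Suc n}"
        have "S n N (frag_of (f i)) = S n (m (f i)) (frag_of (f i)) + (\<Sum>k=m (f i)..<N. T n (?sd n k (frag_of (f i))))"
          using N(2)[of i] i unfolding S_def lessThan_atLeast0 by (simp add: sum.atLeastLessThan_concat)
        then have "S n (m (f i)) (frag_of (f i)) - S n N (frag_of (f i)) = 0 - (\<Sum>k=m (f i)..<N. T n (?sd n k (frag_of (f i))))"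
          by simp
        moreover have "small_chain (Suc n) U V (0 - (\<Sum>k=m (f i)..<N. T n (?sd n k (frag_of (f i)))))"
          using m[OF f] i by (intro small_chain_diff small_chain_0 small_chain_sum sm_T) auto
        ultimately show "small_chain (Suc n) U V (S n (m (f i)) (frag_of (f i)) - S n N (frag_of (f i)))" by simp
      qed
      then have "pairing \<psi> (chain_boundary (Suc n) e) = 0"
        by (rule pairing_small_boundary) (use \<psi> p in auto)
      moreover have "chain_boundary (Suc n) (chain_boundary (Suc (Suc n)) (S (Suc n) N (frag_of \<tau>))) = 0"
        by (rule chain_boundary_boundary_alt[of _ ?Y])
          (use \<tau> in \<open>auto simp: S_def singular_chain_of intro!: singular_chain_sum Tc sdc\<close>)
      ultimately have "pairing \<psi> (\<Sum>i\<le>Suc n. frag_cmul ((-1) ^ i) (frag_of (f i) + chain_boundary (Suc n) (S n (m (f i)) (frag_of (f i))))) = 0"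
        unfolding e chain_boundary_add
        by (simp add: chain_boundary_sum chain_boundary_cmul bd frag_cmul_distrib2 sum.distrib del: sum.atMost_Suc)
      then have "(\<Sum>i\<le>Suc n. (-1) ^ i * \<phi> (f i)) = 0"
        by (simp add: pairing_sum pairing_cmul \<phi>_def del: sum.atMost_Suc)
      then show "codiff (p + 1) \<phi> \<tau> = 0"
        by (simp add: codiff_def p aug_face_def f_def nat_add_distrib del: sum.atMost_Suc)
    qed
  qed
qed

section \<open>Gluing cocycles and Mayer-Vietoris\<close>

lemma simplices_Int: "simplices p U \<inter> simplices p V = simplices p (U \<inter> V)"
  by (auto simp: aug_simplices_def singular_simplex_subtopology)

text \<open>
  After subtracting a coboundary the two cocycles agree on the intersection and define a cocycle on
  small simplices.
\<close>

lemma glue_cocycles_open: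
  fixes \<alpha> \<beta> :: "((nat \<Rightarrow> real) \<Rightarrow> 'a::topological_space) \<Rightarrow> 'k::field"
  assumes U: "openin (top_of_set (U \<union> V)) U" and V: "openin (top_of_set (U \<union> V)) V"
    and \<alpha>: "cocycle p U \<alpha>" and \<beta>: "cocycle p V \<beta>" and eq: "cohomologous p (U \<inter> V) \<alpha> \<beta>"
  obtains \<phi> where "cocycle p (U \<union> V) \<phi>" "cohomologous p U \<phi> \<alpha>" "cohomologous p V \<phi> \<beta>"
proof -
  obtain \<theta> where \<theta>: "\<And>\<sigma>. \<sigma> \<in> simplices p (U \<inter> V) \<Longrightarrow> \<alpha> \<sigma> - \<beta> \<sigma> = codiff p \<theta> \<sigma>"
    using eq by (auto simp: cohomologous_def)
  define \<psi> where "\<psi> \<sigma> = (if \<sigma> \<in> simplices p U then \<alpha> \<sigma> - codiff p \<theta> \<sigma> else \<beta> \<sigma>)" for \<sigma>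
  have U': "\<psi> \<sigma> = \<alpha> \<sigma> - codiff p \<theta> \<sigma>" if "\<sigma> \<in> simplices p U" for \<sigma>
    using that by (simp add: \<psi>_def)
  have V': "\<psi> \<sigma> = \<beta> \<sigma>" if "\<sigma> \<in> simplices p V" for \<sigma>
    using that \<theta>[of \<sigma>] by (auto simp: \<psi>_def algebra_simps simp flip: simplices_Int)
  have cU: "cocycle p U \<psi>"
    using cocycle_diff[OF \<alpha> cocycle_codiff[of p U \<theta>]] cocycle_cong[of p U \<psi> "\<lambda>\<sigma>. \<alpha> \<sigma> - codiff p \<theta> \<sigma>"] U' by blast
  have cV: "cocycle p V \<psi>" using \<beta> cocycle_cong[of p V \<psi> \<beta>] V' by blast
  obtain \<phi> where \<phi>: "cocycle p (U \<union> V) \<phi>" "\<And>\<sigma>. \<sigma> \<in> simplices p U \<union> simplices p V \<Longrightarrow> \<phi> \<sigma> = \<psi> \<sigma>"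
    by (rule extend_small_cocycle[OF U V, of p \<psi>]) (use cU cV in \<open>auto simp: cocycle_def\<close>)
  show ?thesis
  proof (rule that[OF \<phi>(1)])
    have "\<forall>\<sigma>\<in>simplices p U. \<phi> \<sigma> - \<alpha> \<sigma> = codiff p (\<lambda>\<sigma>. - \<theta> \<sigma>) \<sigma>"
      using \<phi>(2) U' by (simp add: codiff_uminus)
    then show "cohomologous p U \<phi> \<alpha>" by (auto simp: cohomologous_def)
    show "cohomologous p V \<phi> \<beta>" by (rule cohomologous_eq) (use \<phi>(2) V' in auto)
  qed
qed

text \<open>
  The complement is the projection of a closed set along the compact unit interval.
\<close>

lemma openin_tube:
  fixes f :: "real \<times> 'a::topological_space \<Rightarrow> 'b::topological_space"
  assumes "continuous_on ({0..1} \<times> V) f" "open G"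
  shows "openin (top_of_set V) {z \<in> V. \<forall>t\<in>{0..1}. f (t, z) \<in> G}"
proof -
  have "closedin (top_of_set ({0..1} \<times> V)) (({0..1} \<times> V) \<inter> f -` (- G))"
    using assms by (intro continuous_closedin_preimage) auto
  moreover have "closed_map (prod_topology (top_of_set {0..1::real}) (top_of_set V)) (top_of_set V) snd"
    by (intro closed_map_snd) (simp add: compact_space_subtopology)
  moreover have "prod_topology (top_of_set {0..1::real}) (top_of_set V) = top_of_set ({0..1} \<times> V)"
    using subtopology_Times[of euclidean euclidean "{0..1::real}" V] by simp
  ultimately have "closedin (top_of_set V) (snd ` (({0..1} \<times> V) \<inter> f -` (- G)))"
    by (simp add: closed_map_def)
  then have "openin (top_of_set V) (V - snd ` (({0..1} \<times> V) \<inter> f -` (- G)))"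
    by (simp add: openin_diff)
  also have "V - snd ` (({0..1} \<times> V) \<inter> f -` (- G)) = {z \<in> V. \<forall>t\<in>{0..1}. f (t, z) \<in> G}"
    by force
  finally show ?thesis .
qed

text \<open>
  Around the intersection of two closed sets that are neighbourhood retracts there is a neighbourhood
  \<open>V\<close> that retracts onto the intersection by \<open>\<rho>\<close>, in such a way that on each side the retraction is
  homotopic, inside that side, to the map that is the identity on the side and \<open>\<rho>\<close> off it. The
  homotopy is the straight line between the two maps, pushed back by the neighbourhood retraction of the
  side; \<open>V\<close> consists of the points for which the line stays in the domain of that retraction.
\<close>

lemma ENR_pair_neighbourhood:
  fixes A B :: "'a::euclidean_space set"
  assumes A: "closedin (top_of_set (A \<union> B)) A" and B: "closedin (top_of_set (A \<union> B)) B"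
    and "ENR A" "ENR B" "ENR (A \<inter> B)"
  obtains V \<rho> hA hB where "openin (top_of_set (A \<union> B)) V" "A \<inter> B \<subseteq> V"
    "continuous_on V \<rho>" "\<rho> ` V \<subseteq> A \<inter> B" "\<And>z. z \<in> A \<inter> B \<Longrightarrow> \<rho> z = z"
    "continuous_on ({0..1} \<times> V) hA" "hA ` ({0..1::real} \<times> V) \<subseteq> A"
    "\<And>z. z \<in> V \<Longrightarrow> hA (0, z) = (if z \<in> A then z else \<rho> z)" "\<And>z. z \<in> V \<Longrightarrow> hA (1, z) = \<rho> z"
    "continuous_on ({0..1} \<times> V) hB" "hB ` ({0..1::real} \<times> V) \<subseteq> B"
    "\<And>z. z \<in> V \<Longrightarrow> hB (0, z) = (if z \<in> B then z else \<rho> z)" "\<And>z. z \<in> V \<Longrightarrow> hB (1, z) = \<rho> z"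
proof -
  obtain GA \<pi>A where GA: "open GA" "retraction GA A \<pi>A" using \<open>ENR A\<close> by (auto simp: ENR_def retract_of_def)
  obtain GB \<pi>B where GB: "open GB" "retraction GB B \<pi>B" using \<open>ENR B\<close> by (auto simp: ENR_def retract_of_def)
  obtain GD \<rho> where GD: "open GD" "retraction GD (A \<inter> B) \<rho>" using \<open>ENR (A \<inter> B)\<close> by (auto simp: ENR_def retract_of_def)
  define V0 where "V0 = (A \<union> B) \<inter> GD"
  have V0: "openin (top_of_set (A \<union> B)) V0" using GD by (auto simp: V0_def)
  have D0: "A \<inter> B \<subseteq> V0" using GD by (auto simp: V0_def retraction_def)
  have \<rho>c: "continuous_on V0 \<rho>" using GD by (auto simp: V0_def retraction_def intro: continuous_on_subset)
  have \<rho>D: "\<rho> z \<in> A \<inter> B" if "z \<in> V0" for z using GD that by (auto simp: V0_def retraction_def)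
  have \<rho>i: "\<rho> z = z" if "z \<in> A \<inter> B" for z using GD that by (auto simp: retraction_def)
  define r where "r C z = (if z \<in> C then z else \<rho> z)" for C z
  have split: "V0 = (V0 \<inter> A) \<union> (V0 \<inter> B)" by (auto simp: V0_def)
  have clA: "closedin (top_of_set V0) (V0 \<inter> A)" and clB: "closedin (top_of_set V0) (V0 \<inter> B)"
    using A B by (auto simp: V0_def closedin_subtopology)
  have rA: "continuous_on V0 (r A)"
    unfolding r_def
    by (subst split, rule continuous_on_cases_local)
       (use clA clB split \<rho>i \<rho>c in \<open>auto intro: continuous_on_subset continuous_on_id\<close>)
  have split': "V0 = (V0 \<inter> B) \<union> (V0 \<inter> A)" by (auto simp: V0_def)
  have rB: "continuous_on V0 (r B)"
    unfolding r_def
    by (subst split', rule continuous_on_cases_local)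
       (use clA clB split' \<rho>i \<rho>c in \<open>auto intro: continuous_on_subset continuous_on_id\<close>)
  define s where "s C = (\<lambda>(t, z). (1 - t) *\<^sub>R r C z + t *\<^sub>R \<rho> z)" for C and t :: real and z
  have s: "continuous_on ({0..1} \<times> V0) (s C)" if "continuous_on V0 (r C)" for C
    unfolding s_def split_def
    by (intro continuous_intros continuous_on_compose2[OF that] continuous_on_compose2[OF \<rho>c]) auto
  define V where "V = {z\<in>V0. \<forall>t\<in>{0..1}. s A (t, z) \<in> GA} \<inter> {z\<in>V0. \<forall>t\<in>{0..1}. s B (t, z) \<in> GB}"
  have "openin (top_of_set V0) V"
    unfolding V_def by (intro openin_Int openin_tube s rA rB GA GB)
  then have V: "openin (top_of_set (A \<union> B)) V" using V0 openin_trans by blast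
  have VV0: "V \<subseteq> V0" by (auto simp: V_def)
  have sid: "s C (t, z) = z" if "z \<in> A \<inter> B" for C t z
    using that \<rho>i[of z] by (simp add: s_def r_def flip: scaleR_add_left)
  have AGA: "A \<subseteq> GA" "B \<subseteq> GB" using GA GB by (auto simp: retraction_def)
  have DV: "A \<inter> B \<subseteq> V" using D0 AGA sid by (auto simp: V_def)
  have sV: "continuous_on ({0..1} \<times> V) (s C)" if "continuous_on V0 (r C)" for C
    using s[OF that] by (rule continuous_on_subset) (use VV0 in auto)
  have pA: "\<pi>A z = z" if "z \<in> A" for z using GA that by (auto simp: retraction_def)
  have pB: "\<pi>B z = z" if "z \<in> B" for z using GB that by (auto simp: retraction_def)
  show ?thesis
  proof (rule that[OF V DV, of \<rho> "\<pi>A \<circ> s A" "\<pi>B \<circ> s B"])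
    show "continuous_on V \<rho>" using \<rho>c VV0 continuous_on_subset by blast
    show "\<rho> ` V \<subseteq> A \<inter> B" using \<rho>D VV0 by blast
    show "\<rho> z = z" if "z \<in> A \<inter> B" for z using that by (rule \<rho>i)
    show "continuous_on ({0..1} \<times> V) (\<pi>A \<circ> s A)"
      using GA by (intro continuous_on_compose sV rA)
        (auto simp: retraction_def V_def image_def intro: continuous_on_subset)
    show "continuous_on ({0..1} \<times> V) (\<pi>B \<circ> s B)"
      using GB by (intro continuous_on_compose sV rB)
        (auto simp: retraction_def V_def image_def intro: continuous_on_subset)
    show "(\<pi>A \<circ> s A) ` ({0..1} \<times> V) \<subseteq> A"
      using GA by (auto simp: retraction_def V_def)
    show "(\<pi>B \<circ> s B) ` ({0..1} \<times> V) \<subseteq> B"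
      using GB by (auto simp: retraction_def V_def)
    fix z assume z: "z \<in> V"
    then show "(\<pi>A \<circ> s A) (0, z) = (if z \<in> A then z else \<rho> z)" "(\<pi>B \<circ> s B) (0, z) = (if z \<in> B then z else \<rho> z)"
      "(\<pi>A \<circ> s A) (1, z) = \<rho> z" "(\<pi>B \<circ> s B) (1, z) = \<rho> z"
      using \<rho>D[of z] VV0 by (auto simp: s_def r_def pA pB)
  qed
qed

lemma continuous_on_extend_retraction:
  fixes A B :: "'a::topological_space set"
  assumes A: "closedin (top_of_set (A \<union> B)) A" and B: "closedin (top_of_set (A \<union> B)) B"
    and V: "V \<subseteq> A \<union> B" "A \<inter> B \<subseteq> V" and \<rho>: "continuous_on V \<rho>" "\<And>z. z \<in> A \<inter> B \<Longrightarrow> \<rho> z = z"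
  shows "continuous_on (A \<union> V) (\<lambda>z. if z \<in> A then z else \<rho> z)"
proof -
  have eq: "A \<union> V = A \<union> (V \<inter> B)" "V \<inter> B = (A \<union> (V \<inter> B)) \<inter> B" using V by auto
  have "closedin (top_of_set (A \<union> (V \<inter> B))) A"
    by (rule closedin_subset_trans[OF A]) auto
  moreover have "closedin (top_of_set (A \<union> (V \<inter> B))) (V \<inter> B)"
    by (subst (2) eq(2)) (use B in \<open>auto simp: closedin_subtopology\<close>)
  ultimately show ?thesis
    unfolding eq(1)
    by (rule continuous_on_cases_local) (use \<rho> in \<open>auto intro: continuous_on_subset continuous_on_id\<close>)
qed

lemma openin_union_neighbourhood:
  assumes B: "closedin (top_of_set (A \<union> B)) B" and V: "openin (top_of_set (A \<union> B)) V" and "A \<inter> B \<subseteq> V"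
  shows "openin (top_of_set (A \<union> B)) (A \<union> V)"
proof -
  have "V \<subseteq> A \<union> B" using openin_subset[OF V] by simp
  then have "A \<union> V = (A \<union> B) - (B - V)" using assms by auto
  moreover have "openin (top_of_set (A \<union> B)) ((A \<union> B) - (B - V))"
    using B V by (metis closedin_diff openin_diff openin_subtopology_self)
  ultimately show ?thesis by simp
qed

text \<open>
  Gluing along closed sets is reduced to gluing along the open sets \<open>A \<union> V\<close> and \<open>B \<union> V\<close>, to which the
  cocycles are pulled back. On their intersection \<open>V\<close> both pullbacks are cohomologous to pullbacks
  under \<open>\<rho>\<close> from \<open>A \<inter> B\<close>, where they agree by assumption.
\<close>

lemma glue_cocycles:
  fixes A B :: "'a::euclidean_space set" and \<alpha> \<beta> :: "((nat \<Rightarrow> real) \<Rightarrow> 'a) \<Rightarrow> 'k::field"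
  assumes A: "closedin (top_of_set (A \<union> B)) A" and B: "closedin (top_of_set (A \<union> B)) B"
    and "ENR A" "ENR B" "ENR (A \<inter> B)"
    and \<alpha>: "cocycle p A \<alpha>" and \<beta>: "cocycle p B \<beta>" and eq: "cohomologous p (A \<inter> B) \<alpha> \<beta>"
  obtains \<phi> where "cocycle p (A \<union> B) \<phi>" "cohomologous p A \<phi> \<alpha>" "cohomologous p B \<phi> \<beta>"
proof -
  obtain V \<rho> hA hB where V: "openin (top_of_set (A \<union> B)) V" "A \<inter> B \<subseteq> V"
    and \<rho>: "continuous_on V \<rho>" "\<rho> ` V \<subseteq> A \<inter> B" "\<And>z. z \<in> A \<inter> B \<Longrightarrow> \<rho> z = z"
    and hA: "continuous_on ({0..1} \<times> V) hA" "hA ` ({0..1::real} \<times> V) \<subseteq> A"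
    and hA01: "\<And>z. z \<in> V \<Longrightarrow> hA (0, z) = (if z \<in> A then z else \<rho> z)" "\<And>z. z \<in> V \<Longrightarrow> hA (1, z) = \<rho> z"
    and hB: "continuous_on ({0..1} \<times> V) hB" "hB ` ({0..1::real} \<times> V) \<subseteq> B"
    and hB01: "\<And>z. z \<in> V \<Longrightarrow> hB (0, z) = (if z \<in> B then z else \<rho> z)" "\<And>z. z \<in> V \<Longrightarrow> hB (1, z) = \<rho> z"
    by (rule ENR_pair_neighbourhood[OF assms(1-5)]) blast
  have VAB: "V \<subseteq> A \<union> B" using openin_subset[OF V(1)] by simp
  define rA where "rA z = (if z \<in> A then z else \<rho> z)" for z
  define rB where "rB z = (if z \<in> B then z else \<rho> z)" for z
  have rA: "continuous_on (A \<union> V) rA" "rA ` (A \<union> V) \<subseteq> A"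
    using continuous_on_extend_retraction[OF A B VAB V(2) \<rho>(1,3)] \<rho>(2) unfolding rA_def by auto
  have rB: "continuous_on (B \<union> V) rB" "rB ` (B \<union> V) \<subseteq> B"
    using continuous_on_extend_retraction[of B A V \<rho>] A B VAB V(2) \<rho> unfolding rB_def
    by (auto simp: Un_commute Int_commute)
  let ?\<alpha> = "\<lambda>\<sigma>. \<alpha> (aug_map p rA \<sigma>)" and ?\<beta> = "\<lambda>\<sigma>. \<beta> (aug_map p rB \<sigma>)"
  have Y: "(A \<union> V) \<union> (B \<union> V) = A \<union> B" "(A \<union> V) \<inter> (B \<union> V) = V" using VAB V(2) by auto
  have oA: "openin (top_of_set (A \<union> B)) (A \<union> V)" by (rule openin_union_neighbourhood[OF B V])
  have oB: "openin (top_of_set (A \<union> B)) (B \<union> V)"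
    using openin_union_neighbourhood[of B A V] A V by (auto simp: Un_commute Int_commute)
  have "cohomologous p V (\<lambda>\<sigma>. \<alpha> (aug_map p (\<lambda>z. hA (1, z)) \<sigma>)) (\<lambda>\<sigma>. \<alpha> (aug_map p (\<lambda>z. hA (0, z)) \<sigma>))"
    by (rule homotopic_imp_cohomologous[OF \<alpha> hA])
  moreover have "aug_map p (\<lambda>z. hA (1, z)) \<sigma> = aug_map p \<rho> \<sigma>" "aug_map p (\<lambda>z. hA (0, z)) \<sigma> = aug_map p rA \<sigma>"
    if "\<sigma> \<in> simplices p V" for \<sigma>
    using that by (auto intro!: aug_map_cong simp: hA01 rA_def)
  ultimately have "cohomologous p V (\<lambda>\<sigma>. \<alpha> (aug_map p \<rho> \<sigma>)) ?\<alpha>"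
    by (simp add: cohomologous_def)
  then have 1: "cohomologous p V ?\<alpha> (\<lambda>\<sigma>. \<alpha> (aug_map p \<rho> \<sigma>))" by (rule cohomologous_sym)
  have "cohomologous p V (\<lambda>\<sigma>. \<beta> (aug_map p (\<lambda>z. hB (1, z)) \<sigma>)) (\<lambda>\<sigma>. \<beta> (aug_map p (\<lambda>z. hB (0, z)) \<sigma>))"
    by (rule homotopic_imp_cohomologous[OF \<beta> hB])
  moreover have "aug_map p (\<lambda>z. hB (1, z)) \<sigma> = aug_map p \<rho> \<sigma>" "aug_map p (\<lambda>z. hB (0, z)) \<sigma> = aug_map p rB \<sigma>"
    if "\<sigma> \<in> simplices p V" for \<sigma>
    using that by (auto intro!: aug_map_cong simp: hB01 rB_def)
  ultimately have 2: "cohomologous p V (\<lambda>\<sigma>. \<beta> (aug_map p \<rho> \<sigma>)) ?\<beta>"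
    by (simp add: cohomologous_def)
  have 3: "cohomologous p V (\<lambda>\<sigma>. \<alpha> (aug_map p \<rho> \<sigma>)) (\<lambda>\<sigma>. \<beta> (aug_map p \<rho> \<sigma>))"
    by (rule cohomologous_pullback[OF eq \<rho>(1,2)])
  have "cohomologous p V ?\<alpha> ?\<beta>" using 1 2 3 cohomologous_trans by blast
  then obtain \<phi> where \<phi>: "cocycle p (A \<union> B) \<phi>" "cohomologous p (A \<union> V) \<phi> ?\<alpha>" "cohomologous p (B \<union> V) \<phi> ?\<beta>"
    using glue_cocycles_open[of "A \<union> V" "B \<union> V" p ?\<alpha> ?\<beta>] oA oB
      cocycle_pullback[OF \<alpha> rA] cocycle_pullback[OF \<beta> rB] unfolding Y by blast
  have "cohomologous p A ?\<alpha> \<alpha>" "cohomologous p B ?\<beta> \<beta>"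
    using aug_map_ident[of _ p A rA] aug_map_ident[of _ p B rB]
    by (auto intro!: cohomologous_eq simp: rA_def rB_def)
  moreover have "cohomologous p A \<phi> ?\<alpha>" "cohomologous p B \<phi> ?\<beta>"
    using \<phi>(2,3) by (auto elim: cohomologous_mono)
  ultimately show ?thesis using that[OF \<phi>(1)] cohomologous_trans by blast
qed

text \<open>
  The connecting homomorphism is injective when \<open>A\<close> and \<open>B\<close> are acyclic one degree lower. A cocycle
  \<open>\<gamma>\<close> on \<open>A \<inter> B\<close> is spread to a neighbourhood \<open>V\<close>; the coboundary of the spread cochain on
  \<open>A \<union> V\<close>, and zero on \<open>B \<union> V\<close>, form a cocycle on small simplices. If its extension
  bounds \<open>\<theta>\<close>, then \<open>\<gamma> - \<theta>\<close> on \<open>A\<close> and \<open>\<theta>\<close> on \<open>B\<close> are cocycles, so \<open>\<gamma>\<close> is a coboundary.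
\<close>

lemma Mayer_Vietoris_connecting:
  fixes A B :: "'a::euclidean_space set" and K :: "'k::field itself"
  assumes A: "closedin (top_of_set (A \<union> B)) A" and B: "closedin (top_of_set (A \<union> B)) B"
    and "ENR (A \<inter> B)"
    and acA: "acyclic_in K (p - 1) A" and acB: "acyclic_in K (p - 1) B"
    and nac: "\<not> acyclic_in K (p - 1) (A \<inter> B)"
  shows "\<not> acyclic_in K p (A \<union> B)"
proof
  assume acY: "acyclic_in K p (A \<union> B)"
  obtain \<gamma> :: "((nat \<Rightarrow> real) \<Rightarrow> 'a) \<Rightarrow> 'k" where \<gamma>: "cocycle (p - 1) (A \<inter> B) \<gamma>" "\<not> cohomologous (p - 1) (A \<inter> B) \<gamma> (\<lambda>_. 0)"
    using nac by (auto simp: acyclic_in_def)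
  obtain G \<rho> where G: "open G" "retraction G (A \<inter> B) \<rho>" using \<open>ENR (A \<inter> B)\<close> by (auto simp: ENR_def retract_of_def)
  define V where "V = (A \<union> B) \<inter> G"
  have V: "openin (top_of_set (A \<union> B)) V" "A \<inter> B \<subseteq> V" "V \<subseteq> A \<union> B" using G by (auto simp: V_def retraction_def)
  have \<rho>: "continuous_on V \<rho>" "\<rho> ` V \<subseteq> A \<inter> B" "\<And>z. z \<in> A \<inter> B \<Longrightarrow> \<rho> z = z"
    using G by (auto simp: V_def retraction_def intro: continuous_on_subset)
  have Y: "(A \<union> V) \<union> (B \<union> V) = A \<union> B" "(A \<union> V) \<inter> (B \<union> V) = V" using V by auto
  have oA: "openin (top_of_set (A \<union> B)) (A \<union> V)" by (rule openin_union_neighbourhood[OF B V(1,2)])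
  have oB: "openin (top_of_set (A \<union> B)) (B \<union> V)"
    using openin_union_neighbourhood[of B A V] A V by (auto simp: Un_commute Int_commute)
  define \<gamma>' where "\<gamma>' \<sigma> = \<gamma> (aug_map (p - 1) \<rho> \<sigma>)" for \<sigma>
  have \<gamma>': "cocycle (p - 1) V \<gamma>'" unfolding \<gamma>'_def by (rule cocycle_pullback[OF \<gamma>(1) \<rho>(1,2)])
  define \<psi> where "\<psi> \<sigma> = (if \<sigma> \<in> simplices p (A \<union> V) then codiff p \<gamma>' \<sigma> else 0)" for \<sigma>
  have \<psi>A: "\<psi> \<sigma> = codiff p \<gamma>' \<sigma>" if "\<sigma> \<in> simplices p (A \<union> V)" for \<sigma> using that by (simp add: \<psi>_def)
  have \<psi>B: "\<psi> \<sigma> = 0" if "\<sigma> \<in> simplices p (B \<union> V)" for \<sigma>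
  proof (cases "\<sigma> \<in> simplices p (A \<union> V)")
    case True
    then have "\<sigma> \<in> simplices p V" using that simplices_Int[of p "A \<union> V" "B \<union> V"] Y by auto
    with \<gamma>' True show ?thesis by (simp add: \<psi>_def cocycle_def)
  qed (simp add: \<psi>_def)
  have "cocycle p (A \<union> V) \<psi>"
    using cocycle_codiff[of p "A \<union> V" \<gamma>'] cocycle_cong[of p "A \<union> V" \<psi> "codiff p \<gamma>'"] \<psi>A by blast
  moreover have "cocycle p (B \<union> V) \<psi>"
    using cocycle_cong[of p "B \<union> V" \<psi> "\<lambda>_. 0"] \<psi>B by (auto simp: cocycle_def)
  ultimately obtain \<phi> where \<phi>: "cocycle p (A \<union> B) \<phi>"
    "\<And>\<sigma>. \<sigma> \<in> simplices p (A \<union> V) \<union> simplices p (B \<union> V) \<Longrightarrow> \<phi> \<sigma> = \<psi> \<sigma>"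
    using extend_small_cocycle[of "A \<union> V" "B \<union> V" p \<psi>] oA oB unfolding Y cocycle_def by blast
  obtain \<theta> where \<theta>: "\<forall>\<sigma>\<in>simplices p (A \<union> B). \<phi> \<sigma> = codiff p \<theta> \<sigma>"
    using acY \<phi>(1) by (auto simp: acyclic_in_def cohomologous_def)
  have sub: "simplices p A \<subseteq> simplices p (A \<union> B)" "simplices p A \<subseteq> simplices p (A \<union> V)"
       "simplices p B \<subseteq> simplices p (A \<union> B)" "simplices p B \<subseteq> simplices p (B \<union> V)"
    by (intro simplices_mono; auto)+
  have "cocycle (p - 1) A (\<lambda>\<sigma>. \<gamma>' \<sigma> - \<theta> \<sigma>)"
    unfolding cocycle_def
  proof
    fix \<sigma> assume "\<sigma> \<in> simplices (p - 1 + 1) A"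
    then have "\<sigma> \<in> simplices p (A \<union> B)" "\<sigma> \<in> simplices p (A \<union> V)" using sub by auto
    then show "codiff (p - 1 + 1) (\<lambda>\<sigma>. \<gamma>' \<sigma> - \<theta> \<sigma>) \<sigma> = 0"
      using \<theta> \<phi>(2)[of \<sigma>] \<psi>A[of \<sigma>] by (simp add: codiff_diff)
  qed
  then have "cohomologous (p - 1) A (\<lambda>\<sigma>. \<gamma>' \<sigma> - \<theta> \<sigma>) (\<lambda>_. 0)"
    using acA by (auto simp: acyclic_in_def)
  then have "cohomologous (p - 1) A \<gamma>' \<theta>" by (simp add: cohomologous_def)
  then have 1: "cohomologous (p - 1) (A \<inter> B) \<gamma>' \<theta>" by (rule cohomologous_mono) simp
  have "cocycle (p - 1) B \<theta>"
    unfolding cocycle_def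
  proof
    fix \<sigma> assume "\<sigma> \<in> simplices (p - 1 + 1) B"
    then have "\<sigma> \<in> simplices p (A \<union> B)" "\<sigma> \<in> simplices p (B \<union> V)" using sub by auto
    then show "codiff (p - 1 + 1) \<theta> \<sigma> = 0"
      using \<theta> \<phi>(2)[of \<sigma>] \<psi>B[of \<sigma>] by simp
  qed
  then have "cohomologous (p - 1) B \<theta> (\<lambda>_. 0)"
    using acB by (auto simp: acyclic_in_def)
  then have "cohomologous (p - 1) (A \<inter> B) \<theta> (\<lambda>_. 0)" by (rule cohomologous_mono) auto
  with 1 have "cohomologous (p - 1) (A \<inter> B) \<gamma>' (\<lambda>_. 0)" by (rule cohomologous_trans)
  moreover have "cohomologous (p - 1) (A \<inter> B) \<gamma> \<gamma>'"
    unfolding \<gamma>'_def by (rule cohomologous_eq) (use aug_map_ident \<rho>(3) in metis)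
  ultimately show False using \<gamma>(2) cohomologous_trans by blast
qed

lemma straight_line_cohomologous:
  fixes Y :: "'a::real_normed_vector set"
  assumes "cocycle p Y \<phi>" "continuous_on X f" "X \<subseteq> Y" "\<And>z. z \<in> X \<Longrightarrow> closed_segment z (f z) \<subseteq> Y"
  shows "cohomologous p X (\<lambda>\<sigma>. \<phi> (aug_map p f \<sigma>)) \<phi>"
proof -
  define h where "h = (\<lambda>(t, z). (1 - t) *\<^sub>R z + t *\<^sub>R f z)"
  have "continuous_on ({0..1} \<times> X) h"
    unfolding h_def split_def
    by (intro continuous_intros continuous_on_compose2[OF assms(2)]) auto
  moreover have "h ` ({0..1} \<times> X) \<subseteq> Y"
    using assms(4) by (force simp: h_def closed_segment_def)
  ultimately have "cohomologous p X (\<lambda>\<sigma>. \<phi> (aug_map p (\<lambda>z. h (1, z)) \<sigma>)) (\<lambda>\<sigma>. \<phi> (aug_map p (\<lambda>z. h (0, z)) \<sigma>))"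
    by (rule homotopic_imp_cohomologous[OF assms(1)])
  moreover have "cohomologous p X (\<lambda>\<sigma>. \<phi> (aug_map p (\<lambda>z. h (0, z)) \<sigma>)) \<phi>"
    by (rule cohomologous_eq) (simp add: h_def aug_map_ident)
  ultimately show ?thesis using cohomologous_trans by (fastforce simp: h_def)
qed

text \<open>
  There is one simplex in each degree from \<open>-1\<close> on, and the coboundary on it is alternately zero and the identity.
\<close>

lemma acyclic_in_singleton:
  fixes q :: "'a::topological_space" and K :: "'k::field itself"
  shows "acyclic_in K p {q}"
proof (cases "p < -1")
  case True
  then show ?thesis by (auto simp: acyclic_in_def cohomologous_def aug_simplices_def)
next
  case False
  define u where "u p = (if 0 \<le> p then restrict (\<lambda>_. q) (standard_simplex (nat p)) else (\<lambda>_. undefined))" for p :: int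
  have S: "simplices p {q} = {u p}" if "p \<ge> -1" for p
    using that singular_simplex_singleton[of "top_of_set {q}" q "nat p"] by (auto simp: aug_simplices_def u_def)
  have codiff: "codiff p \<psi> (u p) = (if 0 \<le> p \<and> even (nat p) then \<psi> (u (p - 1)) else 0)"
    if "p \<ge> -1" for p and \<psi> :: "((nat \<Rightarrow> real) \<Rightarrow> 'a) \<Rightarrow> 'k"
  proof (cases "0 \<le> p")
    case True
    have f: "aug_face p i (u p) = u (p - 1)" if "i \<le> nat p" for i
      using aug_face_in_simplices[of "u p" p "top_of_set {q}" i] S[of p] S[of "p - 1"] True that by auto
    have alt: "(\<Sum>i\<le>n. (-1) ^ i * x) = (if even n then x else 0)" for n :: nat and x :: 'k
      by (induction n) auto
    have "codiff p \<psi> (u p) = (\<Sum>i\<le>nat p. (-1) ^ i * \<psi> (u (p - 1)))"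
      using True f by (simp add: codiff_def)
    also have "\<dots> = (if even (nat p) then \<psi> (u (p - 1)) else 0)" by (rule alt)
    finally show ?thesis using True by simp
  qed (simp add: codiff_def)
  show ?thesis
    unfolding acyclic_in_def
  proof (intro allI impI)
    fix \<phi> :: "((nat \<Rightarrow> real) \<Rightarrow> 'a) \<Rightarrow> 'k" assume "cocycle p {q} \<phi>"
    then have *: "even (nat (p + 1)) \<Longrightarrow> \<phi> (u p) = 0"
      using S[of "p + 1"] codiff[of "p + 1" \<phi>] False by (simp add: cocycle_def)
    have "\<phi> (u p) = codiff p (\<lambda>_. \<phi> (u p)) (u p)"
    proof (cases "0 \<le> p")
      case True
      then show ?thesis using codiff[of p "\<lambda>_. \<phi> (u p)"] * by (simp add: nat_add_distrib)
    next
      case False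
      then show ?thesis using * \<open>\<not> p < -1\<close> by (simp add: codiff_def)
    qed
    then show "cohomologous p {q} \<phi> (\<lambda>_. 0)"
      using S[of p] False by (auto simp: cohomologous_def)
  qed
qed

lemma acyclic_in_starlike:
  fixes X :: "'a::real_normed_vector set" and K :: "'k::field itself"
  assumes "q \<in> X" "\<And>z. z \<in> X \<Longrightarrow> closed_segment z q \<subseteq> X"
  shows "acyclic_in K p X"
  unfolding acyclic_in_def
proof (intro allI impI)
  fix \<phi> :: "((nat \<Rightarrow> real) \<Rightarrow> 'a) \<Rightarrow> 'k" assume \<phi>: "cocycle p X \<phi>"
  then have "cocycle p {q} \<phi>" using assms(1) by (auto elim: cocycle_mono)
  then have "cohomologous p {q} \<phi> (\<lambda>_. 0)" using acyclic_in_singleton[of K p q] by (auto simp: acyclic_in_def)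
  then have "cohomologous p X (\<lambda>\<sigma>. \<phi> (aug_map p (\<lambda>_. q) \<sigma>)) (\<lambda>\<sigma>. (\<lambda>_. 0) (aug_map p (\<lambda>_. q) \<sigma>))"
    by (rule cohomologous_pullback) auto
  moreover have "cohomologous p X (\<lambda>\<sigma>. \<phi> (aug_map p (\<lambda>_. q) \<sigma>)) \<phi>"
    by (rule straight_line_cohomologous[OF \<phi>]) (use assms in auto)
  ultimately show "cohomologous p X \<phi> (\<lambda>_. 0)" using cohomologous_trans cohomologous_sym by blast
qed

text \<open>
  The straight lines from \<open>z\<close> to \<open>r z\<close> must stay in \<open>Y\<close>, but \<open>r\<close> need not fix \<open>X\<close>: a map into \<open>X\<close> that
  is homotopic in \<open>Y\<close> to the identity suffices to carry vanishing from \<open>X\<close> to \<open>Y\<close>.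
\<close>

lemma acyclic_in_deformation_retract:
  fixes X Y :: "'a::real_normed_vector set" and K :: "'k::field itself"
  assumes "acyclic_in K p X" "X \<subseteq> Y" "continuous_on Y r" "r ` Y \<subseteq> X" 
    "\<And>z. z \<in> Y \<Longrightarrow> closed_segment z (r z) \<subseteq> Y"
  shows "acyclic_in K p Y"
  unfolding acyclic_in_def
proof (intro allI impI)
  fix \<phi> :: "((nat \<Rightarrow> real) \<Rightarrow> 'a) \<Rightarrow> 'k" assume \<phi>: "cocycle p Y \<phi>"
  then have "cohomologous p X \<phi> (\<lambda>_. 0)" using assms(1) cocycle_mono[OF \<phi> assms(2)] by (simp add: acyclic_in_def)
  then have "cohomologous p Y (\<lambda>\<sigma>. \<phi> (aug_map p r \<sigma>)) (\<lambda>\<sigma>. (\<lambda>_. 0) (aug_map p r \<sigma>))"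
    by (rule cohomologous_pullback) (use assms in auto)
  moreover have "cohomologous p Y (\<lambda>\<sigma>. \<phi> (aug_map p r \<sigma>)) \<phi>"
    by (rule straight_line_cohomologous[OF \<phi>]) (use assms in auto)
  ultimately show "cohomologous p Y \<phi> (\<lambda>_. 0)" using cohomologous_trans cohomologous_sym by blast
qed

lemma not_acyclic_in_empty:
  fixes K :: "'k::field itself"
  shows "\<not> acyclic_in K (-1) ({} :: 'a::topological_space set)"
proof
  assume *: "acyclic_in K (-1) ({} :: 'a set)"
  have "cocycle (-1) ({} :: 'a set) (\<lambda>_. 1 :: 'k)"
    by (simp add: cocycle_def aug_simplices_def singular_simplex_empty)
  then have "cohomologous (-1) ({} :: 'a set) (\<lambda>_. 1 :: 'k) (\<lambda>_. 0)"
    using * by (simp add: acyclic_in_def)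
  then show False by (simp add: cohomologous_def aug_simplices_def codiff_def)
qed

section \<open>Unions of half-cones and the sweep over the hyperplanes\<close>

text \<open>
  The origin is left out because the sets are cones and stand for their intersections with the unit
  sphere.
\<close>

definition halfcone_union :: "('n \<Rightarrow> 'a::euclidean_space) \<Rightarrow> 'a set \<Rightarrow> 'n set \<Rightarrow> 'a set" where
  "halfcone_union v C T = {z \<in> C - {0}. \<exists>u\<in>T. 0 \<le> v u \<bullet> z}"

lemma halfcone_union_Int_singleton: "halfcone_union v C S \<inter> halfcone_union v C {i} = halfcone_union v (C \<inter> {z. 0 \<le> v i \<bullet> z}) S"
  by (auto simp: halfcone_union_def)

lemma closedin_halfcone_union:
  assumes "finite S" "halfcone_union v C S \<subseteq> Y" "Y \<subseteq> C - {0}"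
  shows "closedin (top_of_set Y) (halfcone_union v C S)"
proof -
  have "halfcone_union v C S = Y \<inter> (\<Union>u\<in>S. {z. 0 \<le> v u \<bullet> z})"
    using assms by (auto simp: halfcone_union_def)
  moreover have "closed (\<Union>u\<in>S. {z. 0 \<le> v u \<bullet> z})"
    using assms(1) by (intro closed_UN) (simp_all add: closed_halfspace_ge)
  ultimately show ?thesis by (simp add: closedin_closed_Int)
qed

lemma ENR_halfcone_union:
  assumes "finite S" "closed C" "convex C"
  shows "ENR (halfcone_union v C S)"
proof -
  let ?F = "(\<lambda>u. C \<inter> {z. 0 \<le> v u \<bullet> z}) ` S"
  have "ANR (\<Union>?F)"
    using assms by (intro ANR_finite_Union_convex_closed)
      (auto intro!: closed_Int convex_Int simp: closed_halfspace_ge convex_halfspace_ge)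
  moreover have "closed (\<Union>?F)"
    using assms by (intro closed_Union) (auto intro!: closed_Int simp: closed_halfspace_ge)
  ultimately have "ENR (\<Union>?F)"
    by (simp add: ENR_ANR closed_imp_locally_compact)
  moreover have "halfcone_union v C S = \<Union>?F \<inter> - {0}" by (auto simp: halfcone_union_def)
  ultimately show ?thesis
    by (metis ENR_openin open_Compl closed_singleton openin_open_Int)
qed

text \<open>
  The segment could only meet the origin if \<open>z\<close> were a negative multiple of \<open>q\<close>. So a convex
  cone that is not a linear subspace is starlike after removal of its apex, whereas a linear
  subspace becomes a sphere up to homotopy.
\<close>

lemma segment_in_punctured_cone:
  assumes "convex C" "conic C" "z \<in> C" "z \<noteq> 0" "q \<in> C" "- q \<notin> C"
  shows "closed_segment z q \<subseteq> C - {0}"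
proof
  fix y assume y: "y \<in> closed_segment z q"
  then have "y \<in> C" using assms closed_segment_subset by blast
  moreover obtain t where t: "0 \<le> t" "t \<le> 1" "y = (1 - t) *\<^sub>R z + t *\<^sub>R q"
    using y by (auto simp: closed_segment_def)
  have "y \<noteq> 0"
  proof
    assume "y = 0"
    show False
    proof (cases "t = 0")
      case False
      with t \<open>y = 0\<close> have "- (t *\<^sub>R q) = (1 - t) *\<^sub>R z" by (metis add.inverse_unique add.commute)
      then have "- q = ((1 - t) / t) *\<^sub>R z"
        using False by (simp add: divide_inverse mult.commute flip: scaleR_scaleR) 
          (metis (no_types) False left_inverse scaleR_minus_right scaleR_one scaleR_scaleR)
      moreover have "((1 - t) / t) *\<^sub>R z \<in> C" using assms t False by (intro conic_mul[of C]) auto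
      ultimately show False using assms by simp
    qed (use t \<open>y = 0\<close> assms in auto)
  qed
  ultimately show "y \<in> C - {0}" by simp
qed

lemma halfspace_segment:
  assumes "0 \<le> v \<bullet> z" "0 \<le> v \<bullet> q" "y \<in> closed_segment z q"
  shows "0 \<le> v \<bullet> y"
  using closed_segment_subset[of z "{x. 0 \<le> v \<bullet> x}" q] assms convex_halfspace_ge[of 0 v] by (auto simp: inner_commute)

lemma acyclic_in_halfcone_union:
  fixes K :: "'k::field itself"
  assumes "convex C" "conic C" "q \<in> C" "- q \<notin> C" "T \<noteq> {}" "\<And>u. u \<in> T \<Longrightarrow> 0 \<le> v u \<bullet> q"
  shows "acyclic_in K p (halfcone_union v C T)"
proof (rule acyclic_in_starlike[of q])
  have "0 \<in> C" using conic_mul[of C q 0] assms by simp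
  then have "q \<noteq> 0" using assms by auto
  then show "q \<in> halfcone_union v C T" using assms by (auto simp: halfcone_union_def)
  fix z assume z: "z \<in> halfcone_union v C T"
  then obtain u where "u \<in> T" "0 \<le> v u \<bullet> z" by (auto simp: halfcone_union_def)
  then show "closed_segment z q \<subseteq> halfcone_union v C T"
    using segment_in_punctured_cone[of C z q] z assms halfspace_segment[of "v u" z q]
    by (auto simp: halfcone_union_def)
qed

lemma conic_Int_halfspace: "conic C \<Longrightarrow> conic (C \<inter> {z. 0 \<le> a \<bullet> z})"
  by (auto simp: conic_def)

text \<open>
  The half-cones for \<open>T\<close> have empty intersection, but \<open>q x\<close> lies in all of them except the one of
  \<open>x\<close>, so their nerve is the boundary of a simplex. Induction on \<open>T\<close>: the union over
  \<open>F\<close> is starlike about \<open>q x\<close>, the half-cone of \<open>x\<close> is starlike about any other \<open>q u\<close>, and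
  their intersection is a union of the same kind, with \<open>F\<close> in place of \<open>T\<close>, inside a smaller cone.
  The connecting homomorphism raises the degree by one. The induction starts with the
  empty union, whose reduced cohomology in degree \<open>-1\<close> is the field.
\<close>

lemma nerve_not_acyclic:
  fixes K :: "'k::field itself" and v :: "'n \<Rightarrow> 'a::euclidean_space"
  assumes "finite T" "T \<noteq> {}" "closed C" "convex C" "conic C"
    and "\<And>x. x \<in> T \<Longrightarrow> q x \<in> C \<and> - q x \<notin> C \<and> (\<forall>u\<in>T - {x}. 0 \<le> v u \<bullet> q x)"
    and "\<And>z. z \<in> C \<Longrightarrow> z \<noteq> 0 \<Longrightarrow> \<exists>u\<in>T. v u \<bullet> z < 0"
  shows "\<not> acyclic_in K (int (card T) - 2) (halfcone_union v C T)"
  using assms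
proof (induction T arbitrary: C rule: finite_ne_induct)
  case (singleton x)
  then have "halfcone_union v C {x} = {}" by (force simp: halfcone_union_def)
  then show ?case using not_acyclic_in_empty[of K] by simp
next
  case (insert x F)
  let ?C' = "C \<inter> {z. 0 \<le> v x \<bullet> z}"
  obtain u0 where u0: "u0 \<in> F" using insert by auto
  have Y: "halfcone_union v C (insert x F) = halfcone_union v C F \<union> halfcone_union v C {x}" by (auto simp: halfcone_union_def)
  have sub: "halfcone_union v C F \<union> halfcone_union v C {x} \<subseteq> C - {0}" by (auto simp: halfcone_union_def)
  have IH: "\<not> acyclic_in K (int (card F) - 2) (halfcone_union v ?C' F)"
  proof (rule insert.IH)
    show "closed ?C'" "convex ?C'" "conic ?C'"
      using insert.prems by (auto intro!: closed_Int convex_Int conic_Int_halfspace simp: closed_halfspace_ge convex_halfspace_ge)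
    show "q y \<in> ?C' \<and> - q y \<notin> ?C' \<and> (\<forall>u\<in>F - {y}. 0 \<le> v u \<bullet> q y)" if "y \<in> F" for y
      using insert.prems(4)[of y] insert.hyps that by auto
    show "\<exists>u\<in>F. v u \<bullet> z < 0" if "z \<in> ?C'" "z \<noteq> 0" for z
      using insert.prems(5)[of z] that by auto
  qed
  have "acyclic_in K (int (card F) - 2) (halfcone_union v C F)"
    using insert.prems(4)[of x] insert.hyps by (intro acyclic_in_halfcone_union[of C "q x"] insert.prems) auto
  moreover have "acyclic_in K (int (card F) - 2) (halfcone_union v C {x})"
    using insert.prems(4)[of u0] u0 insert.hyps by (intro acyclic_in_halfcone_union[of C "q u0"] insert.prems) auto
  ultimately have "\<not> acyclic_in K (int (card F) - 1) (halfcone_union v C F \<union> halfcone_union v C {x})"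
    using IH insert.hyps insert.prems sub
    by (intro Mayer_Vietoris_connecting closedin_halfcone_union)
       (auto simp: halfcone_union_Int_singleton intro!: ENR_halfcone_union closed_Int convex_Int simp: closed_halfspace_ge convex_halfspace_ge)
  then show ?case using insert.hyps by (simp add: Y)
qed

text \<open>
  Restriction of cohomology classes in degree \<open>p\<close> from \<open>C\<close> to \<open>D\<close> is not surjective. This
  relative form of nonvanishing, unlike nonvanishing on \<open>D\<close>, is inherited in \<open>obstructed_step\<close> without
  any knowledge of the topology of \<open>C\<close>.
\<close>

definition obstructed ::
    "'k::field itself \<Rightarrow> int \<Rightarrow> 'a::topological_space set \<Rightarrow> 'a set \<Rightarrow> bool" where
  "obstructed K p D C \<longleftrightarrow> (\<exists>\<alpha> :: ((nat \<Rightarrow> real) \<Rightarrow> 'a) \<Rightarrow> 'k. cocycle p D \<alpha> \<and>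
     (\<forall>\<beta>. cocycle p C \<beta> \<longrightarrow> \<not> cohomologous p D \<alpha> \<beta>))"

lemma obstructed_imp_not_acyclic: "obstructed K p D C \<Longrightarrow> \<not> acyclic_in K p D"
  by (force simp: obstructed_def acyclic_in_def cocycle_def)

lemma obstructed_irrefl: "\<not> obstructed K p D D"
  by (auto simp: obstructed_def)

lemma obstructed_of_acyclic:
  fixes K :: "'k::field itself" and C :: "'a::topological_space set"
  assumes "acyclic_in K p C" "\<not> acyclic_in K p D" "D \<subseteq> C"
  shows "obstructed K p D C"
proof -
  obtain \<alpha> :: "((nat \<Rightarrow> real) \<Rightarrow> 'a) \<Rightarrow> 'k" where \<alpha>: "cocycle p D \<alpha>" "\<not> cohomologous p D \<alpha> (\<lambda>_. 0)"
    using assms(2) by (auto simp: acyclic_in_def)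
  have "\<not> cohomologous p D \<alpha> \<beta>" if "cocycle p C \<beta>" for \<beta>
  proof
    assume "cohomologous p D \<alpha> \<beta>"
    moreover have "cohomologous p D \<beta> (\<lambda>_. 0)"
      using that assms(1,3) cohomologous_mono[of p C \<beta> "\<lambda>_. 0" D] by (auto simp: acyclic_in_def)
    ultimately show False using \<alpha>(2) cohomologous_trans by blast
  qed
  with \<alpha>(1) show ?thesis by (auto simp: obstructed_def)
qed

text \<open>
  If the obstructed cocycle restricted to \<open>{L i \<ge> 0}\<close> is cohomologous to one that extends to the whole
  half-cone of \<open>i\<close>, then it glues with the extension to a cocycle on the larger union, and an extension
  of that cocycle to \<open>C - {0}\<close> would extend the original one.
\<close>

lemma obstructed_step:
  fixes K :: "'k::field itself" and v :: "'n \<Rightarrow> 'a::euclidean_space"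
  assumes C: "closed C" "convex C" and S: "finite S"
    and ob: "obstructed K p (halfcone_union v C S) (C - {0})"
  shows "obstructed K p (halfcone_union v (C \<inter> {z. 0 \<le> v i \<bullet> z}) S) (C \<inter> {z. 0 \<le> v i \<bullet> z} - {0})
     \<or> obstructed K p (halfcone_union v C (insert i S)) (C - {0})"
proof (rule disjCI)
  let ?A = "halfcone_union v C S" and ?B = "halfcone_union v C {i}"
  assume no2: "\<not> obstructed K p (halfcone_union v C (insert i S)) (C - {0})"
  have AB: "?A \<inter> ?B = halfcone_union v (C \<inter> {z. 0 \<le> v i \<bullet> z}) S" by (rule halfcone_union_Int_singleton)
  have B: "?B = C \<inter> {z. 0 \<le> v i \<bullet> z} - {0}" by (auto simp: halfcone_union_def)
  have Y: "halfcone_union v C (insert i S) = ?A \<union> ?B" by (auto simp: halfcone_union_def)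
  have sub: "?A \<union> ?B \<subseteq> C - {0}" by (auto simp: halfcone_union_def)
  obtain \<alpha> :: "((nat \<Rightarrow> real) \<Rightarrow> 'a) \<Rightarrow> 'k" where \<alpha>: "cocycle p ?A \<alpha>"
    "\<And>\<beta>. cocycle p (C - {0}) \<beta> \<Longrightarrow> \<not> cohomologous p ?A \<alpha> \<beta>"
    using ob by (auto simp: obstructed_def)
  have "\<not> cohomologous p (?A \<inter> ?B) \<alpha> \<beta>" if \<beta>: "cocycle p ?B \<beta>" for \<beta>
  proof
    assume eq: "cohomologous p (?A \<inter> ?B) \<alpha> \<beta>"
    have "ENR (?A \<inter> ?B)" unfolding AB
      using C S by (intro ENR_halfcone_union) (auto intro!: closed_Int convex_Int simp: closed_halfspace_ge convex_halfspace_ge)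
    moreover have "closedin (top_of_set (?A \<union> ?B)) ?A" "closedin (top_of_set (?A \<union> ?B)) ?B"
      using S sub by (auto intro!: closedin_halfcone_union)
    moreover have "ENR ?A" "ENR ?B" using C S by (auto intro!: ENR_halfcone_union)
    ultimately obtain \<phi> where \<phi>: "cocycle p (?A \<union> ?B) \<phi>" "cohomologous p ?A \<phi> \<alpha>"
      using glue_cocycles[of ?A ?B p \<alpha> \<beta>] \<alpha>(1) \<beta> eq by metis
    obtain \<gamma> where \<gamma>: "cocycle p (C - {0}) \<gamma>" "cohomologous p (?A \<union> ?B) \<phi> \<gamma>"
      using no2 \<phi>(1) unfolding Y obstructed_def by blast
    have "cohomologous p ?A \<phi> \<gamma>" using \<gamma>(2) by (rule cohomologous_mono) auto
    then have "cohomologous p ?A \<alpha> \<gamma>" using \<phi>(2) cohomologous_sym cohomologous_trans by blast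
    with \<alpha>(2)[OF \<gamma>(1)] show False by blast
  qed
  moreover have "cocycle p (?A \<inter> ?B) \<alpha>" using \<alpha>(1) by (rule cocycle_mono) auto
  ultimately show "obstructed K p (halfcone_union v (C \<inter> {z. 0 \<le> v i \<bullet> z}) S) (C \<inter> {z. 0 \<le> v i \<bullet> z} - {0})"
    unfolding obstructed_def AB[symmetric] B[symmetric] by blast
qed

lemma obstructed_sweep:
  fixes K :: "'k::field itself"
  assumes "finite R" "closed C" "convex C" "conic C" "finite S"
    and "obstructed K p (halfcone_union v C S) (C - {0})"
  shows "\<exists>M\<subseteq>R. obstructed K p (halfcone_union v (C \<inter> {z. \<forall>i\<in>R - M. 0 \<le> v i \<bullet> z}) (S \<union> M))
      (C \<inter> {z. \<forall>i\<in>R - M. 0 \<le> v i \<bullet> z} - {0})"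
  using assms
proof (induction R arbitrary: C S rule: finite_induct)
  case empty
  then show ?case by simp
next
  case (insert i R)
  let ?C' = "C \<inter> {z. 0 \<le> v i \<bullet> z}"
  consider "obstructed K p (halfcone_union v ?C' S) (?C' - {0})" | "obstructed K p (halfcone_union v C (insert i S)) (C - {0})"
    using obstructed_step[of C S K p v i] insert.prems by blast
  then show ?case
  proof cases
    case 1
    have C': "closed ?C'" "convex ?C'" "conic ?C'"
      using insert.prems by (auto intro!: closed_Int convex_Int conic_Int_halfspace simp: closed_halfspace_ge convex_halfspace_ge)
    from insert.IH[OF C' \<open>finite S\<close> 1]
    obtain M where "M \<subseteq> R" and M: "obstructed K p (halfcone_union v (?C' \<inter> {z. \<forall>i\<in>R - M. 0 \<le> v i \<bullet> z}) (S \<union> M))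
      (?C' \<inter> {z. \<forall>i\<in>R - M. 0 \<le> v i \<bullet> z} - {0})" by (elim exE conjE)
    have "?C' \<inter> {z. \<forall>i\<in>R - M. 0 \<le> v i \<bullet> z} = C \<inter> {z. \<forall>i\<in>insert i R - M. 0 \<le> v i \<bullet> z}"
      using \<open>M \<subseteq> R\<close> insert.hyps by auto
    with M have "obstructed K p (halfcone_union v (C \<inter> {z. \<forall>i\<in>insert i R - M. 0 \<le> v i \<bullet> z}) (S \<union> M))
      (C \<inter> {z. \<forall>i\<in>insert i R - M. 0 \<le> v i \<bullet> z} - {0})" by simp
    with \<open>M \<subseteq> R\<close> show ?thesis by (intro exI[of _ M] conjI) auto
  next
    case 2
    have "finite (insert i S)" using insert.prems by simp
    from insert.IH[OF insert.prems(1-3) this 2]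
    obtain M where "M \<subseteq> R" and M: "obstructed K p (halfcone_union v (C \<inter> {z. \<forall>i\<in>R - M. 0 \<le> v i \<bullet> z}) (insert i S \<union> M))
      (C \<inter> {z. \<forall>i\<in>R - M. 0 \<le> v i \<bullet> z} - {0})" by (elim exE conjE)
    have "insert i R - insert i M = R - M" "insert i S \<union> M = S \<union> insert i M"
      using insert.hyps \<open>M \<subseteq> R\<close> by auto
    then show ?thesis using M \<open>M \<subseteq> R\<close> by (intro exI[of _ "insert i M"] conjI) auto
  qed
qed

lemma continuous_on_Max_image:
  fixes f :: "'n \<Rightarrow> 'a::topological_space \<Rightarrow> real"
  assumes "finite S" "S \<noteq> {}" "\<And>m. m \<in> S \<Longrightarrow> continuous_on A (f m)"
  shows "continuous_on A (\<lambda>z. Max ((\<lambda>m. f m z) ` S))"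
  using assms by (induction S rule: finite_ne_induct) (auto intro!: continuous_on_max)

text \<open>
  An obstruction forces the union to be different from \<open>C - {0}\<close>, which yields a point \<open>w\<close> of \<open>C\<close> where
  all forms of \<open>S\<close> are negative. If \<open>-w\<close> also lay in \<open>C\<close>, the union would be starlike about it and hence
  unobstructed. Otherwise each point of the union is moved in direction \<open>w\<close> until the last form of \<open>S\<close>
  becomes nonpositive. This deforms the union to the part of the boundary of the region
  of sign pattern \<open>S\<close> that consists of walls of \<open>S\<close>.
\<close>

lemma obstructed_boundary:
  fixes K :: "'k::field itself" and v :: "'n \<Rightarrow> 'a::euclidean_space"
  assumes C: "convex C" "conic C" and S: "finite S" "S \<noteq> {}"
    and ob: "obstructed K p (halfcone_union v C S) (C - {0})"
  obtains w where "w \<in> C" "w \<noteq> 0" "\<And>m. m \<in> S \<Longrightarrow> v m \<bullet> w < 0"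
    "\<not> acyclic_in K p {z \<in> C. norm z = 1 \<and> (\<forall>m\<in>S. v m \<bullet> z \<le> 0) \<and> (\<exists>m\<in>S. v m \<bullet> z = 0)}"
proof -
  have "halfcone_union v C S \<noteq> C - {0}" using ob obstructed_irrefl by metis
  then obtain w where w: "w \<in> C" "w \<noteq> 0" "\<And>m. m \<in> S \<Longrightarrow> v m \<bullet> w < 0"
    by (force simp: halfcone_union_def)
  have nac: "\<not> acyclic_in K p (halfcone_union v C S)" using ob by (rule obstructed_imp_not_acyclic)
  have nw: "- w \<notin> C"
  proof
    assume mw: "- w \<in> C"
    have "acyclic_in K p (halfcone_union v C S)"
    proof (rule acyclic_in_starlike[of "- w"])
      show "- w \<in> halfcone_union v C S" using mw w S by (force simp: halfcone_union_def intro: less_imp_le)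
      fix z assume z: "z \<in> halfcone_union v C S"
      then obtain m where m: "m \<in> S" "0 \<le> v m \<bullet> z" by (auto simp: halfcone_union_def)
      show "closed_segment z (- w) \<subseteq> halfcone_union v C S"
      proof
        fix y assume y: "y \<in> closed_segment z (- w)"
        then obtain t where t: "0 \<le> t" "t \<le> 1" "y = (1 - t) *\<^sub>R z + t *\<^sub>R - w" by (auto simp: closed_segment_def)
        have "y \<in> C" using y z mw C closed_segment_subset[of z C "- w"] by (auto simp: halfcone_union_def)
        moreover have "0 \<le> v m \<bullet> y" using halfspace_segment[OF m(2) _ y] w(3)[OF m(1)] by auto
        moreover have "y \<noteq> 0"
        proof (cases "t = 0")
          case True
          then show ?thesis using t z by (auto simp: halfcone_union_def)
        next
          case False
          have "v m \<bullet> y = (1 - t) * (v m \<bullet> z) + t * - (v m \<bullet> w)" unfolding t(3) by (simp add: inner_diff_right)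
          moreover have "t * - (v m \<bullet> w) > 0" using False t w(3)[OF m(1)] by (intro mult_pos_pos) auto
          moreover have "(1 - t) * (v m \<bullet> z) \<ge> 0" using t m by simp
          ultimately show ?thesis by (metis add_nonneg_pos inner_zero_right less_irrefl)
        qed
        ultimately show "y \<in> halfcone_union v C S" using m by (auto simp: halfcone_union_def)
      qed
    qed
    with nac show False by simp
  qed
  define X where "X = {z \<in> C. norm z = 1 \<and> (\<forall>m\<in>S. v m \<bullet> z \<le> 0) \<and> (\<exists>m\<in>S. v m \<bullet> z = 0)}"
  define s where "s z = Max ((\<lambda>m. (v m \<bullet> z) / - (v m \<bullet> w)) ` S)" for z
  define r where "r z = (z + s z *\<^sub>R w) /\<^sub>R norm (z + s z *\<^sub>R w)" for z
  have s_max: "v m \<bullet> (z + s z *\<^sub>R w) \<le> 0" if "m \<in> S" for m z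
  proof -
    have "(v m \<bullet> z) / - (v m \<bullet> w) \<le> s z" unfolding s_def using S that by (intro Max_ge) auto
    with w(3)[OF that] show ?thesis by (simp add: inner_add_right field_simps)
  qed
  have s_att: "\<exists>m\<in>S. s z = (v m \<bullet> z) / - (v m \<bullet> w)" for z
  proof -
    have "s z \<in> (\<lambda>m. (v m \<bullet> z) / - (v m \<bullet> w)) ` S" unfolding s_def using S by (intro Max_in) auto
    then show ?thesis by auto
  qed
  have s0: "0 \<le> s z" if z: "z \<in> halfcone_union v C S" for z
  proof -
    obtain m where m: "m \<in> S" "0 \<le> v m \<bullet> z" using z by (auto simp: halfcone_union_def)
    have "0 \<le> (v m \<bullet> z) / - (v m \<bullet> w)" using m w(3)[OF m(1)] by (intro divide_nonneg_pos) auto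
    also have "\<dots> \<le> s z" unfolding s_def using S m by (intro Max_ge) auto
    finally show ?thesis .
  qed
  have comb: "a *\<^sub>R z + b *\<^sub>R w \<in> C - {0}" if "z \<in> halfcone_union v C S" "0 < a" "0 \<le> b" for a b z
  proof -
    have zC: "z \<in> C" "z \<noteq> 0" using that by (auto simp: halfcone_union_def)
    have aC: "a *\<^sub>R z \<in> C" "b *\<^sub>R w \<in> C" using C zC w that by (auto intro!: conic_mul[of C])
    have "a *\<^sub>R z + b *\<^sub>R w \<in> C" using conic_mul[OF C(2) convexD[OF C(1) aC, of "1/2" "1/2"], of 2]
      by (simp add: scaleR_add_right)
    moreover have "a *\<^sub>R z + b *\<^sub>R w \<noteq> 0"
    proof
      assume *: "a *\<^sub>R z + b *\<^sub>R w = 0"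
      show False
      proof (cases "b = 0")
        case False
        have "- w = (1 / b) *\<^sub>R (a *\<^sub>R z + b *\<^sub>R w) - w" unfolding * by simp
        also have "\<dots> = (a / b) *\<^sub>R z" using False by (simp add: scaleR_add_right)
        also have "\<dots> \<in> C" using C zC that by (intro conic_mul[of C]) auto
        finally show False using nw by simp
      qed (use * that zC in auto)
    qed
    ultimately show ?thesis by simp
  qed
  have nac': "\<not> acyclic_in K p X"
  proof
    assume acX: "acyclic_in K p X"
    have "acyclic_in K p (halfcone_union v C S)"
    proof (rule acyclic_in_deformation_retract[OF acX])
      show "X \<subseteq> halfcone_union v C S"
      proof
        fix z assume "z \<in> X"
        then obtain m where "z \<in> C" "norm z = 1" "m \<in> S" "v m \<bullet> z = 0" by (auto simp: X_def)
        moreover from this have "z \<noteq> 0" by auto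
        ultimately show "z \<in> halfcone_union v C S" by (auto simp: halfcone_union_def intro!: bexI[of _ m])
      qed
      have "continuous_on (halfcone_union v C S) s"
        unfolding s_def using S w(3) by (intro continuous_on_Max_image) (auto intro!: continuous_intros simp: less_imp_neq)
      moreover have "\<forall>z\<in>halfcone_union v C S. z + s z *\<^sub>R w \<noteq> 0" using comb[of _ 1] s0 by auto
      ultimately show "continuous_on (halfcone_union v C S) r"
        unfolding r_def by (auto intro!: continuous_intros)
      show "r ` halfcone_union v C S \<subseteq> X"
      proof
        fix y assume "y \<in> r ` halfcone_union v C S"
        then obtain z where z: "z \<in> halfcone_union v C S" "y = r z" by auto
        have nz: "z + s z *\<^sub>R w \<in> C" "z + s z *\<^sub>R w \<noteq> 0" using comb[OF z(1), of 1 "s z"] s0[OF z(1)] by auto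
        obtain m where m: "m \<in> S" "s z = (v m \<bullet> z) / - (v m \<bullet> w)" using s_att by blast
        then have "v m \<bullet> (z + s z *\<^sub>R w) = 0" using w(3)[OF m(1)] by (simp add: inner_add_right inner_diff_right)
        then have "v m \<bullet> y = 0" by (simp add: z r_def)
        moreover have "y \<in> C" unfolding z r_def using nz C by (intro conic_mul[of C]) auto
        moreover have "\<forall>m\<in>S. v m \<bullet> y \<le> 0" unfolding z r_def using s_max[of _ z] nz
          by (auto simp: divide_simps mult_le_0_iff)
        moreover have "norm y = 1" unfolding z r_def using nz by simp
        ultimately show "y \<in> X" using m by (auto simp: X_def)
      qed
      fix z assume z: "z \<in> halfcone_union v C S"
      show "closed_segment z (r z) \<subseteq> halfcone_union v C S"
      proof
        fix y assume y: "y \<in> closed_segment z (r z)"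
        define c where "c = inverse (norm (z + s z *\<^sub>R w))"
        have c: "c > 0" using comb[OF z, of 1 "s z"] s0[OF z] by (simp add: c_def)
        obtain t where t: "0 \<le> t" "t \<le> 1" "y = (1 - t) *\<^sub>R z + t *\<^sub>R r z" using y by (auto simp: closed_segment_def)
        have "y = ((1 - t) + t * c) *\<^sub>R z + (t * c * s z) *\<^sub>R w"
          unfolding t r_def c_def[symmetric] by (simp add: algebra_simps)
        moreover have "(1 - t) + t * c > 0"
          using t c by (cases "t = 1") (auto intro: add_pos_nonneg)
        moreover have "t * c * s z \<ge> 0" using t c s0[OF z] by simp
        ultimately have "y \<in> C - {0}" using comb[OF z] by simp
        moreover obtain m where m: "m \<in> S" "s z = (v m \<bullet> z) / - (v m \<bullet> w)" using s_att by blast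
        have "v m \<bullet> z = s z * - (v m \<bullet> w)" using m w(3)[OF m(1)] by simp
        then have "0 \<le> v m \<bullet> z" using s0[OF z] w(3)[OF m(1)] by (simp add: mult_nonneg_nonpos)
        moreover have "v m \<bullet> (z + s z *\<^sub>R w) = 0" using m w(3)[OF m(1)] by (simp add: inner_add_right inner_diff_right)
        then have "v m \<bullet> r z = 0" by (simp add: r_def)
        ultimately show "y \<in> halfcone_union v C S" using halfspace_segment[of "v m" z "r z" y] y m by (auto simp: halfcone_union_def)
      qed
    qed
    with nac show False by simp
  qed
  then show ?thesis using that[OF w] by (simp add: X_def)
qed

text \<open>
  The two forms \<open>t\<close> and \<open>h\<close> both have to stay nonnegative. The first will be the height; the
  second makes the cone small enough for the nerve argument and will follow from the other conditions on
  the region that is found.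
\<close>

lemma exists_sign_pattern:
  fixes K :: "'k::field itself" and v :: "'n::finite \<Rightarrow> 'a::euclidean_space"
  assumes W: "subspace W" and T: "T \<subseteq> U" "T \<noteq> {}"
    and none: "\<And>z. \<lbrakk>z \<in> W; 0 \<le> t \<bullet> z; 0 \<le> h \<bullet> z; \<And>u. u \<in> U \<Longrightarrow> 0 \<le> v u \<bullet> z\<rbrakk> \<Longrightarrow> z = 0"
    and q: "\<And>x. x \<in> T \<Longrightarrow> q x \<in> W \<and> 0 \<le> t \<bullet> q x \<and> 0 \<le> h \<bullet> q x \<and> (\<forall>u\<in>U - {x}. 0 \<le> v u \<bullet> q x)
        \<and> (0 < t \<bullet> q x \<or> 0 < h \<bullet> q x)"
  obtains M w where "M \<inter> U = T" "w \<in> W" "w \<noteq> 0" "0 \<le> t \<bullet> w" "\<And>i. i \<in> M \<longleftrightarrow> v i \<bullet> w < 0"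
    "\<not> acyclic_in K (int (card T) - 2) {z \<in> W. norm z = 1 \<and> 0 \<le> t \<bullet> z \<and> 0 \<le> h \<bullet> z
        \<and> (\<forall>i. i \<notin> M \<longrightarrow> 0 \<le> v i \<bullet> z) \<and> (\<forall>i\<in>M. v i \<bullet> z \<le> 0) \<and> (\<exists>i\<in>M. v i \<bullet> z = 0)}"
proof -
  define C where "C = W \<inter> {z. 0 \<le> t \<bullet> z} \<inter> {z. 0 \<le> h \<bullet> z} \<inter> {z. \<forall>u\<in>U - T. 0 \<le> v u \<bullet> z}"
  have eq: "{z. \<forall>u\<in>J. 0 \<le> v u \<bullet> z} = (\<Inter>u\<in>J. {z. 0 \<le> v u \<bullet> z})" for J by auto
  have C: "closed C" "convex C" "conic C"
    unfolding C_def eq using closed_subspace[OF W] subspace_imp_convex[OF W]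
    by (auto intro!: closed_Int convex_Int closed_INT convex_INT
        simp: closed_halfspace_ge convex_halfspace_ge) (use W in \<open>auto simp: conic_def subspace_scale\<close>)
  let ?p = "int (card T) - 2"
  have fin: "finite A" for A :: "'n set" by simp
  have qC: "q x \<in> C \<and> - q x \<notin> C \<and> (\<forall>u\<in>T - {x}. 0 \<le> v u \<bullet> q x)" if "x \<in> T" for x
    using q[OF that] T that by (auto simp: C_def not_le)
  have nac: "\<not> acyclic_in K ?p (halfcone_union v C T)"
  proof (rule nerve_not_acyclic[OF fin T(2) C qC])
    fix z assume z: "z \<in> C" "z \<noteq> 0"
    show "\<exists>u\<in>T. v u \<bullet> z < 0"
    proof (rule ccontr)
      assume "\<not> ?thesis"
      then have "0 \<le> v u \<bullet> z" if "u \<in> U" for u using z that T by (cases "u \<in> T") (auto simp: C_def)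
      then show False using none[of z] z by (auto simp: C_def)
    qed
  qed
  obtain x where x: "x \<in> T" using T by auto
  have "acyclic_in K ?p (C - {0})"
  proof (rule acyclic_in_starlike[of "q x"])
    have "0 \<in> C" using W by (auto simp: C_def subspace_0)
    then show "q x \<in> C - {0}" using qC[OF x] by auto
    show "closed_segment z (q x) \<subseteq> C - {0}" if "z \<in> C - {0}" for z
      using segment_in_punctured_cone[of C z "q x"] qC[OF x] C that by auto
  qed
  then have "obstructed K ?p (halfcone_union v C T) (C - {0})"
    using nac by (rule obstructed_of_acyclic) (auto simp: halfcone_union_def)
  from obstructed_sweep[OF fin[of "UNIV - U"] C fin this]
  obtain M' where M': "M' \<subseteq> UNIV - U" and ob: "obstructed K ?p
      (halfcone_union v (C \<inter> {z. \<forall>i\<in>UNIV - U - M'. 0 \<le> v i \<bullet> z}) (T \<union> M')) (C \<inter> {z. \<forall>i\<in>UNIV - U - M'. 0 \<le> v i \<bullet> z} - {0})"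
    by (elim exE conjE)
  define M where "M = T \<union> M'"
  define C' where "C' = C \<inter> {z. \<forall>i\<in>UNIV - U - M'. 0 \<le> v i \<bullet> z}"
  have C': "convex C'" "conic C'"
    using C unfolding C'_def eq
    by (auto intro!: convex_Int convex_INT simp: convex_halfspace_ge) (auto simp: conic_def)
  have C'eq: "C' = {z \<in> W. 0 \<le> t \<bullet> z \<and> 0 \<le> h \<bullet> z \<and> (\<forall>i. i \<notin> M \<longrightarrow> 0 \<le> v i \<bullet> z)}"
    using T M' by (auto simp: C'_def C_def M_def)
  obtain w where w: "w \<in> C'" "w \<noteq> 0" "\<And>m. m \<in> M \<Longrightarrow> v m \<bullet> w < 0"
    "\<not> acyclic_in K ?p {z \<in> C'. norm z = 1 \<and> (\<forall>m\<in>M. v m \<bullet> z \<le> 0) \<and> (\<exists>m\<in>M. v m \<bullet> z = 0)}"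
    using obstructed_boundary[OF C' fin _ ob[folded C'_def M_def]] T by (auto simp: M_def)
  show ?thesis
  proof (rule that[of M w])
    show "M \<inter> U = T" using T M' by (auto simp: M_def)
    show "w \<in> W" "0 \<le> t \<bullet> w" using w by (auto simp: C'eq)
    show "i \<in> M \<longleftrightarrow> v i \<bullet> w < 0" for i using w(1,3) by (fastforce simp: C'eq)
    show "\<not> acyclic_in K ?p {z \<in> W. norm z = 1 \<and> 0 \<le> t \<bullet> z \<and> 0 \<le> h \<bullet> z \<and> (\<forall>i. i \<notin> M \<longrightarrow> 0 \<le> v i \<bullet> z)
        \<and> (\<forall>i\<in>M. v i \<bullet> z \<le> 0) \<and> (\<exists>i\<in>M. v i \<bullet> z = 0)}"
      using w(4) unfolding C'eq by (simp add: conj_ac)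
  qed (use w in auto)
qed

section \<open>Choosing the sign pattern\<close>

lemma convex_cone_hull_finite_subset:
  assumes "finite S" "x \<in> convex_cone hull S"
  shows "\<exists>g. (\<forall>s\<in>S. 0 \<le> g s) \<and> x = (\<Sum>s\<in>S. g s *\<^sub>R (s :: 'a::real_vector))"
proof -
  let ?C = "{y. \<exists>g. (\<forall>s\<in>S. 0 \<le> g s) \<and> y = (\<Sum>s\<in>S. g s *\<^sub>R s)}"
  have sub: "convex_cone hull S \<subseteq> ?C"
  proof (rule hull_minimal)
    show "S \<subseteq> ?C"
    proof
      fix s assume s: "s \<in> S"
      have "(\<Sum>r\<in>S. (if r = s then 1 else 0) *\<^sub>R r) = (\<Sum>r\<in>S. if r = s then r else 0)"
        by (rule sum.cong) auto
      also have "\<dots> = s" using assms(1) s by simp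
      finally have "s = (\<Sum>r\<in>S. (if r = s then 1 else 0) *\<^sub>R r)" by simp
      moreover have "\<forall>r\<in>S. (0::real) \<le> (if r = s then 1 else 0)" by simp
      ultimately show "s \<in> ?C" by (intro CollectI exI conjI)
    qed
    show "convex_cone ?C"
      unfolding convex_cone_iff
    proof (intro conjI ballI allI impI)
      show "0 \<in> ?C" by (auto intro!: exI[of _ "\<lambda>_. 0"])
      fix x y assume "x \<in> ?C" "y \<in> ?C"
      then obtain g h where "\<forall>s\<in>S. 0 \<le> g s" "x = (\<Sum>s\<in>S. g s *\<^sub>R s)" "\<forall>s\<in>S. 0 \<le> h s" "y = (\<Sum>s\<in>S. h s *\<^sub>R s)" by blast
      then show "x + y \<in> ?C"
        by (auto intro!: exI[of _ "\<lambda>s. g s + h s"] simp: scaleR_add_left sum.distrib)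
    next
      fix x and c :: real assume "x \<in> ?C" "0 \<le> c"
      then obtain g where "\<forall>s\<in>S. 0 \<le> g s" "x = (\<Sum>s\<in>S. g s *\<^sub>R s)" by blast
      with \<open>0 \<le> c\<close> show "c *\<^sub>R x \<in> ?C"
        by (auto intro!: exI[of _ "\<lambda>s. c * g s"] simp: scaleR_sum_right)
    qed
  qed
  have "x \<in> ?C" by (rule subsetD[OF sub assms(2)])
  then show ?thesis by simp
qed

text \<open>
  A representation with the least possible number of vectors is independent: moving along a linear
  relation until a coefficient vanishes would shorten it.
\<close>

lemma conic_Caratheodory:
  fixes S :: "'a::real_vector set"
  assumes "finite S" "x \<in> convex_cone hull S"
  shows "\<exists>I g. I \<subseteq> S \<and> independent I \<and> (\<forall>s\<in>I. 0 < g s) \<and> x = (\<Sum>s\<in>I. g s *\<^sub>R s)"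
proof -
  define P where "P n \<longleftrightarrow> (\<exists>I g. I \<subseteq> S \<and> card I = n \<and> (\<forall>s\<in>I. 0 < g s) \<and> x = (\<Sum>s\<in>I. g s *\<^sub>R s))" for n
  have drop: "\<exists>n \<le> card I. P n" if I: "I \<subseteq> S" and g: "\<forall>s\<in>I. 0 \<le> g s" "x = (\<Sum>s\<in>I. g s *\<^sub>R s)" 
     for I and g :: "'a \<Rightarrow> real"
  proof -
    have fI: "finite I" using I assms(1) finite_subset by blast
    let ?J = "{s\<in>I. g s \<noteq> 0}"
    have "x = (\<Sum>s\<in>?J. g s *\<^sub>R s)" unfolding g(2) using fI by (intro sum.mono_neutral_right) auto
    moreover have "\<forall>s\<in>?J. 0 < g s" using g(1) by force
    ultimately have "P (card ?J)" unfolding P_def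
      by (intro exI[of _ ?J] exI[of _ g] conjI refl) (use I in auto)
    moreover have "card ?J \<le> card I" using fI by (intro card_mono) auto
    ultimately show ?thesis by blast
  qed
  obtain g0 where "\<forall>s\<in>S. 0 \<le> g0 s" "x = (\<Sum>s\<in>S. g0 s *\<^sub>R s)"
    using convex_cone_hull_finite_subset[OF assms] by (elim exE conjE)
  from drop[OF order_refl this] have "\<exists>n. P n" by (elim exE conjE) (rule exI)
  define n where "n = (LEAST n. P n)"
  have n: "P n" "\<And>m. P m \<Longrightarrow> n \<le> m" unfolding n_def by (rule LeastI_ex[OF \<open>\<exists>n. P n\<close>], rule Least_le)
  then obtain I g where I: "I \<subseteq> S" "card I = n" and g: "\<forall>s\<in>I. 0 < g s" "x = (\<Sum>s\<in>I. g s *\<^sub>R s)"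
    unfolding P_def by blast
  have fI: "finite I" using I assms(1) finite_subset by blast
  have "independent I"
  proof
    assume "dependent I"
    then obtain c where c: "\<exists>s\<in>I. c s \<noteq> 0" "(\<Sum>s\<in>I. c s *\<^sub>R s) = 0"
      using dependent_finite[OF fI] by blast
    have "\<exists>c. (\<exists>s\<in>I. c s > 0) \<and> (\<Sum>s\<in>I. c s *\<^sub>R s) = 0"
    proof (cases "\<exists>s\<in>I. c s > 0")
      case False
      with c(1) have "\<exists>s\<in>I. - c s > 0" by force
      moreover have "(\<Sum>s\<in>I. - c s *\<^sub>R s) = 0" using c(2) by (simp add: sum_negf)
      ultimately show ?thesis by (intro exI[of _ "\<lambda>s. - c s"] conjI)
    qed (use c(2) in \<open>intro exI[of _ c] conjI\<close>)
    then obtain c where c: "\<exists>s\<in>I. c s > 0" "(\<Sum>s\<in>I. c s *\<^sub>R s) = 0" by (elim exE conjE)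
    let ?R = "(\<lambda>s. g s / c s) ` {s\<in>I. c s > 0}"
    define l where "l = Min ?R"
    have fR: "finite ?R" "?R \<noteq> {}" using fI c by auto
    obtain s0 where s0: "s0 \<in> I" "c s0 > 0" "l = g s0 / c s0" using Min_in[OF fR] by (auto simp: l_def)
    have l0: "0 < l" using s0 g by simp
    have nn: "0 \<le> g s - l * c s" if "s \<in> I" for s
    proof (cases "c s > 0")
      case True
      then have "l \<le> g s / c s" using fR that by (auto simp: l_def intro!: Min_le)
      with True show ?thesis by (simp add: field_simps)
    next
      case False
      then have "l * c s \<le> 0" using l0 by (simp add: mult_le_0_iff)
      with g(1) that show ?thesis by force
    qed
    have z: "g s0 - l * c s0 = 0" using s0 by simp
    have "x = (\<Sum>s\<in>I. g s *\<^sub>R s) - l *\<^sub>R (\<Sum>s\<in>I. c s *\<^sub>R s)" using c g by simp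
    also have "\<dots> = (\<Sum>s\<in>I. (g s - l * c s) *\<^sub>R s)"
      by (simp add: scaleR_sum_right scaleR_diff_left sum_subtractf)
    also have "\<dots> = (\<Sum>s\<in>I - {s0}. (g s - l * c s) *\<^sub>R s)"
      using fI s0 z by (simp add: sum.remove[of I s0])
    finally have "\<exists>m \<le> card (I - {s0}). P m" by (intro drop) (use I nn in auto)
    moreover have "card (I - {s0}) < n" using s0 I fI by (metis card_Diff1_less)
    ultimately show False using n(2) by fastforce
  qed
  with I(1) g show ?thesis by (intro exI[of _ I] exI[of _ g] conjI)
qed

lemma dual_basis:
  fixes W :: "'a::euclidean_space set"
  assumes "subspace W" "B \<subseteq> W" "independent B" "x \<in> B"
  shows "\<exists>e\<in>W. x \<bullet> e = 1 \<and> (\<forall>y\<in>B - {x}. y \<bullet> e = 0)"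
proof -
  obtain f :: "'a \<Rightarrow> real" where f: "linear f" "\<forall>y\<in>B. f y = (if y = x then 1 else 0)"
    using linear_independent_extend[OF assms(3), of "\<lambda>y. if y = x then 1 else 0 :: real"] by blast
  obtain e e' where e: "e \<in> span W" "\<And>w. w \<in> span W \<Longrightarrow> orthogonal e' w" "adjoint f 1 = e + e'"
    by (rule orthogonal_subspace_decomp_exists[of W "adjoint f 1"]) blast
  have sW: "span W = W" using assms(1) by (simp add: span_eq_iff)
  have "y \<bullet> e = f y" if "y \<in> B" for y
  proof -
    have "y \<bullet> adjoint f 1 = f y" using adjoint_works[OF f(1), of y 1] by simp
    moreover have "y \<bullet> e' = 0" using e(2)[of y] that assms(2) sW by (auto simp: orthogonal_def inner_commute)
    ultimately show ?thesis by (simp add: e(3) inner_add_right)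
  qed
  with f(2) assms e(1) sW show ?thesis by (intro bexI[of _ e]) auto
qed

text \<open>
  Without a nonzero common point of the closed half-spaces, the forms \<open>v i\<close> generate the dual of \<open>W\<close> as a
  convex cone, by separation. So \<open>-t\<close> is a positive combination of independent ones, and these extend
  to a basis of the dual of \<open>W\<close> consisting of forms \<open>v i\<close>, with dual basis \<open>e\<close>.
\<close>

lemma positively_spanning_basis:
  fixes v :: "'n::finite \<Rightarrow> 'a::euclidean_space"
  assumes W: "subspace W" and pos: "\<And>z. \<lbrakk>z \<in> W; \<And>i. 0 \<le> v i \<bullet> z\<rbrakk> \<Longrightarrow> z = 0"
  obtains I U \<gamma> e where "I \<subseteq> U" "card U = dim W"
    "\<And>u. u \<in> I \<Longrightarrow> 0 < \<gamma> u" "\<And>z. z \<in> W \<Longrightarrow> t \<bullet> z = - (\<Sum>u\<in>I. \<gamma> u * (v u \<bullet> z))"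
    "\<And>x. x \<in> U \<Longrightarrow> e x \<in> W \<and> v x \<bullet> e x = 1 \<and> (\<forall>y\<in>U - {x}. v y \<bullet> e x = 0)"
    "\<And>z. \<lbrakk>z \<in> W; \<And>u. u \<in> U \<Longrightarrow> v u \<bullet> z = 0\<rbrakk> \<Longrightarrow> z = 0"
proof -
  have sW: "span W = W" using W by (simp add: span_eq_iff)
  have proj: "\<exists>y\<in>W. \<forall>z\<in>W. y \<bullet> z = x \<bullet> z" for x
  proof -
    obtain y y' where y: "y \<in> span W" "\<And>w. w \<in> span W \<Longrightarrow> orthogonal y' w" "x = y + y'"
      by (rule orthogonal_subspace_decomp_exists[of W x]) blast
    then show ?thesis using sW by (intro bexI[of _ y]) (auto simp: inner_add_left orthogonal_def)
  qed
  then obtain p where p: "\<And>x. p x \<in> W" "\<And>x z. z \<in> W \<Longrightarrow> p x \<bullet> z = x \<bullet> z" by metis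
  define u where "u i = p (v i)" for i
  have u: "u i \<in> W" "z \<in> W \<Longrightarrow> u i \<bullet> z = v i \<bullet> z" for i z using p by (auto simp: u_def)
  let ?S = "range u"
  have "- p t \<in> convex_cone hull ?S"
  proof (rule ccontr)
    assume *: "- p t \<notin> convex_cone hull ?S"
    have "closed (convex_cone hull ?S)" by (rule closed_convex_cone_hull) simp
    then obtain a b where ab: "a \<bullet> - p t < b" "\<forall>x\<in>convex_cone hull ?S. b < a \<bullet> x"
      using separating_hyperplane_closed_point[OF convex_convex_cone_hull _ *] by blast
    have b0: "b < 0" using ab(2) convex_cone_hull_contains_0 by force
    have au: "0 \<le> a \<bullet> u i" for i
    proof (rule ccontr)
      assume "\<not> 0 \<le> a \<bullet> u i"
      then have neg: "a \<bullet> u i < 0" by simp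
      have "(b / (a \<bullet> u i)) *\<^sub>R u i \<in> convex_cone hull ?S"
        using neg b0 by (intro convex_cone_hull_mul hull_inc) (auto simp: zero_le_divide_iff)
      then have "b < a \<bullet> ((b / (a \<bullet> u i)) *\<^sub>R u i)" using ab(2) by blast
      with neg show False by simp
    qed
    have "0 \<le> v i \<bullet> p a" for i
      using au[of i] u(1)[of i] u(2)[OF p(1), of i a] p(2)[of "u i" a] by (simp add: inner_commute)
    then have "p a = 0" using pos p(1) by blast
    then have "a \<bullet> p t = 0" using p(2)[OF p(1), of a t] by simp
    with ab(1) b0 show False by simp
  qed
  then obtain I' g where I': "I' \<subseteq> ?S" "independent I'" "\<forall>s\<in>I'. 0 < g s" "- p t = (\<Sum>s\<in>I'. g s *\<^sub>R s)"
    using conic_Caratheodory[of ?S "- p t"] by auto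
  obtain B where B: "I' \<subseteq> B" "B \<subseteq> ?S" "independent B" "?S \<subseteq> span B"
    by (rule maximal_independent_subset_extend[OF I'(1,2)]) blast
  have BW: "B \<subseteq> W" using B(2) u by auto
  have perp: "z = 0" if "z \<in> W" "\<And>b. b \<in> B \<Longrightarrow> b \<bullet> z = 0" for z
  proof -
    have "v i \<bullet> z = 0" for i
    proof -
      have "u i \<in> span B" using B(4) by auto
      then have "orthogonal z (u i)"
        by (rule orthogonal_to_span) (use that in \<open>auto simp: orthogonal_def inner_commute\<close>)
      then show ?thesis using u(2)[OF that(1), of i] by (simp add: orthogonal_def inner_commute)
    qed
    then show ?thesis using pos[OF that(1)] by simp
  qed
  have "W \<subseteq> span B"
  proof (rule ccontr)
    assume "\<not> W \<subseteq> span B"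
    then have "span B \<subset> span W" using span_mono[OF BW] unfolding sW by blast
    then obtain z where z: "z \<noteq> 0" "z \<in> span W" "\<And>y. y \<in> span B \<Longrightarrow> orthogonal z y"
      by (rule orthogonal_to_subspace_exists_gen) blast
    then have "z = 0" using sW by (intro perp) (auto simp: orthogonal_def inner_commute span_base)
    with z(1) show False by simp
  qed
  then have cB: "card B = dim W" by (rule basis_card_eq_dim[OF BW _ B(3)])
  define idx where "idx b = (SOME i. u i = b)" for b
  have idx: "u (idx b) = b" if "b \<in> B" for b
  proof -
    have "\<exists>i. u i = b" using that B(2) by auto
    then show ?thesis unfolding idx_def by (rule someI_ex)
  qed
  then have inj: "inj_on idx B" by (rule inj_on_inverseI)
  have "\<exists>e\<in>W. u i \<bullet> e = 1 \<and> (\<forall>y\<in>B - {u i}. y \<bullet> e = 0)" if "i \<in> idx ` B" for i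
    using that dual_basis[OF W BW B(3), of "u i"] idx by auto
  then obtain e where e: "\<And>i. i \<in> idx ` B \<Longrightarrow> e i \<in> W \<and> u i \<bullet> e i = 1 \<and> (\<forall>y\<in>B - {u i}. y \<bullet> e i = 0)"
    by metis
  show ?thesis
  proof (rule that[of "idx ` I'" "idx ` B" "\<lambda>i. g (u i)" e])
    show "idx ` I' \<subseteq> idx ` B" using B by auto
    show "card (idx ` B) = dim W" using cB inj by (simp add: card_image)
    show "0 < g (u i)" if "i \<in> idx ` I'" for i using that I' B idx by auto
    show "t \<bullet> z = - (\<Sum>i\<in>idx ` I'. g (u i) * (v i \<bullet> z))" if z: "z \<in> W" for z
    proof -
      have "(\<Sum>i\<in>idx ` I'. g (u i) * (v i \<bullet> z)) = (\<Sum>i\<in>idx ` I'. g (u i) * (u i \<bullet> z))"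
        using u(2)[OF z] by simp
      also have "\<dots> = (\<Sum>s\<in>I'. g s * (s \<bullet> z))"
        using inj B(1) idx by (subst sum.reindex) (auto intro: inj_on_subset intro!: sum.cong)
      also have "\<dots> = - p t \<bullet> z" unfolding I'(4) by (simp add: inner_sum_left)
      finally show ?thesis using p(2)[OF z, of t] by simp
    qed
    show "e i \<in> W \<and> v i \<bullet> e i = 1 \<and> (\<forall>y\<in>idx ` B - {i}. v y \<bullet> e i = 0)" if i: "i \<in> idx ` B" for i
    proof -
      have "v y \<bullet> e i = 0" if y: "y \<in> idx ` B - {i}" for y
      proof -
        have "u y \<in> B - {u i}" using i y idx by auto
        then have "u y \<bullet> e i = 0" using e[OF i] by blast
        then show ?thesis using e[OF i] u(2)[of "e i" y] by simp
      qed
      then show ?thesis using e[OF i] u(2)[of "e i" i] by auto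
    qed
    show "z = 0" if "z \<in> W" "\<And>i. i \<in> idx ` B \<Longrightarrow> v i \<bullet> z = 0" for z
      using that idx u(2)[OF that(1)] by (intro perp) (metis image_eqI)+
  qed
qed

text \<open>
  On points where \<open>t\<close> and the forms of \<open>I\<close> are nonnegative, all of these vanish. The forms of \<open>U - I\<close> are
  controlled only if they all belong to \<open>T\<close>, for then \<open>h\<close>, the difference of \<open>t\<close> and the sum of the
  forms of \<open>U - I\<close>, is nonnegative on the region that is found. This needs
  \<open>U - I\<close> to have at most \<open>j + 2\<close> elements. If it has more, the
  subspace \<open>W0\<close> where the forms of \<open>I\<close> vanish has dimension at least \<open>j + 2\<close> and is smaller than \<open>W\<close>, and
  the induction hypothesis applies to it with some \<open>v i0\<close> in the role of \<open>t\<close>. The pattern found there is also the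
  right one in \<open>W\<close>, because nonnegativity of \<open>t\<close> and of the forms of \<open>I\<close> already confines the
  region to \<open>W0\<close>.
\<close>

lemma exists_nonacyclic_sign_pattern:
  fixes K :: "'k::field itself" and v :: "'n::finite \<Rightarrow> 'a::euclidean_space"
  assumes "subspace W" and "\<And>z. \<lbrakk>z \<in> W; \<And>i. 0 \<le> v i \<bullet> z\<rbrakk> \<Longrightarrow> z = 0"
    and "\<exists>z\<in>W. t \<bullet> z \<noteq> 0" and "0 \<le> j" "j + 2 \<le> int (dim W)"
  shows "\<exists>M w. w \<in> W \<and> w \<noteq> 0 \<and> 0 \<le> t \<bullet> w \<and> (\<forall>i. i \<in> M \<longleftrightarrow> v i \<bullet> w < 0) \<and>
    \<not> acyclic_in K j {z \<in> W. norm z = 1 \<and> 0 \<le> t \<bullet> z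
        \<and> (\<forall>i. i \<notin> M \<longrightarrow> 0 \<le> v i \<bullet> z) \<and> (\<forall>i\<in>M. v i \<bullet> z \<le> 0) \<and> (\<exists>i\<in>M. v i \<bullet> z = 0)}"
  using assms
proof (induction "dim W" arbitrary: W t rule: less_induct)
  case less
  note W = less.prems(1) and pos = less.prems(2)
  obtain I U \<gamma> e where IU: "I \<subseteq> U" "card U = dim W"
    and \<gamma>: "\<And>u. u \<in> I \<Longrightarrow> 0 < \<gamma> u" and t: "\<And>z. z \<in> W \<Longrightarrow> t \<bullet> z = - (\<Sum>u\<in>I. \<gamma> u * (v u \<bullet> z))"
    and e: "\<And>x. x \<in> U \<Longrightarrow> e x \<in> W \<and> v x \<bullet> e x = 1 \<and> (\<forall>y\<in>U - {x}. v y \<bullet> e x = 0)"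
    and zero: "\<And>z. \<lbrakk>z \<in> W; \<And>u. u \<in> U \<Longrightarrow> v u \<bullet> z = 0\<rbrakk> \<Longrightarrow> z = 0"
    by (rule positively_spanning_basis[where v = v and t = t, OF W]) (use pos in \<open>blast+\<close>)
  have fin: "finite A" for A :: "'n set" by simp
  have tI: "v u \<bullet> z = 0" if "z \<in> W" "0 \<le> t \<bullet> z" "\<And>u. u \<in> I \<Longrightarrow> 0 \<le> v u \<bullet> z" "u \<in> I" for z u
  proof -
    have nn: "\<forall>u\<in>I. 0 \<le> \<gamma> u * (v u \<bullet> z)" using that \<gamma> by (simp add: less_imp_le)
    have "0 \<le> (\<Sum>u\<in>I. \<gamma> u * (v u \<bullet> z))" using nn by (intro sum_nonneg) blast
    then have sum0: "(\<Sum>u\<in>I. \<gamma> u * (v u \<bullet> z)) = 0" using t[OF that(1)] that(2) by linarith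
    have "\<gamma> u * (v u \<bullet> z) = 0"
      by (rule sum_nonneg_0[OF fin _ sum0 that(4)]) (use nn in blast)
    then show ?thesis using \<gamma>[OF that(4)] by simp
  qed
  show ?case
  proof (cases "int (card (U - I)) \<le> j + 2")
    case True
    have "card (U - I) \<le> nat (j + 2)" "nat (j + 2) \<le> card U"
      using True less.prems(4,5) IU by auto
    then obtain T where T: "U - I \<subseteq> T" "T \<subseteq> U" "card T = nat (j + 2)"
      using exists_subset_between[of "U - I" "nat (j + 2)" U] fin by blast
    have Tne: "T \<noteq> {}" using T(3) less.prems(4) by auto
    have jT: "int (card T) - 2 = j" using T(3) less.prems(4) by simp
    \<comment> \<open>The subtracted sum makes the half-space meet the positive cone of \<open>U\<close> only in the origin.\<close>
    define h where "h = t - (\<Sum>u\<in>U - I. v u)"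
    have h: "h \<bullet> z = t \<bullet> z - (\<Sum>u\<in>U - I. v u \<bullet> z)" for z
      by (simp add: h_def inner_diff_left inner_sum_left)
    have none: "z = 0" if "z \<in> W" "0 \<le> t \<bullet> z" "0 \<le> h \<bullet> z" "\<And>u. u \<in> U \<Longrightarrow> 0 \<le> v u \<bullet> z" for z
    proof (rule zero[OF that(1)])
      fix u assume u: "u \<in> U"
      have I0: "v u \<bullet> z = 0" if "u \<in> I" for u using tI[of z u] that \<open>z \<in> W\<close> \<open>0 \<le> t \<bullet> z\<close> IU \<open>\<And>u. u \<in> U \<Longrightarrow> 0 \<le> v u \<bullet> z\<close> by blast
      then have "t \<bullet> z = 0" using t[OF that(1)] by simp
      then have "(\<Sum>u\<in>U - I. v u \<bullet> z) \<le> 0" using that(3) h by simp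
      moreover have nn: "\<forall>u\<in>U - I. 0 \<le> v u \<bullet> z" using that(4) by auto
      moreover have "0 \<le> (\<Sum>u\<in>U - I. v u \<bullet> z)" using nn by (intro sum_nonneg) blast
      ultimately have sum0: "(\<Sum>u\<in>U - I. v u \<bullet> z) = 0" by linarith
      have "v u \<bullet> z = 0" if "u \<in> U - I" for u
        by (rule sum_nonneg_0[OF fin _ sum0 that]) (use nn in blast)
      with I0 u show "v u \<bullet> z = 0" by blast
    qed
    have te: "t \<bullet> e x = (if x \<in> I then - \<gamma> x else 0)" if x: "x \<in> U" for x
    proof -
      have "(\<Sum>u\<in>I. \<gamma> u * (v u \<bullet> e x)) = (\<Sum>u\<in>I. if u = x then \<gamma> u else 0)"
        using e[OF x] IU by (intro sum.cong) auto
      then show ?thesis using t[of "e x"] e[OF x] fin[of I] by simp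
    qed
    have se: "(\<Sum>u\<in>U - I. v u \<bullet> e x) = (if x \<in> I then 0 else 1)" if x: "x \<in> U" for x
    proof -
      have "(\<Sum>u\<in>U - I. v u \<bullet> e x) = (\<Sum>u\<in>U - I. if u = x then 1 else 0)"
        using e[OF x] by (intro sum.cong) auto
      then show ?thesis using x fin[of "U - I"] by simp
    qed
    have q: "- e x \<in> W \<and> 0 \<le> t \<bullet> - e x \<and> 0 \<le> h \<bullet> - e x \<and> (\<forall>u\<in>U - {x}. 0 \<le> v u \<bullet> - e x)
        \<and> (0 < t \<bullet> - e x \<or> 0 < h \<bullet> - e x)" if "x \<in> T" for x
    proof -
      have x: "x \<in> U" using that T by auto
      show ?thesis using te[OF x] se[OF x] h[of "- e x"] e[OF x] \<gamma>[of x] W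
        by (auto simp: subspace_neg sum_negf)
    qed
    obtain M w where M: "M \<inter> U = T" "w \<in> W" "w \<noteq> 0" "0 \<le> t \<bullet> w" "\<And>i. i \<in> M \<longleftrightarrow> v i \<bullet> w < 0"
      "\<not> acyclic_in K (int (card T) - 2) {z \<in> W. norm z = 1 \<and> 0 \<le> t \<bullet> z \<and> 0 \<le> h \<bullet> z
        \<and> (\<forall>i. i \<notin> M \<longrightarrow> 0 \<le> v i \<bullet> z) \<and> (\<forall>i\<in>M. v i \<bullet> z \<le> 0) \<and> (\<exists>i\<in>M. v i \<bullet> z = 0)}"
      by (rule exists_sign_pattern[OF W T(2) Tne, where v = v and t = t and h = h and q = "\<lambda>x. - e x" and K = K])
         (use none q in blast)+
    have "{z \<in> W. norm z = 1 \<and> 0 \<le> t \<bullet> z \<and> 0 \<le> h \<bullet> z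
        \<and> (\<forall>i. i \<notin> M \<longrightarrow> 0 \<le> v i \<bullet> z) \<and> (\<forall>i\<in>M. v i \<bullet> z \<le> 0) \<and> (\<exists>i\<in>M. v i \<bullet> z = 0)} =
      {z \<in> W. norm z = 1 \<and> 0 \<le> t \<bullet> z
        \<and> (\<forall>i. i \<notin> M \<longrightarrow> 0 \<le> v i \<bullet> z) \<and> (\<forall>i\<in>M. v i \<bullet> z \<le> 0) \<and> (\<exists>i\<in>M. v i \<bullet> z = 0)}"
    proof -
      have "0 \<le> h \<bullet> z" if "0 \<le> t \<bullet> z" "\<forall>i\<in>M. v i \<bullet> z \<le> 0" for z
      proof -
        have "(\<Sum>u\<in>U - I. v u \<bullet> z) \<le> 0" using that T M(1) by (intro sum_nonpos) auto
        with that h show ?thesis by simp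
      qed
      then show ?thesis by auto
    qed
    with M(6) jT have "\<not> acyclic_in K j {z \<in> W. norm z = 1 \<and> 0 \<le> t \<bullet> z
        \<and> (\<forall>i. i \<notin> M \<longrightarrow> 0 \<le> v i \<bullet> z) \<and> (\<forall>i\<in>M. v i \<bullet> z \<le> 0) \<and> (\<exists>i\<in>M. v i \<bullet> z = 0)}" by simp
    with M(2-5) show ?thesis by blast
  next
    case False
    define W0 where "W0 = {z\<in>W. \<forall>u\<in>I. v u \<bullet> z = 0}"
    have W0: "subspace W0" using W by (auto simp: W0_def subspace_def inner_add_right)
    have sub: "W0 \<subseteq> W" by (auto simp: W0_def)
    have eW0: "e x \<in> W0" if "x \<in> U - I" for x using e[of x] that IU by (auto simp: W0_def)
    have inj: "inj_on e (U - I)"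
    proof (rule inj_onI)
      fix x y assume "x \<in> U - I" "y \<in> U - I" "e x = e y"
      then show "x = y" using e[of x] e[of y] by (metis DiffD1 DiffI empty_iff insert_iff zero_neq_one)
    qed
    have "independent (e ` (U - I))"
    proof
      assume "dependent (e ` (U - I))"
      then obtain c where c: "\<exists>x\<in>e ` (U - I). c x \<noteq> 0" "(\<Sum>x\<in>e ` (U - I). c x *\<^sub>R x) = 0"
        using dependent_finite[of "e ` (U - I)"] fin by blast
      then obtain x where x: "x \<in> U - I" "c (e x) \<noteq> 0" by blast
      have "0 = v x \<bullet> (\<Sum>y\<in>U - I. c (e y) *\<^sub>R e y)" using c(2) inj by (simp add: sum.reindex)
      also have "\<dots> = (\<Sum>y\<in>U - I. c (e y) * (v x \<bullet> e y))" by (simp add: inner_sum_right)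
      also have "\<dots> = (\<Sum>y\<in>U - I. if y = x then c (e x) else 0)"
        using x e by (intro sum.cong) auto
      also have "\<dots> = c (e x)" using x fin[of "U - I"] by simp
      finally show False using x by simp
    qed
    then have "card (e ` (U - I)) \<le> dim W0" using eW0 by (intro independent_card_le_dim) auto
    then have dim0: "card (U - I) \<le> dim W0" using inj by (simp add: card_image)
    have "I \<noteq> {}" using less.prems(3) t by auto
    then obtain x where x: "x \<in> I" by auto
    have "e x \<in> W" "e x \<notin> W0" using e[of x] x IU by (auto simp: W0_def intro!: bexI[of _ x])
    then have "W0 \<subset> W" using sub by auto
    then have dimlt: "dim W0 < dim W" using W W0 by (metis dim_psubset span_eq_iff)
    have pos0: "z = 0" if "z \<in> W0" "\<And>i. 0 \<le> v i \<bullet> z" for z using that pos sub by blast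
    have "\<exists>i. \<exists>z\<in>W0. v i \<bullet> z \<noteq> 0"
    proof (rule ccontr)
      assume "\<not> ?thesis"
      then have "\<forall>z\<in>W0. z = 0" using pos0 by auto
      then have "W0 \<subseteq> {0}" by auto
      then have "dim W0 = 0" by (simp add: dim_eq_0)
      then have "card (U - I) = 0" using dim0 by linarith
      with False less.prems(4) show False by linarith
    qed
    then obtain i0 where i0: "\<exists>z\<in>W0. v i0 \<bullet> z \<noteq> 0" by blast
    have "j + 2 \<le> int (dim W0)" using dim0 False by simp
    from less.hyps[OF dimlt W0 pos0 i0 less.prems(4) this]
    obtain M w where M: "w \<in> W0" "w \<noteq> 0" "0 \<le> v i0 \<bullet> w" "\<forall>i. i \<in> M \<longleftrightarrow> v i \<bullet> w < 0"
      "\<not> acyclic_in K j {z \<in> W0. norm z = 1 \<and> 0 \<le> v i0 \<bullet> z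
        \<and> (\<forall>i. i \<notin> M \<longrightarrow> 0 \<le> v i \<bullet> z) \<and> (\<forall>i\<in>M. v i \<bullet> z \<le> 0) \<and> (\<exists>i\<in>M. v i \<bullet> z = 0)}" by blast
    have t0: "t \<bullet> z = 0" if "z \<in> W0" for z using t[of z] that sub by (auto simp: W0_def)
    have MI: "M \<inter> I = {}" "i0 \<notin> M" using M(1,3,4) by (auto simp: W0_def)
    have "{z \<in> W0. norm z = 1 \<and> 0 \<le> v i0 \<bullet> z
        \<and> (\<forall>i. i \<notin> M \<longrightarrow> 0 \<le> v i \<bullet> z) \<and> (\<forall>i\<in>M. v i \<bullet> z \<le> 0) \<and> (\<exists>i\<in>M. v i \<bullet> z = 0)} =
        {z \<in> W. norm z = 1 \<and> 0 \<le> t \<bullet> z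
        \<and> (\<forall>i. i \<notin> M \<longrightarrow> 0 \<le> v i \<bullet> z) \<and> (\<forall>i\<in>M. v i \<bullet> z \<le> 0) \<and> (\<exists>i\<in>M. v i \<bullet> z = 0)}" (is "?L = ?R")
    proof
      show "?L \<subseteq> ?R" using sub t0 by auto
      show "?R \<subseteq> ?L"
      proof
        fix z assume z: "z \<in> ?R"
        then have "v u \<bullet> z = 0" if "u \<in> I" for u using tI[of z u] that MI by auto
        then show "z \<in> ?L" using z MI by (auto simp: W0_def)
      qed
    qed
    with M sub t0[of w] show ?thesis by (intro exI[of _ M] exI[of _ w]) auto
  qed
qed

section \<open>Homogenization of regions and of their visible facets\<close>

definition homogenized_normal :: "('n \<Rightarrow> 'a::euclidean_space) \<Rightarrow> ('n \<Rightarrow> real) \<Rightarrow> 'n \<Rightarrow> 'a \<times> real" where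
  "homogenized_normal a c i = (a i, - c i)"

lemma homogenized_normal_inner: "homogenized_normal a c i \<bullet> z = a i \<bullet> fst z - c i * snd z"
  by (cases z) (simp add: homogenized_normal_def)

lemma homogenized_normal_point: "homogenized_normal a c i \<bullet> (x, 1) = a i \<bullet> x - c i"
  by (simp add: homogenized_normal_inner)

lemma homogenized_normal_dehomogenize:
  assumes "0 < snd z"
  shows "homogenized_normal a c i \<bullet> z = snd z * (a i \<bullet> (fst z /\<^sub>R snd z) - c i)"
  using assms by (simp add: homogenized_normal_inner right_diff_distrib)

lemma in_open_side_iff: "x \<in> open_side s v r \<longleftrightarrow> (if s = Pos then r < v \<bullet> x else v \<bullet> x < r)"
  by (cases s) auto

lemma in_region_iff: "x \<in> region a c b \<longleftrightarrow> (\<forall>i. if b i = Pos then c i < a i \<bullet> x else a i \<bullet> x < c i)"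
  by (simp add: region_def in_open_side_iff)

lemma not_Pos_iff: "s \<noteq> Pos \<longleftrightarrow> s = Neg"
  by (cases s) auto

text \<open>
  For a nonempty region, the closed cone over the region placed at height one. Its vectors of height
  zero are the directions in which the closed region extends to infinity.
\<close>

definition homogenized_region :: "('n \<Rightarrow> 'a::euclidean_space) \<Rightarrow> ('n \<Rightarrow> real) \<Rightarrow> ('n \<Rightarrow> side) \<Rightarrow> ('a \<times> real) set" where
  "homogenized_region a c b = {z. 0 \<le> snd z \<and> (\<forall>i. if b i = Pos then 0 \<le> homogenized_normal a c i \<bullet> z else homogenized_normal a c i \<bullet> z \<le> 0)}"

lemma to_hemisphere_snd: "0 < snd z \<Longrightarrow> to_hemisphere (fst z /\<^sub>R snd z) = z /\<^sub>R norm z"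
proof -
  assume z: "0 < snd z"
  have eq: "(fst z /\<^sub>R snd z, 1) = z /\<^sub>R snd z" using z by (cases z) simp
  show ?thesis
    unfolding to_hemisphere_def eq using z by simp
qed

text \<open>
  The way in which points at infinity are reached: \<open>f\<close> is a curve of vectors of positive height that
  represent points of \<open>S\<close>.
\<close>

lemma in_hemisphere_closureI:
  assumes "norm z = 1" "(f \<longlongrightarrow> z) (at_right (0::real))"
    "\<And>\<delta>. 0 < \<delta> \<Longrightarrow> 0 < snd (f \<delta>) \<and> fst (f \<delta>) /\<^sub>R snd (f \<delta>) \<in> S"
  shows "z \<in> hemisphere_closure S"
  unfolding hemisphere_closure_def
proof (rule Lim_in_closed_set[of _ "\<lambda>\<delta>. f \<delta> /\<^sub>R norm (f \<delta>)" "at_right 0"])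
  show "eventually (\<lambda>\<delta>. f \<delta> /\<^sub>R norm (f \<delta>) \<in> closure (to_hemisphere ` S)) (at_right (0::real))"
    unfolding eventually_at_right_field
  proof (intro exI[of _ 1] conjI allI impI)
    fix \<delta> :: real assume "0 < \<delta>" 
    then have "0 < snd (f \<delta>)" "fst (f \<delta>) /\<^sub>R snd (f \<delta>) \<in> S" using assms(3) by auto
    then show "f \<delta> /\<^sub>R norm (f \<delta>) \<in> closure (to_hemisphere ` S)"
      using to_hemisphere_snd[of "f \<delta>"] by (metis closure_subset imageI subsetD)
  qed simp
  have "((\<lambda>\<delta>. f \<delta> /\<^sub>R norm (f \<delta>)) \<longlongrightarrow> z /\<^sub>R norm z) (at_right 0)"
    using assms(1) by (intro tendsto_intros assms(2)) auto
  then show "((\<lambda>\<delta>. f \<delta> /\<^sub>R norm (f \<delta>)) \<longlongrightarrow> z) (at_right 0)" using assms(1) by simp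
qed auto

lemma hemisphere_closure_subset:
  assumes "closed T" "\<And>x. x \<in> S \<Longrightarrow> to_hemisphere x \<in> T"
  shows "hemisphere_closure S \<subseteq> T"
  unfolding hemisphere_closure_def using assms by (intro closure_minimal) auto

lemma norm_pair_one_pos: "0 < norm (x, 1::real)"
  by (metis norm_eq_zero zero_less_norm_iff prod.inject zero_neq_one zero_prod_def)

lemma norm_to_hemisphere: "norm (to_hemisphere x) = 1"
  using norm_pair_one_pos[of x] by (simp add: to_hemisphere_def del: scaleR_Pair)

lemma to_hemisphere_inner: "u \<bullet> to_hemisphere x = (u \<bullet> (x, 1)) / norm (x, 1::real)"
  by (simp add: to_hemisphere_def divide_inverse mult.commute del: scaleR_Pair)

lemma snd_to_hemisphere: "0 < snd (to_hemisphere x)"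
  using norm_pair_one_pos[of x] by (simp add: to_hemisphere_def)

lemma closure_region:
  assumes "region a c b \<noteq> {}"
  shows "closure (region a c b) = {x. \<forall>i. if b i = Pos then c i \<le> a i \<bullet> x else a i \<bullet> x \<le> c i}" (is "_ = ?P")
proof
  have eq: "?P = (\<Inter>i. if b i = Pos then {x. c i \<le> a i \<bullet> x} else {x. a i \<bullet> x \<le> c i})" by (auto split: if_splits)
  have "closed ?P"
    by (subst eq, intro closed_INT ballI) (simp add: closed_halfspace_ge closed_halfspace_le)
  moreover have "region a c b \<subseteq> ?P" by (auto simp: in_region_iff less_imp_le)
  ultimately show "closure (region a c b) \<subseteq> ?P" by (simp add: closure_minimal)
  show "?P \<subseteq> closure (region a c b)"
  proof
    fix x assume x: "x \<in> ?P"
    obtain x0 where x0: "x0 \<in> region a c b" using assms by auto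
    show "x \<in> closure (region a c b)"
    proof (rule Lim_in_closed_set[of _ "\<lambda>\<delta>. (1 - \<delta>) *\<^sub>R x + \<delta> *\<^sub>R x0" "at_right 0"])
      show "eventually (\<lambda>\<delta>. (1 - \<delta>) *\<^sub>R x + \<delta> *\<^sub>R x0 \<in> closure (region a c b)) (at_right (0::real))"
        unfolding eventually_at_right_field
      proof (intro exI[of _ 1] conjI allI impI)
        fix \<delta> :: real assume \<delta>: "0 < \<delta>" "\<delta> < 1"
        have "if b i = Pos then c i < a i \<bullet> ((1 - \<delta>) *\<^sub>R x + \<delta> *\<^sub>R x0) else a i \<bullet> ((1 - \<delta>) *\<^sub>R x + \<delta> *\<^sub>R x0) < c i" for i
        proof (cases "b i = Pos")
          case True
          then have "(1 - \<delta>) * c i \<le> (1 - \<delta>) * (a i \<bullet> x)" "\<delta> * c i < \<delta> * (a i \<bullet> x0)"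
            using x x0 \<delta> by (auto simp: in_region_iff intro!: mult_left_mono)
          with True show ?thesis by (simp add: inner_add_right algebra_simps)
        next
          case False
          then have "(1 - \<delta>) * (a i \<bullet> x) \<le> (1 - \<delta>) * c i" "\<delta> * (a i \<bullet> x0) < \<delta> * c i"
            using x x0 \<delta> by (auto simp: in_region_iff intro!: mult_left_mono)
          with False show ?thesis by (simp add: inner_add_right algebra_simps)
        qed
        then show "(1 - \<delta>) *\<^sub>R x + \<delta> *\<^sub>R x0 \<in> closure (region a c b)"
          by (intro subsetD[OF closure_subset]) (simp add: in_region_iff)
      qed simp
      have "((\<lambda>\<delta>. (1 - \<delta>) *\<^sub>R x + \<delta> *\<^sub>R x0) \<longlongrightarrow> (1 - 0) *\<^sub>R x + 0 *\<^sub>R x0) (at_right 0)"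
        by (intro tendsto_intros)
      then show "((\<lambda>\<delta>. (1 - \<delta>) *\<^sub>R x + \<delta> *\<^sub>R x0) \<longlongrightarrow> x) (at_right 0)" by simp
    qed auto
  qed
qed

lemma open_region: "open (region a c (b :: 'n::finite \<Rightarrow> side))"
proof -
  have "open (open_side (b i) (a i) (c i))" for i
    by (cases "b i") (simp_all add: open_halfspace_gt open_halfspace_lt)
  then show ?thesis unfolding region_def by (intro open_INT) auto
qed

text \<open>
  Near \<open>x\<close>, the points towards \<open>p\<close> violate the constraint of \<open>i0\<close>, so they violate some constraint of an
  irredundant subsystem. As there are finitely many, one constraint of the subsystem is tight at \<open>x\<close>
  and violated at \<open>p\<close>. It defines a facet through \<open>x\<close>, and its sign is negative because \<open>p\<close> satisfies
  every positive constraint.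
\<close>

lemma tight_negative_in_visible_facet:
  fixes a :: "'n::finite \<Rightarrow> 'a::euclidean_space"
  assumes nz: "\<And>i. a i \<noteq> 0" and p: "p \<in> region a c (\<lambda>_. Pos)" and ne: "region a c b \<noteq> {}"
    and x: "x \<in> closure (region a c b)" and i0: "b i0 = Neg" "a i0 \<bullet> x = c i0"
  shows "\<exists>F i. F facet_of closure (region a c b) \<and> affine hull F = hyperplane (a i) (c i) \<and> b i = Neg \<and> x \<in> F"
proof -
  let ?P = "closure (region a c b)"
  define \<alpha> where "\<alpha> i = (if b i = Pos then - a i else a i)" for i
  define \<beta> where "\<beta> i = (if b i = Pos then - c i else c i)" for i
  define H where "H i = {y. \<alpha> i \<bullet> y \<le> \<beta> i}" for i
  have P: "?P = \<Inter>(range H)"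
    unfolding closure_region[OF ne] by (auto simp: H_def \<alpha>_def \<beta>_def split: if_splits)
  let ?A = "{F \<in> Pow (range H). \<Inter>F = ?P}"
  have "finite ?A" "?A \<noteq> {}" using P by auto
  obtain F where F: "F \<in> ?A" "\<And>F'. F' \<in> ?A \<Longrightarrow> F' \<subseteq> F \<Longrightarrow> F = F'"
  proof -
    obtain F where F1: "F \<in> ?A" and F2: "\<forall>F'\<in>?A. F' \<le> F \<longrightarrow> F = F'"
      using finite_has_minimal[OF \<open>finite ?A\<close> \<open>?A \<noteq> {}\<close>] by (elim bexE)
    show thesis by (rule that[OF F1]) (rule F2[rule_format])
  qed
  have FP: "\<Inter>F = ?P" "F \<subseteq> range H" using F by auto
  obtain j where j: "\<And>h. h \<in> F \<Longrightarrow> H (j h) = h" using FP(2) by (metis f_inv_into_f subsetD)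
  have "interior ?P \<noteq> {}"
    using open_region[of a c b] ne interior_maximal[OF closure_subset, of "region a c b"] by auto
  then have aff: "affine hull ?P = UNIV" by (rule affine_hull_nonempty_interior)
  have "\<exists>h\<in>F. p \<notin> h \<and> \<alpha> (j h) \<bullet> x = \<beta> (j h)"
  proof (rule ccontr)
    assume contr: "\<not> ?thesis"
    have ev: "eventually (\<lambda>\<epsilon>. (1 - \<epsilon>) *\<^sub>R x + \<epsilon> *\<^sub>R p \<in> h) (at_right (0::real))" if h: "h \<in> F" for h
    proof (cases "p \<in> h")
      case True
      have xh: "x \<in> h" using x h FP(1) by auto
      have "convex h" using j[OF h] convex_halfspace_le unfolding H_def by metis
      then have "(1 - \<epsilon>) *\<^sub>R x + \<epsilon> *\<^sub>R p \<in> h" if "0 < \<epsilon>" "\<epsilon> < 1" for \<epsilon>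
        using that xh True by (intro convexD) auto
      then show ?thesis unfolding eventually_at_right_field by (intro exI[of _ 1]) auto
    next
      case False
      have "x \<in> H (j h)" using x h FP(1) j by auto
      then have lt: "\<alpha> (j h) \<bullet> x < \<beta> (j h)" using contr h False by (force simp: H_def)
      have "((\<lambda>\<epsilon>. \<alpha> (j h) \<bullet> ((1 - \<epsilon>) *\<^sub>R x + \<epsilon> *\<^sub>R p)) \<longlongrightarrow> \<alpha> (j h) \<bullet> ((1 - 0) *\<^sub>R x + 0 *\<^sub>R p)) (at_right (0::real))"
        by (intro tendsto_intros)
      then have "eventually (\<lambda>\<epsilon>. \<alpha> (j h) \<bullet> ((1 - \<epsilon>) *\<^sub>R x + \<epsilon> *\<^sub>R p) < \<beta> (j h)) (at_right (0::real))"
        using lt by (intro order_tendstoD) auto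
      then have "eventually (\<lambda>\<epsilon>. (1 - \<epsilon>) *\<^sub>R x + \<epsilon> *\<^sub>R p \<in> H (j h)) (at_right (0::real))"
        by (rule eventually_mono) (simp add: H_def)
      then show ?thesis using j[OF h] by simp
    qed
    have "finite F" by (rule finite_subset[OF FP(2)]) simp
    then have "eventually (\<lambda>\<epsilon>. \<forall>h\<in>F. (1 - \<epsilon>) *\<^sub>R x + \<epsilon> *\<^sub>R p \<in> h) (at_right (0::real))"
      using ev by (simp add: eventually_ball_finite_distrib)
    then obtain d :: real where d: "d > 0" "\<And>\<epsilon>. 0 < \<epsilon> \<Longrightarrow> \<epsilon> < d \<Longrightarrow> (1 - \<epsilon>) *\<^sub>R x + \<epsilon> *\<^sub>R p \<in> ?P"
      unfolding eventually_at_right_field FP(1)[symmetric] by auto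
    have "(1 - d/2) *\<^sub>R x + (d/2) *\<^sub>R p \<in> H i0" using d P by auto
    then have "a i0 \<bullet> ((1 - d/2) *\<^sub>R x + (d/2) *\<^sub>R p) \<le> c i0" using i0 by (simp add: H_def \<alpha>_def \<beta>_def)
    then have "d / 2 * (a i0 \<bullet> p) \<le> d / 2 * c i0" using i0 by (simp add: inner_add_right algebra_simps)
    moreover have "c i0 < a i0 \<bullet> p" using p by (simp add: in_region_iff)
    ultimately show False using d by simp
  qed
  then obtain h where h: "h \<in> F" "p \<notin> h" "\<alpha> (j h) \<bullet> x = \<beta> (j h)" by blast
  define i where "i = j h"
  have bi: "b i = Neg"
  proof (rule ccontr)
    assume "b i \<noteq> Neg"
    then have "b i = Pos" using not_Pos_iff by blast
    then have "p \<in> H i" using p by (simp add: H_def \<alpha>_def \<beta>_def in_region_iff less_imp_le)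
    with h j show False by (simp add: i_def)
  qed
  let ?F = "?P \<inter> {y. \<alpha> (j h) \<bullet> y = \<beta> (j h)}"
  have facet: "?F facet_of ?P"
  proof (subst facet_of_polyhedron_explicit[of F, where a = "\<lambda>h. \<alpha> (j h)" and b = "\<lambda>h. \<beta> (j h)"])
    show "finite F" by (rule finite_subset[OF FP(2)]) simp
    show "?P = affine hull ?P \<inter> \<Inter>F" using aff FP by simp
    show "\<alpha> (j h) \<noteq> 0 \<and> h = {x. \<alpha> (j h) \<bullet> x \<le> \<beta> (j h)}" if "h \<in> F" for h
      using j[OF that] nz by (auto simp: H_def \<alpha>_def)
    show "?P \<subset> affine hull ?P \<inter> \<Inter>F'" if "F' \<subset> F" for F'
    proof -
      have "?P \<subseteq> \<Inter>F'" using that FP(1) by auto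
      moreover have "\<Inter>F' \<noteq> ?P" using F(2)[of F'] that FP(2) by auto
      ultimately show ?thesis using aff by auto
    qed
    show "\<exists>h'. h' \<in> F \<and> ?F = ?P \<inter> {x. \<alpha> (j h') \<bullet> x = \<beta> (j h')}" using h by blast
  qed
  have FH: "?F \<subseteq> hyperplane (a i) (c i)" using bi by (auto simp: hyperplane_def \<alpha>_def \<beta>_def i_def)
  have affH: "affine (hyperplane (a i) (c i))" unfolding hyperplane_def by (rule affine_hyperplane)
  have "aff_dim ?F = aff_dim ?P - 1" using facet by (simp add: facet_of_def)
  also have "aff_dim ?P = aff_dim (UNIV :: 'a set)" by (metis aff aff_dim_affine_hull)
  also have "\<dots> - 1 = aff_dim (hyperplane (a i) (c i))"
    unfolding hyperplane_def using nz[of i] by (simp add: aff_dim_hyperplane)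
  finally have "affine hull ?F = hyperplane (a i) (c i)"
    using affH FH facet by (intro affine_dim_equal) (auto simp: hull_minimal facet_of_def)
  then show ?thesis using facet bi h x by blast
qed

lemma Lambda_empty: "region a c b = {} \<Longrightarrow> Lambda a c b = {}"
  by (auto simp: Lambda_def facet_of_def)

definition visible_boundary :: "('n \<Rightarrow> 'a::euclidean_space) \<Rightarrow> ('n \<Rightarrow> real) \<Rightarrow> ('n \<Rightarrow> side) \<Rightarrow> ('a \<times> real) set" where
  "visible_boundary a c b = {z \<in> homogenized_region a c b. \<exists>i. b i = Neg \<and> homogenized_normal a c i \<bullet> z = 0}"

lemma homogenized_region_eq_Inter:
  "homogenized_region a c b = {z. 0 \<le> (0, 1) \<bullet> z} \<inter>
     (\<Inter>i. if b i = Pos then {z. 0 \<le> homogenized_normal a c i \<bullet> z} else {z. homogenized_normal a c i \<bullet> z \<le> 0})"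
  by (auto simp: homogenized_region_def split: if_splits)

lemma closed_homogenized_region: "closed (homogenized_region a c b)"
  by (subst homogenized_region_eq_Inter, intro closed_Int closed_INT ballI closed_halfspace_ge)
    (simp add: closed_halfspace_ge closed_halfspace_le)

lemma convex_homogenized_region: "convex (homogenized_region a c b)"
  by (subst homogenized_region_eq_Inter, intro convex_Int convex_INT convex_halfspace_ge)
    (simp add: convex_halfspace_ge convex_halfspace_le)

lemma conic_homogenized_region: "conic (homogenized_region a c b)"
  unfolding conic_def
proof (intro allI impI)
  fix z and k :: real assume "z \<in> homogenized_region a c b" "0 \<le> k"
  then show "k *\<^sub>R z \<in> homogenized_region a c b"
    unfolding homogenized_region_def inner_scaleR_right
    by (auto simp: zero_le_mult_iff mult_le_0_iff simp del: scaleR_Pair split: if_splits)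
qed

lemma to_hemisphere_in_homogenized_region:
  assumes "region a c b \<noteq> {}" "x \<in> closure (region a c b)"
  shows "to_hemisphere x \<in> homogenized_region a c b"
proof -
  have "if b i = Pos then c i \<le> a i \<bullet> x else a i \<bullet> x \<le> c i" for i
    using assms by (simp add: closure_region)
  then show ?thesis
    using norm_pair_one_pos[of x] snd_to_hemisphere[of x]
    by (auto simp: homogenized_region_def to_hemisphere_inner homogenized_normal_point zero_le_divide_iff divide_le_0_iff less_imp_le)
qed

text \<open>
  For the inclusion from right to left, a vector \<open>z\<close> of the visible boundary is approximated by finite points: move it
  a little towards a point \<open>x0\<close> of the region, which makes its height positive and all negative
  constraints strict, and then in direction \<open>(p, 1)\<close> until the first negative constraint is tight.
\<close>

lemma Lambda_eq:
  fixes a :: "'n::finite \<Rightarrow> 'a::euclidean_space"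
  assumes nz: "\<And>i. a i \<noteq> 0" and pos: "region a c (\<lambda>_. Pos) \<noteq> {}" and ne: "region a c b \<noteq> {}"
  shows "Lambda a c b = {z \<in> visible_boundary a c b. norm z = 1}"
proof
  let ?P = "closure (region a c b)"
  obtain p where p: "p \<in> region a c (\<lambda>_. Pos)" using pos by auto
  obtain x0 where x0: "x0 \<in> region a c b" using ne by auto
  let ?\<F> = "{F. F facet_of ?P \<and> (\<exists>i. affine hull F = hyperplane (a i) (c i) \<and> region a c b \<subseteq> open_side Neg (a i) (c i))}"
  have Lam: "Lambda a c b = \<Union> (hemisphere_closure ` ?\<F>)" unfolding Lambda_def by auto
  show "Lambda a c b \<subseteq> {z \<in> visible_boundary a c b. norm z = 1}"
  proof
    fix z assume "z \<in> Lambda a c b"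
    then obtain F i where z: "z \<in> hemisphere_closure F" and F: "F facet_of ?P"
      "affine hull F = hyperplane (a i) (c i)" "region a c b \<subseteq> open_side Neg (a i) (c i)"
      unfolding Lam by auto
    have bi: "b i = Neg"
    proof (rule ccontr)
      assume "b i \<noteq> Neg"
      then have "b i = Pos" using not_Pos_iff by blast
      then have "c i < a i \<bullet> x0" using x0 spec[of _ i] unfolding in_region_iff by metis
      moreover have "a i \<bullet> x0 < c i" using x0 F(3) by auto
      ultimately show False by simp
    qed
    let ?T = "homogenized_region a c b \<inter> {z. homogenized_normal a c i \<bullet> z = 0} \<inter> sphere 0 1"
    have "hemisphere_closure F \<subseteq> ?T"
    proof (rule hemisphere_closure_subset)
      show "closed ?T" by (intro closed_Int closed_homogenized_region closed_hyperplane closed_sphere)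
      fix x assume x: "x \<in> F"
      have "x \<in> ?P" using F(1) x facet_of_imp_subset by blast
      moreover have "x \<in> hyperplane (a i) (c i)" using x F(2) hull_inc by metis
      ultimately show "to_hemisphere x \<in> ?T"
        using to_hemisphere_in_homogenized_region[OF ne] norm_to_hemisphere[of x]
        by (auto simp: to_hemisphere_inner homogenized_normal_point hyperplane_def)
    qed
    with z bi show "z \<in> {z \<in> visible_boundary a c b. norm z = 1}" by (auto simp: visible_boundary_def)
  qed
  show "{z \<in> visible_boundary a c b. norm z = 1} \<subseteq> Lambda a c b"
  proof
    fix z assume "z \<in> {z \<in> visible_boundary a c b. norm z = 1}"
    then obtain i0 where z: "z \<in> homogenized_region a c b" "norm z = 1" and i0: "b i0 = Neg" "homogenized_normal a c i0 \<bullet> z = 0"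
      by (auto simp: visible_boundary_def)
    let ?V = "{x \<in> ?P. \<exists>i. b i = Neg \<and> a i \<bullet> x = c i}"
    let ?J = "{i. b i = Neg}"
    let ?L = "homogenized_normal a c"
    have Lp: "0 < ?L i \<bullet> (p, 1)" for i using p by (simp add: homogenized_normal_point in_region_iff)
    have Lx0: "if b i = Pos then 0 < ?L i \<bullet> (x0, 1) else ?L i \<bullet> (x0, 1) < 0" for i
      using x0 spec[of _ i] unfolding in_region_iff homogenized_normal_point by (metis diff_gt_0_iff_gt diff_less_0_iff_less)
    define zd where "zd \<delta> = z + \<delta> *\<^sub>R (x0, 1)" for \<delta> :: real
    define m where "m \<delta> = Max ((\<lambda>i. (?L i \<bullet> zd \<delta>) / (?L i \<bullet> (p, 1))) ` ?J)" for \<delta>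
    define f where "f \<delta> = zd \<delta> + (- m \<delta>) *\<^sub>R (p, 1)" for \<delta>
    have J: "finite ?J" "?J \<noteq> {}" using i0 by auto
    have Lzd: "?L i \<bullet> zd \<delta> = ?L i \<bullet> z + \<delta> * (?L i \<bullet> (x0, 1))" for i \<delta> by (simp add: zd_def inner_add_right del: scaleR_Pair)
    have Lz: "if b i = Pos then 0 \<le> ?L i \<bullet> z else ?L i \<bullet> z \<le> 0" for i using z by (auto simp: homogenized_region_def)
    have Lf: "?L i \<bullet> f \<delta> = ?L i \<bullet> zd \<delta> - m \<delta> * (?L i \<bullet> (p, 1))" for i \<delta> by (simp add: f_def inner_diff_right del: scaleR_Pair)
    have neg: "?L i \<bullet> zd \<delta> < 0" if "0 < \<delta>" "b i = Neg" for i \<delta>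
      using Lz[of i] Lx0[of i] that mult_pos_neg[of \<delta> "?L i \<bullet> (x0, 1)"] by (simp add: Lzd)
    have m0: "m \<delta> < 0" if \<delta>: "0 < \<delta>" for \<delta>
    proof -
      have "m \<delta> \<in> (\<lambda>i. (?L i \<bullet> zd \<delta>) / (?L i \<bullet> (p, 1))) ` ?J" unfolding m_def using J by (intro Max_in) auto
      then obtain i where "b i = Neg" "m \<delta> = (?L i \<bullet> zd \<delta>) / (?L i \<bullet> (p, 1))" by auto
      with neg[OF \<delta>] Lp[of i] show ?thesis by (simp add: divide_neg_pos)
    qed
    have mge: "?L i \<bullet> zd \<delta> \<le> m \<delta> * (?L i \<bullet> (p, 1))" if "b i = Neg" for i \<delta>
    proof -
      have "(?L i \<bullet> zd \<delta>) / (?L i \<bullet> (p, 1)) \<le> m \<delta>" unfolding m_def using J that by (intro Max_ge) auto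
      with Lp[of i] show ?thesis by (simp add: divide_le_eq)
    qed
    have "z \<in> hemisphere_closure ?V"
    proof (rule in_hemisphere_closureI[OF z(2), of f])
      define k where "k = (?L i0 \<bullet> (x0, 1)) / (?L i0 \<bullet> (p, 1))"
      \<comment> \<open>The constraint of \<open>i0\<close>, tight at \<open>z\<close>, bounds the push by a multiple of \<open>\<delta>\<close>, so that \<open>f \<delta>\<close> tends to \<open>z\<close>.\<close>
      have klow: "\<delta> * k \<le> m \<delta>" for \<delta>
        using mge[OF i0(1), of \<delta>] Lp[of i0] i0(2) by (simp add: k_def Lzd divide_le_eq)
      have "(m \<longlongrightarrow> 0) (at_right 0)"
      proof (rule tendsto_sandwich[of "\<lambda>\<delta>. \<delta> * k" m "at_right 0" "\<lambda>_. 0"])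
        show "\<forall>\<^sub>F \<delta> in at_right 0. \<delta> * k \<le> m \<delta>" using klow by simp
        show "\<forall>\<^sub>F \<delta> in at_right 0. m \<delta> \<le> 0"
          unfolding eventually_at_right_field using m0 by (intro exI[of _ 1]) (auto intro: less_imp_le)
        have "((\<lambda>\<delta>. \<delta> * k) \<longlongrightarrow> 0 * k) (at_right 0)" by (intro tendsto_intros)
        then show "((\<lambda>\<delta>. \<delta> * k) \<longlongrightarrow> 0) (at_right 0)" by simp
      qed simp
      then have "(f \<longlongrightarrow> z + 0 *\<^sub>R (x0, 1) + (- 0) *\<^sub>R (p, 1)) (at_right 0)"
        unfolding f_def zd_def by (intro tendsto_intros)
      then show "(f \<longlongrightarrow> z) (at_right 0)" by (simp del: scaleR_Pair)
      fix \<delta> :: real assume \<delta>: "0 < \<delta>"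
      have "0 \<le> snd z" using z by (simp add: homogenized_region_def)
      then have s: "0 < snd (f \<delta>)" using m0[OF \<delta>] \<delta> by (simp add: f_def zd_def)
      let ?x = "fst (f \<delta>) /\<^sub>R snd (f \<delta>)"
      have sgn: "?L i \<bullet> f \<delta> = snd (f \<delta>) * (a i \<bullet> ?x - c i)" for i by (rule homogenized_normal_dehomogenize[OF s])
      have "if b i = Pos then c i \<le> a i \<bullet> ?x else a i \<bullet> ?x \<le> c i" for i
      proof (cases "b i = Pos")
        case True
        have "0 \<le> ?L i \<bullet> zd \<delta>" using Lz[of i] Lx0[of i] True \<delta> by (simp add: Lzd)
        moreover have "m \<delta> * (?L i \<bullet> (p, 1)) \<le> 0" using m0[OF \<delta>] Lp[of i] by (simp add: mult_le_0_iff)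
        ultimately have "0 \<le> ?L i \<bullet> f \<delta>" by (simp add: Lf)
        then show ?thesis using True s unfolding sgn by (simp add: zero_le_mult_iff)
      next
        case False
        then have "?L i \<bullet> f \<delta> \<le> 0" using mge[of i \<delta>] not_Pos_iff by (simp add: Lf)
        then show ?thesis using False s unfolding sgn by (simp add: mult_le_0_iff)
      qed
      then have "?x \<in> ?P" unfolding closure_region[OF ne] by blast
      moreover have "\<exists>i. b i = Neg \<and> a i \<bullet> ?x = c i"
      proof -
        have "m \<delta> \<in> (\<lambda>i. (?L i \<bullet> zd \<delta>) / (?L i \<bullet> (p, 1))) ` ?J" unfolding m_def using J by (intro Max_in) auto
        then obtain i where i: "b i = Neg" "m \<delta> = (?L i \<bullet> zd \<delta>) / (?L i \<bullet> (p, 1))" by auto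
        then have "?L i \<bullet> f \<delta> = 0" using Lp[of i] by (simp add: Lf)
        with s i(1) show ?thesis unfolding sgn by auto
      qed
      ultimately show "0 < snd (f \<delta>) \<and> ?x \<in> ?V" using s by blast
    qed
    moreover have "hemisphere_closure ?V \<subseteq> Lambda a c b"
    proof (rule hemisphere_closure_subset)
      have Peq: "?P = (\<Inter>i. {x. if b i = Pos then c i \<le> a i \<bullet> x else a i \<bullet> x \<le> c i})"
        unfolding closure_region[OF ne] by auto
      have half: "polyhedron {x. if b i = Pos then c i \<le> a i \<bullet> x else a i \<bullet> x \<le> c i}" for i
        by (cases "b i = Pos") (simp_all add: polyhedron_halfspace_ge polyhedron_halfspace_le)
      have "polyhedron ?P"
        unfolding Peq by (rule polyhedron_Inter) (simp, use half in blast)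
      then have "finite ?\<F>" using finite_polyhedron_facets[of ?P] by (auto intro: finite_subset[rotated])
      then show "closed (Lambda a c b)" unfolding Lam by (auto simp: hemisphere_closure_def)
      fix x assume "x \<in> ?V"
      then obtain i where "x \<in> ?P" "b i = Neg" "a i \<bullet> x = c i" by blast
      then obtain F k where F: "F facet_of ?P" "affine hull F = hyperplane (a k) (c k)" "b k = Neg" "x \<in> F"
        using tight_negative_in_visible_facet[OF nz p ne] by blast
      have "region a c b \<subseteq> open_side (b k) (a k) (c k)" by (auto simp: region_def)
      then have "F \<in> ?\<F>" using F(1,2,3) by auto
      moreover have "to_hemisphere x \<in> hemisphere_closure F"
        unfolding hemisphere_closure_def by (rule subsetD[OF closure_subset]) (rule imageI[OF F(4)])
      ultimately show "to_hemisphere x \<in> Lambda a c b" unfolding Lam by (rule UN_I)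
    qed
    ultimately show "z \<in> Lambda a c b" by blast
  qed
qed

section \<open>Sections by an affine subspace\<close>

lemma bounded_ray_trivial:
  fixes d :: "'a::real_normed_vector"
  assumes "bounded S" "\<And>s. 0 \<le> s \<Longrightarrow> x + s *\<^sub>R d \<in> S"
  shows "d = 0"
proof (rule ccontr)
  assume d: "d \<noteq> 0"
  obtain B where B: "\<And>y. y \<in> S \<Longrightarrow> norm y \<le> B" using assms(1) by (auto simp: bounded_iff)
  define s where "s = (B + norm x + 1) / norm d"
  have "0 \<le> B" using B[OF assms(2)[of 0]] norm_ge_zero[of x] by (simp add: order_trans[OF norm_ge_zero])
  then have "0 \<le> s" by (simp add: s_def)
  then have "norm (x + s *\<^sub>R d) \<le> B" using assms(2) B by blast
  moreover have "norm (s *\<^sub>R d) \<le> norm (x + s *\<^sub>R d) + norm x"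
    using norm_triangle_ineq4[of "x + s *\<^sub>R d" x] by simp
  moreover have "norm (s *\<^sub>R d) = B + norm x + 1" using d \<open>0 \<le> B\<close> by (simp add: s_def abs_of_nonneg)
  ultimately show False by simp
qed

text \<open>
  A direction with these properties is a recession direction of the bounded positive region.
\<close>

lemma recession_trivial:
  assumes "bounded (region a c (\<lambda>_. Pos))" "p \<in> region a c (\<lambda>_. Pos)" "\<And>i. 0 \<le> a i \<bullet> d"
  shows "d = 0"
  using assms(1)
proof (rule bounded_ray_trivial[of _ p])
  fix s :: real assume "0 \<le> s"
  then have nn: "0 \<le> s * (a i \<bullet> d)" for i using assms(3) by simp
  have lt: "c i < a i \<bullet> p" for i using assms(2) by (simp add: in_region_iff)
  have "c i < a i \<bullet> p + s * (a i \<bullet> d)" for i using nn[of i] lt[of i] by linarith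
  then show "p + s *\<^sub>R d \<in> region a c (\<lambda>_. Pos)" by (simp add: in_region_iff inner_add_right)
qed

text \<open>
  The difference of a point of the positive and a point of the negative region would be a recession
  direction of the positive region.
\<close>

lemma region_Neg_empty:
  assumes bd: "bounded (region a c (\<lambda>_. Pos))" and p: "p \<in> region a c (\<lambda>_. Pos)"
  shows "region a c (\<lambda>_. Neg) = {}"
proof (rule ccontr)
  assume "\<not> ?thesis"
  then obtain q where q: "q \<in> region a c (\<lambda>_. Neg)" by auto
  have lt: "0 < a i \<bullet> (p - q)" for i
    using p q by (simp add: in_region_iff inner_diff_right) (meson less_trans)
  then have "p - q = 0" by (intro recession_trivial[OF bd p]) (simp add: less_imp_le)
  with lt show False by auto
qed

text \<open>
  The linear span of \<open>N \<times> {1}\<close>, for affine \<open>N\<close> and any base point \<open>n0\<close> in \<open>N\<close>.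
\<close>

definition homogenized_affine :: "'a::euclidean_space set \<Rightarrow> 'a \<Rightarrow> ('a \<times> real) set" where
  "homogenized_affine N n0 = {z. fst z - snd z *\<^sub>R n0 \<in> (\<lambda>n. n - n0) ` N}"

lemma affine_translate_subspace:
  assumes "affine N" "n0 \<in> N"
  shows "subspace ((\<lambda>n. n - n0) ` N)"
proof -
  have "subspace ((\<lambda>x. - n0 + x) ` N)" using assms affine_diffs_subspace by (simp add: affine_diffs_subspace_subtract)
  then show ?thesis by (simp add: algebra_simps)
qed

lemma subspace_homogenized_affine:
  assumes "affine N" "n0 \<in> N"
  shows "subspace (homogenized_affine N n0)"
proof -
  let ?f = "\<lambda>z. fst z - snd z *\<^sub>R n0"
  have "linear ?f" by (intro linearI) (auto simp: algebra_simps)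
  moreover have "homogenized_affine N n0 = ?f -` ((\<lambda>n. n - n0) ` N)" by (auto simp: homogenized_affine_def)
  ultimately show ?thesis using affine_translate_subspace[OF assms] by (simp add: linear_subspace_vimage)
qed

lemma homogenized_affine_point: "n \<in> N \<Longrightarrow> (n, 1) \<in> homogenized_affine N n0"
  by (simp add: homogenized_affine_def)

lemma homogenized_affine_dehomogenize:
  assumes N: "affine N" "n0 \<in> N" and z: "z \<in> homogenized_affine N n0" "0 < snd z"
  shows "fst z /\<^sub>R snd z \<in> N"
proof -
  have "(1 / snd z) *\<^sub>R (fst z - snd z *\<^sub>R n0) \<in> (\<lambda>n. n - n0) ` N"
    using z affine_translate_subspace[OF N] by (intro subspace_scale) (auto simp: homogenized_affine_def)
  moreover have "(1 / snd z) *\<^sub>R (fst z - snd z *\<^sub>R n0) = fst z /\<^sub>R snd z - n0"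
    using z by (simp add: scaleR_diff_right divide_inverse)
  ultimately show ?thesis by auto
qed

lemma dim_homogenized_affine:
  fixes N :: "'a::euclidean_space set"
  assumes N: "affine N" "n0 \<in> N"
  shows "aff_dim N + 1 \<le> int (dim (homogenized_affine N n0))"
proof -
  let ?V = "(\<lambda>n. n - n0) ` N"
  let ?W = "homogenized_affine N n0"
  let ?j = "\<lambda>v::'a. (v, 0::real)"
  have W: "subspace ?W" by (rule subspace_homogenized_affine[OF N])
  have V: "subspace ?V" by (rule affine_translate_subspace[OF N])
  have lin: "linear ?j" by (intro linearI) auto
  have sV: "subspace (?j ` ?V)" using lin V by (rule linear_subspace_image)
  have "?j ` ?V \<subset> ?W"
    using homogenized_affine_point[OF N(2), of n0] by (force simp: homogenized_affine_def)
  then have "dim (?j ` ?V) < dim ?W" using W sV by (metis dim_psubset span_eq_iff)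
  moreover have "dim (?j ` ?V) = dim ?V" using lin by (intro dim_image_eq) (auto simp: inj_on_def)
  moreover have "aff_dim N = int (dim ?V)"
    using N(2) by (metis aff_dim_eq_dim_subtract hull_inc)
  ultimately show ?thesis by simp
qed

lemma hemisphere_closure_affine:
  fixes N :: "'a::euclidean_space set"
  assumes N: "affine N" "n0 \<in> N"
  shows "hemisphere_closure N = {z \<in> homogenized_affine N n0. norm z = 1 \<and> 0 \<le> snd z}"
proof
  let ?W = "homogenized_affine N n0"
  have W: "subspace ?W" by (rule subspace_homogenized_affine[OF N])
  let ?T = "?W \<inter> sphere 0 1 \<inter> {z. 0 \<le> (0, 1) \<bullet> z}"
  have eq: "?T = {z \<in> ?W. norm z = 1 \<and> 0 \<le> snd z}" by (auto simp: inner_prod_def)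
  have "hemisphere_closure N \<subseteq> ?T"
  proof (rule hemisphere_closure_subset)
    show "closed ?T" by (intro closed_Int closed_subspace W closed_sphere closed_halfspace_ge)
    fix x assume "x \<in> N"
    then have "to_hemisphere x \<in> ?W"
      unfolding to_hemisphere_def by (intro subspace_scale W homogenized_affine_point)
    then show "to_hemisphere x \<in> ?T"
      unfolding eq using norm_to_hemisphere[of x] snd_to_hemisphere[of x] by simp
  qed
  then show "hemisphere_closure N \<subseteq> {z \<in> ?W. norm z = 1 \<and> 0 \<le> snd z}" using eq by simp
  show "{z \<in> ?W. norm z = 1 \<and> 0 \<le> snd z} \<subseteq> hemisphere_closure N"
  proof
    fix z assume z: "z \<in> {z \<in> ?W. norm z = 1 \<and> 0 \<le> snd z}"
    show "z \<in> hemisphere_closure N"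
    proof (rule in_hemisphere_closureI[of z "\<lambda>\<delta>. z + \<delta> *\<^sub>R (n0, 1)"])
      show "norm z = 1" using z by simp
      have "((\<lambda>\<delta>. z + \<delta> *\<^sub>R (n0, 1)) \<longlongrightarrow> z + 0 *\<^sub>R (n0, 1)) (at_right (0::real))"
        by (intro tendsto_intros)
      then show "((\<lambda>\<delta>. z + \<delta> *\<^sub>R (n0, 1)) \<longlongrightarrow> z) (at_right (0::real))" by (simp del: scaleR_Pair)
      fix \<delta> :: real assume \<delta>: "0 < \<delta>"
      have "z + \<delta> *\<^sub>R (n0, 1) \<in> ?W"
        using z N by (intro subspace_add subspace_scale W homogenized_affine_point) auto
      moreover have s: "0 < snd (z + \<delta> *\<^sub>R (n0, 1))" using z \<delta> by simp
      ultimately show "0 < snd (z + \<delta> *\<^sub>R (n0, 1)) \<and> fst (z + \<delta> *\<^sub>R (n0, 1)) /\<^sub>R snd (z + \<delta> *\<^sub>R (n0, 1)) \<in> N"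
        using homogenized_affine_dehomogenize[OF N] by blast
    qed
  qed
qed

lemma affine_meets_Lambda:
  fixes a :: "'n::finite \<Rightarrow> 'a::euclidean_space"
  assumes "\<And>i. a i \<noteq> 0" "region a c (\<lambda>_. Pos) \<noteq> {}" "region a c b \<noteq> {}" "affine N" "n0 \<in> N"
  shows "hemisphere_closure N \<inter> Lambda a c b = {z \<in> homogenized_affine N n0. norm z = 1 \<and> z \<in> visible_boundary a c b}"
  unfolding Lambda_eq[OF assms(1-3)] hemisphere_closure_affine[OF assms(4,5)]
  by (auto simp: visible_boundary_def homogenized_region_def)

text \<open>
  Minus the number \<open>m z\<close> is how far \<open>z\<close> can be pushed in direction \<open>(p, 1)\<close> before the first negative constraint
  becomes tight; normalizing the result gives the retraction. The cone is pointed since a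
  line in it would be at infinity and would be a recession direction of the positive region.
\<close>

lemma acyclic_in_visible:
  fixes a :: "'n::finite \<Rightarrow> 'a::euclidean_space" and K :: "'k::field itself"
  assumes bd: "bounded (region a c (\<lambda>_. Pos))" and p: "p \<in> region a c (\<lambda>_. Pos)"
    and W: "subspace W" "(p, 1) \<in> W" and b: "b \<noteq> (\<lambda>_. Pos)"
    and ne: "{z \<in> W. norm z = 1 \<and> z \<in> visible_boundary a c b} \<noteq> {}"
  shows "acyclic_in K j {z \<in> W. norm z = 1 \<and> z \<in> visible_boundary a c b}" (is "acyclic_in K j ?X")
proof -
  let ?L = "homogenized_normal a c"
  let ?J = "{i. b i = Neg}"
  define C where "C = W \<inter> homogenized_region a c b"
  obtain q where q: "q \<in> ?X" using ne by blast
  have q0: "q \<in> C" "q \<noteq> 0" using q by (auto simp: C_def visible_boundary_def)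
  have J: "finite ?J" "?J \<noteq> {}" using b not_Pos_iff by (auto simp: fun_eq_iff)
  have Lp: "0 < ?L i \<bullet> (p, 1)" for i using p by (simp add: homogenized_normal_point in_region_iff)
  have convC: "convex C"
    unfolding C_def by (intro convex_Int subspace_imp_convex W convex_homogenized_region)
  have conC: "conic C"
    unfolding C_def using subspace_imp_conic[OF W(1)] conic_homogenized_region[of a c b] by (auto simp: conic_def)
  have pointed: "- q \<notin> C"
  proof
    assume "- q \<in> C"
    with q0(1) have s: "snd q = 0" by (simp add: C_def homogenized_region_def)
    have L: "?L i \<bullet> q = 0" for i
    proof -
      have "if b i = Pos then 0 \<le> ?L i \<bullet> q else ?L i \<bullet> q \<le> 0"
        using q0(1) by (simp add: C_def homogenized_region_def)
      moreover have "if b i = Pos then 0 \<le> ?L i \<bullet> - q else ?L i \<bullet> - q \<le> 0"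
        using \<open>- q \<in> C\<close> unfolding C_def homogenized_region_def by blast
      ultimately show ?thesis by (auto split: if_splits)
    qed
    have "0 \<le> a i \<bullet> fst q" for i using L[of i] s by (simp add: homogenized_normal_inner)
    then have "fst q = 0" by (rule recession_trivial[OF bd p])
    with s q0(2) show False by (simp add: prod_eq_iff)
  qed
  define m where "m z = Max ((\<lambda>i. (?L i \<bullet> z) / (?L i \<bullet> (p, 1))) ` ?J)" for z
  define g where "g z = z + (- m z) *\<^sub>R (p, 1)" for z
  define r where "r z = g z /\<^sub>R norm (g z)" for z
  have Lg: "?L i \<bullet> g z = ?L i \<bullet> z - m z * (?L i \<bullet> (p, 1))" for i z
    by (simp add: g_def inner_diff_right del: scaleR_Pair)
  have m_att: "\<exists>i. b i = Neg \<and> m z = (?L i \<bullet> z) / (?L i \<bullet> (p, 1))" for z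
  proof -
    have "m z \<in> (\<lambda>i. (?L i \<bullet> z) / (?L i \<bullet> (p, 1))) ` ?J" unfolding m_def using J by (intro Max_in) auto
    then show ?thesis by auto
  qed
  have mge: "?L i \<bullet> z \<le> m z * (?L i \<bullet> (p, 1))" if "b i = Neg" for i z
  proof -
    have "(?L i \<bullet> z) / (?L i \<bullet> (p, 1)) \<le> m z" unfolding m_def using J that by (intro Max_ge) auto
    with Lp[of i] show ?thesis by (simp add: divide_le_eq)
  qed
  have m0: "m z \<le> 0" if z: "z \<in> C" for z
  proof -
    obtain i where i: "b i = Neg" "m z = (?L i \<bullet> z) / (?L i \<bullet> (p, 1))" using m_att by blast
    have "?L i \<bullet> z \<le> 0" using z i(1) by (force simp: C_def homogenized_region_def)
    with i(2) Lp[of i] show ?thesis by (simp add: divide_le_0_iff)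
  qed
  have g0: "g z \<noteq> 0" if z: "z \<in> C - {0}" for z
  proof
    assume gz: "g z = 0"
    then have "snd z = m z" by (simp add: g_def prod_eq_iff)
    moreover have "0 \<le> snd z" using z by (auto simp: C_def homogenized_region_def)
    ultimately have "m z = 0" using m0[of z] z by simp
    with gz z show False by (simp add: g_def del: scaleR_Pair)
  qed
  have gC: "g z \<in> W" "g z \<in> visible_boundary a c b" if z: "z \<in> C - {0}" for z
  proof -
    show "g z \<in> W" using z W unfolding g_def C_def by (intro subspace_add subspace_scale) auto
    obtain i where i: "b i = Neg" "m z = (?L i \<bullet> z) / (?L i \<bullet> (p, 1))" using m_att by blast
    have "?L i \<bullet> g z = 0" using i(2) Lp[of i] by (simp add: Lg)
    moreover have "0 \<le> snd (g z)"
    proof -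
      have "0 \<le> snd z" "m z \<le> 0" using z m0[of z] by (auto simp: C_def homogenized_region_def)
      then show ?thesis by (simp add: g_def)
    qed
    moreover have "if b k = Pos then 0 \<le> ?L k \<bullet> g z else ?L k \<bullet> g z \<le> 0" for k
    proof (cases "b k = Pos")
      case True
      then have "0 \<le> ?L k \<bullet> z" using z by (force simp: C_def homogenized_region_def)
      moreover have "m z * (?L k \<bullet> (p, 1)) \<le> 0" using m0[of z] z Lp[of k] by (simp add: mult_le_0_iff)
      ultimately show ?thesis using True by (simp add: Lg)
    next
      case False
      then show ?thesis using mge[of k z] not_Pos_iff by (simp add: Lg)
    qed
    ultimately show "g z \<in> visible_boundary a c b" using i(1) by (auto simp: visible_boundary_def homogenized_region_def)
  qed
  have "acyclic_in K j (C - {0})"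
  proof (rule acyclic_in_starlike[of q])
    show "closed_segment z q \<subseteq> C - {0}" if "z \<in> C - {0}" for z
      using segment_in_punctured_cone[OF convC conC, of z q] that q0 pointed by auto
  qed (use q0 in auto)
  then show ?thesis
  proof (rule acyclic_in_retract)
    have "continuous_on (C - {0}) m"
      unfolding m_def using J Lp by (intro continuous_on_Max_image) (auto intro!: continuous_intros simp: less_imp_neq[symmetric])
    then have "continuous_on (C - {0}) g" unfolding g_def by (intro continuous_intros)
    then show "continuous_on (C - {0}) r" unfolding r_def using g0 by (intro continuous_intros) auto
    show "r ` (C - {0}) \<subseteq> ?X"
    proof
      fix y assume "y \<in> r ` (C - {0})"
      then obtain z where z: "z \<in> C - {0}" "y = r z" by auto
      have "0 < inverse (norm (g z))" using g0[OF z(1)] by simp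
      then have "y \<in> visible_boundary a c b"
        using gC(2)[OF z(1)] unfolding z(2) r_def
        by (auto simp: visible_boundary_def homogenized_region_def zero_le_mult_iff mult_le_0_iff split: if_splits)
      moreover have "y \<in> W" using gC(1)[OF z(1)] W unfolding z(2) r_def by (intro subspace_scale)
      moreover have "norm y = 1" using g0[OF z(1)] unfolding z(2) r_def by simp
      ultimately show "y \<in> ?X" by simp
    qed
    show "?X \<subseteq> C - {0}" by (auto simp: C_def visible_boundary_def)
    show "r z = z" if z: "z \<in> ?X" for z
    proof -
      obtain i where i: "b i = Neg" "?L i \<bullet> z = 0" using z by (auto simp: visible_boundary_def)
      have "0 \<le> m z * (?L i \<bullet> (p, 1))" using mge[OF i(1), of z] i(2) by simp
      then have "0 \<le> m z" using Lp[of i] by (simp add: zero_le_mult_iff)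
      moreover have "m z \<le> 0" using z by (intro m0) (auto simp: C_def visible_boundary_def)
      ultimately have "g z = z" by (simp add: g_def del: scaleR_Pair)
      then show ?thesis using z by (simp add: r_def)
    qed
  qed
qed

text \<open>
  The first of two facts needed from the geometry is that no nonzero vector of the homogenization of
  \<open>N\<close> has all forms nonnegative: one of positive height would be a point of \<open>N\<close> in the closed positive
  region, and one of height zero, or a suitable translate of one of negative height, would be a recession
  direction of that region. The second is that a vector \<open>w\<close> at which a sign pattern is attained only
  weakly on the positive side, moved a little in direction \<open>(p, 1)\<close>, attains the pattern strictly, so that
  the region of this pattern is nonempty even if \<open>w\<close> is at infinity.
\<close>

lemma exists_nonacyclic_visible:
  fixes a :: "'n::finite \<Rightarrow> 'a::euclidean_space" and K :: "'k::field itself"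
  assumes bd: "bounded (region a c (\<lambda>_. Pos))" and p: "p \<in> region a c (\<lambda>_. Pos)"
    and N: "affine N" "n0 \<in> N" and disj: "closure (region a c (\<lambda>_. Pos)) \<inter> N = {}"
    and j: "0 \<le> j" "j + 1 \<le> aff_dim N"
  shows "\<exists>b. b \<noteq> (\<lambda>_. Pos) \<and> region a c b \<noteq> {} \<and>
    \<not> acyclic_in K j {z \<in> homogenized_affine N n0. norm z = 1 \<and> z \<in> visible_boundary a c b}"
proof -
  let ?W = "homogenized_affine N n0"
  let ?L = "homogenized_normal a c"
  have W: "subspace ?W" by (rule subspace_homogenized_affine[OF N])
  have Lp: "0 < ?L i \<bullet> (p, 1)" for i using p by (simp add: homogenized_normal_point in_region_iff)
  have pos: "z = 0" if z: "z \<in> ?W" "\<And>i. 0 \<le> ?L i \<bullet> z" for z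
  proof -
    consider "0 < snd z" | "snd z = 0" | "snd z < 0" by linarith
    then show ?thesis
    proof cases
      case 1
      have "c i \<le> a i \<bullet> (fst z /\<^sub>R snd z)" for i
        using z(2)[of i] 1 unfolding homogenized_normal_dehomogenize[OF 1] by (simp add: zero_le_mult_iff)
      then have "fst z /\<^sub>R snd z \<in> closure (region a c (\<lambda>_. Pos))"
        using p by (subst closure_region) auto
      moreover have "fst z /\<^sub>R snd z \<in> N" by (rule homogenized_affine_dehomogenize[OF N z(1) 1])
      ultimately show ?thesis using disj by auto
    next
      case 2
      then have "0 \<le> a i \<bullet> fst z" for i using z(2)[of i] by (simp add: homogenized_normal_inner)
      then have "fst z = 0" by (rule recession_trivial[OF bd p])
      with 2 show ?thesis by (simp add: prod_eq_iff)
    next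
      case 3
      \<comment> \<open>Adding a multiple of \<open>(p, 1)\<close> brings the vector to height zero and makes all forms positive.\<close>
      let ?d = "fst z + (- snd z) *\<^sub>R p"
      have lt: "0 < a i \<bullet> ?d" for i
      proof -
        have "0 < - snd z * (?L i \<bullet> (p, 1))" using 3 Lp[of i] by (simp add: mult_neg_pos)
        with z(2)[of i] have "0 < ?L i \<bullet> z + - snd z * (?L i \<bullet> (p, 1))" by simp
        also have "\<dots> = a i \<bullet> ?d" by (simp add: homogenized_normal_inner inner_diff_right algebra_simps)
        finally show ?thesis .
      qed
      then have "?d = 0" by (intro recession_trivial[OF bd p]) (simp add: less_imp_le)
      with lt show ?thesis by auto
    qed
  qed
  have "\<exists>z\<in>?W. (0::'a, 1::real) \<bullet> z \<noteq> 0"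
    using homogenized_affine_point[OF N(2), of n0] by (auto intro!: bexI[of _ "(n0, 1)"])
  moreover have "j + 2 \<le> int (dim ?W)" using dim_homogenized_affine[OF N] j by simp
  ultimately obtain M w where w: "w \<in> ?W" "w \<noteq> 0" "0 \<le> (0::'a, 1::real) \<bullet> w" "\<forall>i. i \<in> M \<longleftrightarrow> ?L i \<bullet> w < 0"
    and nac: "\<not> acyclic_in K j {z \<in> ?W. norm z = 1 \<and> 0 \<le> (0::'a, 1::real) \<bullet> z
        \<and> (\<forall>i. i \<notin> M \<longrightarrow> 0 \<le> ?L i \<bullet> z) \<and> (\<forall>i\<in>M. ?L i \<bullet> z \<le> 0) \<and> (\<exists>i\<in>M. ?L i \<bullet> z = 0)}"
    using exists_nonacyclic_sign_pattern[OF W pos, of ?L "(0, 1)" j K] j(1) by blast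
  define b where "b i = (if i \<in> M then Neg else Pos)" for i
  have b: "b i = Pos \<longleftrightarrow> i \<notin> M" "b i = Neg \<longleftrightarrow> i \<in> M" for i by (auto simp: b_def)
  have "b \<noteq> (\<lambda>_. Pos)"
  proof
    assume "b = (\<lambda>_. Pos)"
    then have "i \<notin> M" for i using b(1)[of i] by simp
    then have "0 \<le> ?L i \<bullet> w" for i using w(4) by (simp add: not_less)
    then show False using pos[OF w(1)] w(2) by blast
  qed
  moreover have "region a c b \<noteq> {}"
  proof -
    have "eventually (\<lambda>\<epsilon>. \<forall>i\<in>M. ?L i \<bullet> (w + \<epsilon> *\<^sub>R (p, 1)) < 0) (at_right (0::real))"
    proof (rule eventually_ball_finite)
      show "\<forall>i\<in>M. eventually (\<lambda>\<epsilon>. ?L i \<bullet> (w + \<epsilon> *\<^sub>R (p, 1)) < 0) (at_right (0::real))"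
      proof
        fix i assume "i \<in> M"
        then have "?L i \<bullet> w < 0" using w(4) by simp
        moreover have "((\<lambda>\<epsilon>. ?L i \<bullet> (w + \<epsilon> *\<^sub>R (p, 1))) \<longlongrightarrow> ?L i \<bullet> (w + 0 *\<^sub>R (p, 1))) (at_right (0::real))"
          by (intro tendsto_intros)
        ultimately show "eventually (\<lambda>\<epsilon>. ?L i \<bullet> (w + \<epsilon> *\<^sub>R (p, 1)) < 0) (at_right (0::real))"
          by (intro order_tendstoD(2)[of _ "?L i \<bullet> w"]) (auto simp del: scaleR_Pair)
      qed
    qed simp
    then obtain d :: real where d: "d > 0" "\<And>\<epsilon>. 0 < \<epsilon> \<Longrightarrow> \<epsilon> < d \<Longrightarrow> \<forall>i\<in>M. ?L i \<bullet> (w + \<epsilon> *\<^sub>R (p, 1)) < 0"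
      unfolding eventually_at_right_field by auto
    define z where "z = w + (d / 2) *\<^sub>R (p, 1)"
    have s: "0 < snd z" using w(3) d(1) by (cases w) (simp add: z_def)
    have "if b i = Pos then c i < a i \<bullet> (fst z /\<^sub>R snd z) else a i \<bullet> (fst z /\<^sub>R snd z) < c i" for i
    proof (cases "i \<in> M")
      case True
      then have "?L i \<bullet> z < 0" using d unfolding z_def by auto
      with True s show ?thesis unfolding homogenized_normal_dehomogenize[OF s] by (simp add: b mult_less_0_iff)
    next
      case False
      then have "0 \<le> ?L i \<bullet> w" using w(4) by (simp add: not_less)
      moreover have "0 < d / 2 * (?L i \<bullet> (p, 1))" using d(1) Lp[of i] by simp
      ultimately have "0 < ?L i \<bullet> z" by (simp add: z_def inner_add_right del: scaleR_Pair)
      with False s show ?thesis unfolding homogenized_normal_dehomogenize[OF s] by (simp add: b zero_less_mult_iff)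
    qed
    then have "fst z /\<^sub>R snd z \<in> region a c b" unfolding in_region_iff by blast
    then show ?thesis by blast
  qed
  moreover have "{z \<in> ?W. norm z = 1 \<and> 0 \<le> (0::'a, 1::real) \<bullet> z
        \<and> (\<forall>i. i \<notin> M \<longrightarrow> 0 \<le> ?L i \<bullet> z) \<and> (\<forall>i\<in>M. ?L i \<bullet> z \<le> 0) \<and> (\<exists>i\<in>M. ?L i \<bullet> z = 0)}
      = {z \<in> ?W. norm z = 1 \<and> z \<in> visible_boundary a c b}"
    by (auto simp: visible_boundary_def homogenized_region_def b inner_prod_def split: if_splits)
  ultimately show ?thesis using nac by auto
qed

theorem corollary3p57:
  fixes a :: "'n::finite \<Rightarrow> real ^ 'd"
    and c :: "'n \<Rightarrow> real"
    and N :: "(real ^ 'd) set"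
    and l :: nat
  assumes normals_nonzero: "\<And>i. a i \<noteq> 0"
    and normals_span: "affine hull (range a) = UNIV"
    and region_nonempty: "region a c (\<lambda>_. Pos) \<noteq> {}"
    and region_bounded: "bounded (region a c (\<lambda>_. Pos))"
    and N_affine: "affine N"
    and N_dim: "aff_dim N = int l - 1"
  shows "(region a c (\<lambda>_. Pos) \<inter> N \<noteq> {} \<longrightarrow>
            (\<forall>b. b \<noteq> (\<lambda>_. Pos) \<and> b \<noteq> (\<lambda>_. Neg) \<longrightarrow>
              hemisphere_closure N \<inter> Lambda a c b \<noteq> {} \<longrightarrow>
              (\<forall>j. trivial_group
                (reduced_cohomology_group TYPE('k::field) j
                  (top_of_set (hemisphere_closure N \<inter> Lambda a c b)))))) \<and>
         (closure (region a c (\<lambda>_. Pos)) \<inter> N = {} \<longrightarrow>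
            (\<forall>j. 0 \<le> j \<and> j \<le> int l - 2 \<longrightarrow>
              (\<exists>b. b \<noteq> (\<lambda>_. Pos) \<and> b \<noteq> (\<lambda>_. Neg) \<and>
                hemisphere_closure N \<inter> Lambda a c b \<noteq> {} \<and>
                \<not> trivial_group
                  (reduced_cohomology_group TYPE('k) j
                    (top_of_set (hemisphere_closure N \<inter> Lambda a c b))))))"
proof (intro conjI impI allI)
  fix b j
  assume "region a c (\<lambda>_. Pos) \<inter> N \<noteq> {}" and b: "b \<noteq> (\<lambda>_. Pos) \<and> b \<noteq> (\<lambda>_. Neg)"
    and ne: "hemisphere_closure N \<inter> Lambda a c b \<noteq> {}"
  then obtain p where p: "p \<in> region a c (\<lambda>_. Pos)" "p \<in> N" by auto
  have "region a c b \<noteq> {}" using ne Lambda_empty[of a c b] by auto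
  then have eq: "hemisphere_closure N \<inter> Lambda a c b = {z \<in> homogenized_affine N p. norm z = 1 \<and> z \<in> visible_boundary a c b}"
    using affine_meets_Lambda[OF normals_nonzero region_nonempty _ N_affine p(2)] by blast
  have "acyclic_in TYPE('k) j (hemisphere_closure N \<inter> Lambda a c b)"
    unfolding eq
    by (rule acyclic_in_visible[OF region_bounded p(1) subspace_homogenized_affine[OF N_affine p(2)] homogenized_affine_point[OF p(2)]])
       (use b ne eq in auto)
  then show "trivial_group (reduced_cohomology_group TYPE('k) j (top_of_set (hemisphere_closure N \<inter> Lambda a c b)))"
    by (simp add: trivial_reduced_cohomology_iff)
next
  fix j
  assume disj: "closure (region a c (\<lambda>_. Pos)) \<inter> N = {}" and j: "0 \<le> j \<and> j \<le> int l - 2"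
  obtain p where p: "p \<in> region a c (\<lambda>_. Pos)" using region_nonempty by auto
  have "N \<noteq> {}" using N_dim j by auto
  then obtain n0 where n0: "n0 \<in> N" by auto
  obtain b where b: "b \<noteq> (\<lambda>_. Pos)" "region a c b \<noteq> {}"
    "\<not> acyclic_in TYPE('k) j {z \<in> homogenized_affine N n0. norm z = 1 \<and> z \<in> visible_boundary a c b}"
    using exists_nonacyclic_visible[OF region_bounded p N_affine n0 disj, of j "TYPE('k)"] j N_dim by auto
  have eq: "hemisphere_closure N \<inter> Lambda a c b = {z \<in> homogenized_affine N n0. norm z = 1 \<and> z \<in> visible_boundary a c b}"
    by (rule affine_meets_Lambda[OF normals_nonzero region_nonempty b(2) N_affine n0])
  have "b \<noteq> (\<lambda>_. Neg)" using b(2) region_Neg_empty[OF region_bounded p] by auto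
  moreover have nac: "\<not> acyclic_in TYPE('k) j (hemisphere_closure N \<inter> Lambda a c b)" using b(3) eq by simp
  moreover have "hemisphere_closure N \<inter> Lambda a c b \<noteq> {}"
  proof
    assume "hemisphere_closure N \<inter> Lambda a c b = {}"
    moreover have "acyclic_in TYPE('k) j ({} :: ((real ^ 'd) \<times> real) set)"
      using j by (auto simp: acyclic_in_def cohomologous_def aug_simplices_def singular_simplex_empty)
    ultimately show False using nac by simp
  qed
  ultimately show "\<exists>b. b \<noteq> (\<lambda>_. Pos) \<and> b \<noteq> (\<lambda>_. Neg) \<and> hemisphere_closure N \<inter> Lambda a c b \<noteq> {} \<and>
      \<not> trivial_group (reduced_cohomology_group TYPE('k) j (top_of_set (hemisphere_closure N \<inter> Lambda a c b)))"
    using b(1) by (auto simp: trivial_reduced_cohomology_iff)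
qed

end
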